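(* Let $F$ be a graph with $\chi(F)\ge 3$ and $r$ a positive integer. Suppose $\mathrm{biex}(n,F)=O(1)$, and suppose that for all sufficiently large $n$ every $n$-vertex $F$-free graph with $\mathrm{ex}(n,F)$ edges is obtained by taking the Turán graph $T(n,\chi(F)-1)$ and adding, inside one of its parts, a $\mathcal{D}(F)$-free graph with $\mathrm{biex}(n,F)$ edges. Then for all sufficiently large $n$, every $n$-vertex $F$-free graph $G$ with $\mathcal{N}(S_r,G)=\mathrm{ex}(n,S_r,F)$, and every $n$-vertex $F$-free graph $G$ with $e_r(G)=\mathrm{ex}_r(n,F)$, is obtained by taking a complete $(\chi(F)-1)$-partite graph on $n$ vertices and adding, inside one of its parts, a $\mathcal{D}(F)$-free graph with $\mathrm{biex}(n,F)$ edges.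
   Context: $\mathrm{ex}(n,F)$ is the maximum number of edges of an $n$-vertex $F$-free graph. $T(n,k)$ is the complete $k$-partite $n$-vertex graph with parts of order $\lfloor n/k\rfloor$ or $\lceil n/k\rceil$. $S_r$ is the star with $r$ leaves; $\mathcal{N}(S_r,G)$ is the number of copies of $S_r$ in $G$, and $\mathrm{ex}(n,S_r,F)$ is its maximum over $n$-vertex $F$-free graphs. For $G$ with degree sequence $d_1,\dots,d_n$, $e_r(G)=\sum_i d_i^r$, and $\mathrm{ex}_r(n,F)$ is its maximum over $n$-vertex $F$-free graphs. For $F$ with $\chi(F)=k+1$, the decomposition family $\mathcal{D}(F)$ is the family of bipartite graphs induced in $F$ by the union of two color classes of some proper $(k+1)$-coloring of $F$; a graph is $\mathcal{D}(F)$-free if it contains no member of $\mathcal{D}(F)$; $\mathrm{biex}(n,F)=\mathrm{ex}(n,\mathcal{D}(F))$. *)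

theory Defs
  imports "HOL-Library.Landau_Symbols" "HOL-Library.Disjoint_Sets"
begin

type_synonym 'a ugraph = "'a set \<times> 'a set set"

abbreviation verts :: "'a ugraph \<Rightarrow> 'a set" where "verts G \<equiv> fst G"
abbreviation edges :: "'a ugraph \<Rightarrow> 'a set set" where "edges G \<equiv> snd G"

definition ugraph :: "'a ugraph \<Rightarrow> bool" where
  "ugraph G \<longleftrightarrow> finite (verts G) \<and> (\<forall>e\<in>edges G. e \<subseteq> verts G \<and> card e = 2)"

definition degree :: "'a ugraph \<Rightarrow> 'a \<Rightarrow> nat" where
  "degree G v = card {e \<in> edges G. v \<in> e}"

definition subgraph :: "'a ugraph \<Rightarrow> 'a ugraph \<Rightarrow> bool" where
  "subgraph X G \<longleftrightarrow> ugraph X \<and> verts X \<subseteq> verts G \<and> edges X \<subseteq> edges G"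

definition induced :: "'a ugraph \<Rightarrow> 'a set \<Rightarrow> 'a ugraph" where
  "induced G S = (S, {e \<in> edges G. e \<subseteq> S})"

definition graph_iso :: "'a ugraph \<Rightarrow> 'b ugraph \<Rightarrow> bool" where
  "graph_iso H G \<longleftrightarrow> (\<exists>f. bij_betw f (verts H) (verts G) \<and> (\<lambda>e. f ` e) ` edges H = edges G)"

text \<open>Copies are subgraphs that need not be induced.\<close>

definition copies :: "'a ugraph \<Rightarrow> 'b ugraph \<Rightarrow> 'b ugraph set" where
  "copies H G = {X. subgraph X G \<and> graph_iso H X}"

definition num_copies :: "'a ugraph \<Rightarrow> 'b ugraph \<Rightarrow> nat" where
  "num_copies H G = card (copies H G)"

definition free_of :: "'a ugraph set \<Rightarrow> 'b ugraph \<Rightarrow> bool" where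
  "free_of \<F> G \<longleftrightarrow> (\<forall>H\<in>\<F>. copies H G = {})"

definition star :: "nat \<Rightarrow> nat ugraph" where
  "star r = ({0..r}, {{0, i} | i. 1 \<le> i \<and> i \<le> r})"

definition degree_power_sum :: "nat \<Rightarrow> 'a ugraph \<Rightarrow> nat" where
  "degree_power_sum r G = (\<Sum>v\<in>verts G. degree G v ^ r)"

definition proper_colouring :: "'a ugraph \<Rightarrow> nat \<Rightarrow> ('a \<Rightarrow> nat) \<Rightarrow> bool" where
  "proper_colouring G k c \<longleftrightarrow>
     c ` verts G \<subseteq> {..<k} \<and> (\<forall>u v. {u, v} \<in> edges G \<longrightarrow> c u \<noteq> c v)"

definition chromatic_number :: "'a ugraph \<Rightarrow> nat" where
  "chromatic_number G = (LEAST k. \<exists>c. proper_colouring G k c)"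

definition decomposition_family :: "'a ugraph \<Rightarrow> 'a ugraph set" where
  "decomposition_family F =
     {induced F {v \<in> verts F. c v = i \<or> c v = j} | c i j.
        proper_colouring F (chromatic_number F) c \<and>
        i < chromatic_number F \<and> j < chromatic_number F \<and> i \<noteq> j}"

text \<open>Host graphs have vertices of type \<^typ>\<open>nat\<close>, which loses nothing up to isomorphism.
  There are infinitely many with a given number of vertices, but each parameter maximised
  below takes only finitely many values on them.\<close>

definition free_graphs :: "nat \<Rightarrow> 'a ugraph set \<Rightarrow> nat ugraph set" where
  "free_graphs n \<F> = {G. ugraph G \<and> card (verts G) = n \<and> free_of \<F> G}"

definition ex_family :: "nat \<Rightarrow> 'a ugraph set \<Rightarrow> nat" where
  "ex_family n \<F> = Max ((\<lambda>G. card (edges G)) ` free_graphs n \<F>)"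

definition ex_edges :: "nat \<Rightarrow> 'a ugraph \<Rightarrow> nat" where
  "ex_edges n F = ex_family n {F}"

definition biex :: "nat \<Rightarrow> 'a ugraph \<Rightarrow> nat" where
  "biex n F = ex_family n (decomposition_family F)"

definition ex_copies :: "nat \<Rightarrow> 'b ugraph \<Rightarrow> 'a ugraph \<Rightarrow> nat" where
  "ex_copies n H F = Max (num_copies H ` free_graphs n {F})"

definition ex_degree_power :: "nat \<Rightarrow> nat \<Rightarrow> 'a ugraph \<Rightarrow> nat" where
  "ex_degree_power r n F = Max (degree_power_sum r ` free_graphs n {F})"

definition multipartite_edges :: "'a set set \<Rightarrow> 'a set set" where
  "multipartite_edges P = {{u, v} | u v A B. A \<in> P \<and> B \<in> P \<and> A \<noteq> B \<and> u \<in> A \<and> v \<in> B}"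

text \<open>Since \<^const>\<open>partition_on\<close> forbids empty blocks, all \<open>k\<close> parts are nonempty.\<close>

definition complete_partite :: "nat \<Rightarrow> 'a set set \<Rightarrow> 'a ugraph \<Rightarrow> bool" where
  "complete_partite k P G \<longleftrightarrow>
     ugraph G \<and> partition_on (verts G) P \<and> card P = k \<and> edges G = multipartite_edges P"

text \<open>The Turan graph \<open>T(n,k)\<close>, for \<open>n \<ge> k\<close>, as a property of a graph and its parts.\<close>

definition turan :: "nat \<Rightarrow> nat \<Rightarrow> 'a set set \<Rightarrow> 'a ugraph \<Rightarrow> bool" where
  "turan n k P G \<longleftrightarrow> complete_partite k P G \<and> card (verts G) = n \<and>
     (\<forall>A\<in>P. card A = nat \<lfloor>real n / real k\<rfloor> \<or> card A = nat \<lceil>real n / real k\<rceil>)"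

text \<open>\<open>G\<close> arises from \<open>K\<close>, with parts \<open>P\<close>, by adding inside one part a
  \<open>\<D>(F)\<close>-free graph, on the vertex set of that part, with \<open>m\<close> edges.\<close>

definition add_in_part :: "'b ugraph \<Rightarrow> nat \<Rightarrow> 'a ugraph \<Rightarrow> 'a set set \<Rightarrow> 'a ugraph \<Rightarrow> bool" where
  "add_in_part F m K P G \<longleftrightarrow>
     (\<exists>H. ugraph H \<and> verts H \<in> P \<and> free_of (decomposition_family F) H \<and> card (edges H) = m \<and>
          verts G = verts K \<and> edges G = edges K \<union> edges H)"

end

theory Submission imports Defs begin

text \<open>
  Write \<open>k = \<chi>(F) - 1\<close>. The assumptions enter only through balanced subgraphs: in an \<open>F\<close>-free graph,
  \<open>k\<close> disjoint sets of \<open>m\<close> vertices span at most \<open>b\<close> more edges than the complete \<open>k\<close>-partite graph on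
  them, where \<open>b\<close> is the eventual value of \<open>biex\<close>. Hence an \<open>F\<close>-free graph has no large complete
  \<open>(k+1)\<close>-partite subgraph and so, by Erdos's theorem on dense hypergraphs, few cliques of order
  \<open>k+1\<close>. Peeling off the non-neighbours of vertices of maximum degree then gives stability for the
  degree functional without a removal lemma: an optimal graph is close to a complete \<open>k\<close>-partite graph
  whose parts all have linear size. Replacing neighbourhoods of single vertices shows that every
  vertex is adjacent to almost all vertices outside its part. Now there are boundedly many edges inside the
  parts and boundedly many missing edges between them, and to first order each of them changes
  the functional by weights depending on the parts only. Applying the bound on balanced subgraphs
  to the parts of large weight shows that the optimum needs \<open>b\<close> more edges inside parts than missing
  edges; a balanced subgraph containing all of these is extremal, and its known structure carries over.
\<close>

section \<open>Colourings and dense cliques\<close>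

text \<open>The complete multipartite graph that is best for the functional need not be balanced, so
  an optimal graph cannot be compared with ex(n,F) on all its vertices. The hypothesis is applied at
  orders k m only, where floor and ceiling coincide and all balanced colourings have equally many
  cross pairs. The number b exists because \<open>biex\<close> is bounded and, beyond the order of
  F, monotone.

  Both functionals become sums of g(d) with g(d+1) - g(d) = r d^(r-1) + O(n^(r-2)); star counts are
  multiplied by r!, or by 2 if r = 1. Linear changes of linearly many degrees are worth n^(r+1),
  which drives stability. A single edge is worth n^(r-1), whereas boundedly many changed edges cause
  a second-order error of O(n^(r-2)) only, so a discrepancy of one edge is visible. That precision
  requires bounds on the inside edges and missing pairs that do not depend on n; this is why the
  degree condition is established for every vertex and not just for typical ones. The class size m
  depends on these bounds alone, and n is taken large last.\<close>

definition neighbours :: "'a ugraph \<Rightarrow> 'a \<Rightarrow> 'a set" where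
  "neighbours G v = {u. {v, u} \<in> edges G}"

definition colour_class :: "'a set \<Rightarrow> ('a \<Rightarrow> nat) \<Rightarrow> nat \<Rightarrow> 'a set" where
  "colour_class W c i = {v \<in> W. c v = i}"

text \<open>A complete multipartite graph, encoded by a colouring instead of a partition: classes
  may be empty, and one colouring serves all subsets of the vertices.\<close>

definition cross_edges :: "'a set \<Rightarrow> ('a \<Rightarrow> nat) \<Rightarrow> 'a set set" where
  "cross_edges W c = {{u, v} | u v. u \<in> W \<and> v \<in> W \<and> c u \<noteq> c v}"

definition non_neighbours :: "'a ugraph \<Rightarrow> 'a set \<Rightarrow> ('a \<Rightarrow> nat) \<Rightarrow> 'a \<Rightarrow> 'a set" where
  "non_neighbours G W c v = {u \<in> W. c u \<noteq> c v \<and> u \<notin> neighbours G v}"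

definition degree_sum :: "(nat \<Rightarrow> real) \<Rightarrow> 'a ugraph \<Rightarrow> real" where
  "degree_sum g G = (\<Sum>v\<in>verts G. g (degree G v))"

lemma mem_neighbours: "u \<in> neighbours G v \<longleftrightarrow> {v, u} \<in> edges G"
  by (simp add: neighbours_def)

lemma neighbours_sym: "u \<in> neighbours G v \<longleftrightarrow> v \<in> neighbours G u"
  by (simp add: neighbours_def insert_commute)

lemma ugraph_edgeD:
  assumes "ugraph G" "{u, v} \<in> edges G"
  shows "u \<in> verts G" "v \<in> verts G" "u \<noteq> v"
  using assms unfolding ugraph_def by force+

lemma ugraph_finite: "ugraph G \<Longrightarrow> finite (verts G)"
  by (simp add: ugraph_def)

lemma ugraph_edge_cases:
  assumes "ugraph G" "e \<in> edges G"
  obtains u v where "e = {u, v}" "u \<noteq> v" "u \<in> verts G" "v \<in> verts G"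
proof -
  have "card e = 2" "e \<subseteq> verts G" using assms unfolding ugraph_def by auto
  then obtain u v where "e = {u, v}" "u \<noteq> v" by (auto simp: card_2_iff)
  with \<open>e \<subseteq> verts G\<close> show ?thesis using that by auto
qed

lemma ugraph_finite_edges:
  assumes "ugraph G"
  shows "finite (edges G)"
proof (rule finite_subset)
  show "edges G \<subseteq> Pow (verts G)" using assms by (auto simp: ugraph_def)
  show "finite (Pow (verts G))" using assms by (simp add: ugraph_def)
qed

lemma neighbours_subset: "ugraph G \<Longrightarrow> neighbours G v \<subseteq> verts G"
  by (auto simp: neighbours_def dest: ugraph_edgeD(2))

lemma not_self_neighbours: "ugraph G \<Longrightarrow> v \<notin> neighbours G v"
  by (auto simp: neighbours_def ugraph_def)

lemma finite_neighbours: "ugraph G \<Longrightarrow> finite (neighbours G v)"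
  by (rule finite_subset[OF neighbours_subset ugraph_finite])

lemma degree_eq_card_neighbours:
  assumes "ugraph G"
  shows "degree G v = card (neighbours G v)"
proof -
  have "bij_betw (\<lambda>u. {v, u}) (neighbours G v) {e \<in> edges G. v \<in> e}"
    unfolding bij_betw_def
  proof
    show "inj_on (\<lambda>u. {v, u}) (neighbours G v)"
      by (auto simp: inj_on_def doubleton_eq_iff)
    show "(\<lambda>u. {v, u}) ` neighbours G v = {e \<in> edges G. v \<in> e}"
    proof (intro equalityI subsetI)
      fix e assume e: "e \<in> {e \<in> edges G. v \<in> e}"
      then obtain a b where "e = {a, b}" using ugraph_edge_cases[OF assms] by blast
      with e have "e = {v, a} \<or> e = {v, b}" by auto
      then show "e \<in> (\<lambda>u. {v, u}) ` neighbours G v" using e by (auto simp: neighbours_def)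
    qed (auto simp: neighbours_def)
  qed
  then show ?thesis unfolding degree_def by (metis bij_betw_same_card)
qed

lemma handshake:
  assumes "ugraph G"
  shows "(\<Sum>v\<in>verts G. degree G v) = 2 * card (edges G)"
proof -
  have fin: "finite (verts G)" "finite (edges G)"
    by (rule ugraph_finite[OF assms], rule ugraph_finite_edges[OF assms])
  have "(\<Sum>v\<in>verts G. degree G v) = (\<Sum>v\<in>verts G. \<Sum>e\<in>edges G. if v \<in> e then 1 else 0)"
    unfolding degree_def using fin by (simp add: sum.If_cases Int_def conj_commute)
  also have "\<dots> = (\<Sum>e\<in>edges G. \<Sum>v\<in>verts G. if v \<in> e then 1 else 0)"
    by (rule sum.swap)
  also have "\<dots> = (\<Sum>e\<in>edges G. 2)"
  proof (rule sum.cong)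
    fix e assume "e \<in> edges G"
    then have "card e = 2" "e \<subseteq> verts G" using assms unfolding ugraph_def by auto
    then have "{v \<in> verts G. v \<in> e} = e" by auto
    then show "(\<Sum>v\<in>verts G. if v \<in> e then 1 else 0) = (2::nat)"
      using fin \<open>card e = 2\<close> by (simp add: sum.If_cases Int_def)
  qed simp
  finally show ?thesis by simp
qed

lemma colour_class_subset: "colour_class W c i \<subseteq> W" by (auto simp: colour_class_def)

lemma finite_colour_class: "finite W \<Longrightarrow> finite (colour_class W c i)" by (simp add: colour_class_def)

lemma cross_edges_iff: "{u, v} \<in> cross_edges W c \<longleftrightarrow> u \<in> W \<and> v \<in> W \<and> c u \<noteq> c v"
  unfolding cross_edges_def by (auto simp: doubleton_eq_iff)

lemma cross_edges_cases:
  assumes "e \<in> cross_edges W c"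
  obtains u v where "e = {u, v}" "u \<in> W" "v \<in> W" "c u \<noteq> c v"
  using assms unfolding cross_edges_def by auto

lemma ugraph_cross_edges: "finite W \<Longrightarrow> ugraph (W, cross_edges W c)"
  unfolding ugraph_def by (auto elim!: cross_edges_cases simp: card_insert_if)

lemma finite_cross_edges: "finite W \<Longrightarrow> finite (cross_edges W c)"
  using ugraph_finite_edges[OF ugraph_cross_edges, of W c] by simp

lemma card_eq_sum_colour_class:
  assumes "finite W" "c ` W \<subseteq> {..<k}"
  shows "card W = (\<Sum>i<k. card (colour_class W c i))"
proof -
  have "W = (\<Union>i<k. colour_class W c i)" using assms(2) by (auto simp: colour_class_def)
  then have "card W = card (\<Union>i<k. colour_class W c i)" by simp
  also have "\<dots> = (\<Sum>i<k. card (colour_class W c i))"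
    by (rule card_UN_disjoint) (use assms in \<open>auto simp: colour_class_def\<close>)
  finally show ?thesis .
qed

lemma degree_cross_edges:
  assumes "finite W" "v \<in> W"
  shows "degree (W, cross_edges W c) v = card W - card (colour_class W c (c v))"
proof -
  have "neighbours (W, cross_edges W c) v = W - colour_class W c (c v)"
    using assms by (auto simp: neighbours_def colour_class_def cross_edges_iff)
  then show ?thesis
    using degree_eq_card_neighbours[OF ugraph_cross_edges[OF assms(1)]] assms
    by (simp add: card_Diff_subset colour_class_subset finite_colour_class)
qed

text \<open>All degrees are equal. The point is that the count depends on \<open>k\<close> and
  \<open>m\<close> only, so it can be transferred between different vertex sets and colourings. The
  factor 2 avoids a division.\<close>

lemma card_cross_edges_balanced:
  assumes "finite W" "c ` W \<subseteq> {..<k}" "\<And>i. i < k \<Longrightarrow> card (colour_class W c i) = m"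
  shows "2 * card (cross_edges W c) = k * m * (k * m - m)"
proof -
  have W: "card W = k * m" using card_eq_sum_colour_class[OF assms(1,2)] assms(3) by simp
  have "2 * card (cross_edges W c) = (\<Sum>v\<in>W. degree (W, cross_edges W c) v)"
    using handshake[OF ugraph_cross_edges[OF assms(1)]] by simp
  also have "\<dots> = (\<Sum>v\<in>W. k * m - m)"
  proof (rule sum.cong)
    fix v assume v: "v \<in> W"
    then have "c v < k" using assms(2) by auto
    then show "degree (W, cross_edges W c) v = k * m - m"
      using degree_cross_edges[OF assms(1) v, of c] assms(3) W by simp
  qed simp
  finally show ?thesis using W by simp
qed

section \<open>Dense families of lists, boxes and ordered cliques\<close>

lemma card_lists_fibres:
  assumes "finite V" "Q \<subseteq> {xs. length xs = Suc j \<and> set xs \<subseteq> V}"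
  shows "card Q = (\<Sum>x\<in>V. card {w. x # w \<in> Q})"
proof -
  have Q: "Q = (\<lambda>(x, w). x # w) ` (SIGMA x:V. {w. x # w \<in> Q})"
    using assms(2) by (force simp: length_Suc_conv image_iff)
  have finQ: "finite Q"
    using assms finite_lists_length_eq[OF assms(1), of "Suc j"]
    by (auto intro: finite_subset simp: conj_commute)
  have fin: "finite {w. x # w \<in> Q}" for x
    by (rule finite_subset[of _ "tl ` Q"]) (use finQ in \<open>force+\<close>)
  have "card Q = card (SIGMA x:V. {w. x # w \<in> Q})"
    by (subst Q, rule card_image) (auto simp: inj_on_def)
  then show ?thesis using assms(1) fin by simp
qed

lemma pigeonhole_real:
  assumes "finite T" "f ` W \<subseteq> T" "finite W" "T \<noteq> {}"
  shows "\<exists>y\<in>T. real (card W) / real (card T) \<le> real (card {w \<in> W. f w = y})"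
proof (rule ccontr)
  assume "\<not> ?thesis"
  then have a: "\<And>y. y \<in> T \<Longrightarrow> real (card {w \<in> W. f w = y}) < real (card W) / real (card T)" by force
  have "card W = (\<Sum>y\<in>T. card {w \<in> W. f w = y})"
    using sum.group[OF assms(3,1,2), of "\<lambda>_. 1::nat"] by simp
  then have "real (card W) = (\<Sum>y\<in>T. real (card {w \<in> W. f w = y}))" by simp
  also have "\<dots> < (\<Sum>y\<in>T. real (card W) / real (card T))"
    by (rule sum_strict_mono) (use assms a in auto)
  finally show False using assms by simp
qed

text \<open>Among boundedly many vertices of large degree, some \<open>t\<close> share a positive proportion of their
  links; the induction continues in the common link.\<close>

lemma dense_lists_contain_box:
  fixes t :: nat
  assumes "\<delta> > 0"
  shows "\<exists>N. \<forall>V Q. finite (V :: 'a set) \<and> card V \<ge> N \<and> Q \<subseteq> {xs. length xs = j \<and> set xs \<subseteq> V} \<and>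
      real (card Q) \<ge> \<delta> * real (card V) ^ j \<longrightarrow>
      (\<exists>Bs. length Bs = j \<and> (\<forall>B\<in>set Bs. B \<subseteq> V \<and> card B = t) \<and> listset Bs \<subseteq> Q)"
  using assms
proof (induction j arbitrary: \<delta>)
  case 0
  show ?case
  proof (intro exI[of _ 0] allI impI)
    fix V Q assume a: "finite (V :: 'a set) \<and> card V \<ge> 0 \<and> Q \<subseteq> {xs. length xs = 0 \<and> set xs \<subseteq> V} \<and>
      real (card Q) \<ge> \<delta> * real (card V) ^ 0"
    then have "Q \<noteq> {}" using 0 by auto
    then have "[] \<in> Q" using a by auto
    then show "\<exists>Bs. length Bs = 0 \<and> (\<forall>B\<in>set Bs. B \<subseteq> V \<and> card B = t) \<and> listset Bs \<subseteq> Q" by auto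
  qed
next
  case (Suc j)
  \<comment> \<open>Tails extended by fewer than \<open>t\<close> of \<open>M\<close> chosen heads
    account for at most \<open>t * n ^ j\<close> incidences; this choice makes that at most half of
    the \<open>M * (\<delta> / 2 * n ^ j)\<close> available ones.\<close>
  define M where "M = nat \<lceil>4 * real t / \<delta>\<rceil> + 1"
  have M: "real M * \<delta> \<ge> 4 * real t" "M > 0"
  proof -
    have "real M \<ge> 4 * real t / \<delta>" unfolding M_def by linarith
    then show "real M * \<delta> \<ge> 4 * real t" using Suc.prems by (simp add: field_simps)
  qed (simp add: M_def)
  \<comment> \<open>A proportion \<open>\<delta> / 4\<close> of the tails extends at least
    \<open>t\<close> chosen heads; the pigeonhole over the \<open>2 ^ M\<close> sets of chosen heads
    costs the other factor.\<close>
  define \<delta>' where "\<delta>' = \<delta> / 4 / 2 ^ M"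
  have "\<delta>' > 0" using Suc.prems by (simp add: \<delta>'_def)
  from Suc.IH[OF this] obtain N' where N': "\<forall>V Q. finite (V :: 'a set) \<and> card V \<ge> N' \<and>
      Q \<subseteq> {xs. length xs = j \<and> set xs \<subseteq> V} \<and> real (card Q) \<ge> \<delta>' * real (card V) ^ j \<longrightarrow>
      (\<exists>Bs. length Bs = j \<and> (\<forall>B\<in>set Bs. B \<subseteq> V \<and> card B = t) \<and> listset Bs \<subseteq> Q)" ..
  define N where "N = max N' (nat \<lceil>2 * real M / \<delta>\<rceil> + 1)"
  show ?case
  proof (intro exI[of _ N] allI impI)
    fix V Q assume a: "finite (V :: 'a set) \<and> card V \<ge> N \<and> Q \<subseteq> {xs. length xs = Suc j \<and> set xs \<subseteq> V} \<and>
      real (card Q) \<ge> \<delta> * real (card V) ^ Suc j"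
    define n where "n = real (card V)"
    have finV: "finite V" and Q: "Q \<subseteq> {xs. length xs = Suc j \<and> set xs \<subseteq> V}"
      and cQ: "real (card Q) \<ge> \<delta> * n ^ Suc j" using a by (auto simp: n_def)
    have nM: "\<delta> / 2 * n \<ge> real M"
    proof -
      have "n \<ge> 2 * real M / \<delta>" using a unfolding n_def N_def by linarith
      then show ?thesis using Suc.prems by (simp add: field_simps)
    qed
    have npos: "n > 0"
    proof (rule ccontr)
      assume "\<not> n > 0" then have "n = 0" by (simp add: n_def)
      with nM M show False by simp
    qed
    define W where "W = {xs. length xs = j \<and> set xs \<subseteq> V}"
    have finW: "finite W" and cW: "real (card W) = n ^ j"
      unfolding W_def n_def using finite_lists_length_eq[OF finV, of j] card_lists_length_eq[OF finV, of j]
      by (simp_all add: conj_commute)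
    have fib: "{w. x # w \<in> Q} \<subseteq> W" for x
    proof
      fix w assume "w \<in> {w. x # w \<in> Q}"
      then have "x # w \<in> {xs. length xs = Suc j \<and> set xs \<subseteq> V}" using Q by blast
      then show "w \<in> W" by (simp add: W_def)
    qed
    define q where "q x = real (card {w. x # w \<in> Q})" for x
    have q_le: "q x \<le> n ^ j" for x unfolding q_def using card_mono[OF finW fib, of x] cW by linarith
    have q_sum: "real (card Q) = (\<Sum>x\<in>V. q x)"
      using card_lists_fibres[OF finV Q] by (simp add: q_def)
    \<comment> \<open>Heads outside \<open>Y\<close> contribute at most half of the guaranteed
      \<open>\<delta> * n ^ Suc j\<close> lists, and one head contributes at most
      \<open>n ^ j\<close>, so \<open>Y\<close> has linear size.\<close>
    define Y where "Y = {x \<in> V. q x \<ge> \<delta> / 2 * n ^ j}"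
    have "(\<Sum>x\<in>V. q x) \<le> (\<Sum>x\<in>V. (if x \<in> Y then n ^ j else 0) + \<delta> / 2 * n ^ j)"
    proof (rule sum_mono)
      fix x assume "x \<in> V"
      have "0 \<le> \<delta> / 2 * n ^ j" using Suc.prems npos by simp
      then show "q x \<le> (if x \<in> Y then n ^ j else 0) + \<delta> / 2 * n ^ j"
        using \<open>x \<in> V\<close> q_le[of x] by (auto simp: Y_def)
    qed
    also have "\<dots> = real (card Y) * n ^ j + n * (\<delta> / 2 * n ^ j)"
    proof -
      have "V \<inter> {x. x \<in> Y} = Y" by (auto simp: Y_def)
      then show ?thesis using finV by (simp add: sum.distrib sum.If_cases n_def)
    qed
    finally have "\<delta> * n ^ Suc j \<le> real (card Y) * n ^ j + n * (\<delta> / 2 * n ^ j)"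
      using cQ q_sum by linarith
    then have "(\<delta> / 2 * n) * n ^ j \<le> real (card Y) * n ^ j" by (simp add: algebra_simps)
    then have "\<delta> / 2 * n \<le> real (card Y)" using npos by simp
    then have "M \<le> card Y" using nM by linarith
    then obtain Y0 where Y0: "Y0 \<subseteq> Y" "card Y0 = M" by (metis obtain_subset_with_card_n)
    have finY0: "finite Y0" using Y0 M(2) by (metis card.infinite less_irrefl)
    define A where "A w = {x \<in> Y0. x # w \<in> Q}" for w
    define W0 where "W0 = {w \<in> W. card (A w) \<ge> t}"
    have finW0: "finite W0" using finW by (simp add: W0_def)
    have "(\<Sum>w\<in>W. card (A w)) = (\<Sum>w\<in>W. \<Sum>x\<in>Y0. if x # w \<in> Q then 1 else 0)"
      unfolding A_def using finY0 by (simp add: sum.If_cases Int_def)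
    also have "\<dots> = (\<Sum>x\<in>Y0. \<Sum>w\<in>W. if x # w \<in> Q then 1 else 0)" by (rule sum.swap)
    also have "\<dots> = (\<Sum>x\<in>Y0. card {w. x # w \<in> Q})"
    proof (rule sum.cong)
      fix x
      have "{w \<in> W. x # w \<in> Q} = {w. x # w \<in> Q}" using fib by auto
      then show "(\<Sum>w\<in>W. if x # w \<in> Q then 1 else 0) = card {w. x # w \<in> Q}"
        using finW by (simp add: sum.If_cases Int_def)
    qed simp
    finally have "real (\<Sum>w\<in>W. card (A w)) = (\<Sum>x\<in>Y0. q x)" by (simp add: q_def)
    also have "\<dots> \<ge> (\<Sum>x\<in>Y0. \<delta> / 2 * n ^ j)"
      by (rule sum_mono) (use Y0 in \<open>auto simp: Y_def\<close>)
    finally have lower: "real M * (\<delta> / 2 * n ^ j) \<le> real (\<Sum>w\<in>W. card (A w))" using Y0 by simp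
    have "(\<Sum>w\<in>W. card (A w)) \<le> (\<Sum>w\<in>W. (if w \<in> W0 then M else 0) + t)"
    proof (rule sum_mono)
      fix w assume "w \<in> W"
      have "card (A w) \<le> M" using card_mono[OF finY0, of "A w"] Y0 by (auto simp: A_def)
      then show "card (A w) \<le> (if w \<in> W0 then M else 0) + t"
        using \<open>w \<in> W\<close> by (auto simp: W0_def)
    qed
    also have "\<dots> = card W0 * M + card W * t"
    proof -
      have "W \<inter> {x. x \<in> W0} = W0" by (auto simp: W0_def)
      then show ?thesis using finW by (simp add: sum.distrib sum.If_cases)
    qed
    finally have "real (\<Sum>w\<in>W. card (A w)) \<le> real (card W0 * M + card W * t)" by (rule of_nat_mono)
    with lower have "real M * (\<delta> / 2 * n ^ j) \<le> real (card W0) * real M + n ^ j * real t"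
      using cW by simp
    moreover have "n ^ j * real t \<le> n ^ j * (real M * \<delta> / 4)"
      using M(1) npos by (intro mult_left_mono) auto
    ultimately have "(\<delta> / 4 * n ^ j) * real M \<le> real (card W0) * real M"
      by (simp add: algebra_simps)
    then have cW0: "\<delta> / 4 * n ^ j \<le> real (card W0)" using M(2) by simp
    define T where "T w = (SOME S. S \<subseteq> A w \<and> card S = t)" for w
    have T: "T w \<subseteq> A w \<and> card (T w) = t" if "w \<in> W0" for w
    proof -
      have "\<exists>S. S \<subseteq> A w \<and> card S = t"
        using that by (metis (no_types, lifting) W0_def mem_Collect_eq obtain_subset_with_card_n)
      then show ?thesis unfolding T_def by (rule someI_ex)
    qed
    have "T ` W0 \<subseteq> Pow Y0" using T by (force simp: A_def)
    from pigeonhole_real[OF _ this finW0] obtain S where S: "S \<in> Pow Y0"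
      "real (card W0) / real (card (Pow Y0)) \<le> real (card {w \<in> W0. T w = S})"
      using finY0 by auto
    define Q' where "Q' = {w \<in> W0. T w = S}"
    have "\<delta>' * n ^ j \<le> real (card W0) / 2 ^ M"
      unfolding \<delta>'_def using cW0 by (simp add: field_simps)
    also have "\<dots> \<le> real (card Q')"
      using S(2) finY0 Y0 by (simp add: card_Pow Q'_def)
    finally have cQ': "real (card Q') \<ge> \<delta>' * n ^ j" .
    have Q'sub: "Q' \<subseteq> {xs. length xs = j \<and> set xs \<subseteq> V}"
      by (auto simp: Q'_def W0_def W_def)
    have "\<exists>Bs. length Bs = j \<and> (\<forall>B\<in>set Bs. B \<subseteq> V \<and> card B = t) \<and> listset Bs \<subseteq> Q'"
    proof (rule N'[rule_format], intro conjI)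
      show "N' \<le> card V" using a by (simp add: N_def)
    qed (use cQ' finV Q'sub in \<open>simp_all add: n_def\<close>)
    then obtain Bs where Bs: "length Bs = j" "\<forall>B\<in>set Bs. B \<subseteq> V \<and> card B = t" "listset Bs \<subseteq> Q'"
      by blast
    have "Q' \<noteq> {}"
    proof
      assume "Q' = {}"
      then have "\<delta>' * n ^ j \<le> 0" using cQ' by simp
      moreover have "\<delta>' * n ^ j > 0" using \<open>\<delta>' > 0\<close> npos by simp
      ultimately show False by linarith
    qed
    then obtain w0 where "w0 \<in> W0" "T w0 = S" by (auto simp: Q'_def)
    with T have cS: "card S = t" by auto
    have SV: "S \<subseteq> V" using S(1) Y0 by (auto simp: Y_def)
    have "listset (S # Bs) \<subseteq> Q"
    proof
      fix xs assume "xs \<in> listset (S # Bs)"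
      then obtain x w where xs: "xs = x # w" "x \<in> S" "w \<in> listset Bs"
        by (auto simp: set_Cons_def)
      then have "w \<in> W0" "T w = S" using Bs by (auto simp: Q'_def)
      then have "x \<in> A w" using T xs by auto
      then show "xs \<in> Q" using xs by (simp add: A_def)
    qed
    then show "\<exists>Bs. length Bs = Suc j \<and> (\<forall>B\<in>set Bs. B \<subseteq> V \<and> card B = t) \<and> listset Bs \<subseteq> Q"
      using Bs cS SV by (intro exI[of _ "S # Bs"]) auto
  qed
qed

text \<open>Iterating this count with \<open>x\<close> proportional to the number of vertices gives a positive density of
  cliques of order \<open>j\<close>.\<close>

primrec rich :: "'a ugraph \<Rightarrow> real \<Rightarrow> nat \<Rightarrow> 'a set \<Rightarrow> bool" where
  "rich G x 0 S \<longleftrightarrow> True"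
| "rich G x (Suc j) S \<longleftrightarrow> real (card {y \<in> S. rich G x j (neighbours G y \<inter> S)}) \<ge> x"

text \<open>Cliques are counted as ordered lists: the head ranges over at least \<open>x\<close>
  vertices, and the tail is a clique in the part of its neighbourhood that is rich one level
  lower.\<close>

lemma rich_many_cliques:
  assumes "ugraph G" "x \<ge> 0" "S \<subseteq> verts G" "rich G x j S"
  shows "real (card {xs. length xs = j \<and> set xs \<subseteq> S \<and> sorted_wrt (\<lambda>u v. {u, v} \<in> edges G) xs}) \<ge> x ^ j"
  using assms(3,4)
proof (induction j arbitrary: S)
  case 0
  have "{xs. length xs = 0 \<and> set xs \<subseteq> S \<and> sorted_wrt (\<lambda>u v. {u, v} \<in> edges G) xs} = {[]}" by auto
  then show ?case by simp
next
  case (Suc j)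
  have finS: "finite S" using Suc.prems assms(1) ugraph_finite finite_subset by blast
  define C where "C j S = {xs. length xs = j \<and> set xs \<subseteq> S \<and> sorted_wrt (\<lambda>u v. {u, v} \<in> edges G) xs}" for j S
  define Y where "Y = {y \<in> S. rich G x j (neighbours G y \<inter> S)}"
  have "x ^ Suc j \<le> real (card Y) * x ^ j"
    using Suc.prems(2) assms(2) by (simp add: Y_def mult_right_mono)
  also have "\<dots> = (\<Sum>y\<in>Y. x ^ j)" by simp
  also have "\<dots> \<le> (\<Sum>y\<in>Y. real (card {w. y # w \<in> C (Suc j) S}))"
  proof (rule sum_mono)
    fix y assume y: "y \<in> Y"
    have "{w. y # w \<in> C (Suc j) S} = C j (neighbours G y \<inter> S)"
      using y by (auto simp: C_def Y_def neighbours_def)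
    moreover have "x ^ j \<le> real (card (C j (neighbours G y \<inter> S)))"
      unfolding C_def using y Suc.prems by (intro Suc.IH) (auto simp: Y_def)
    ultimately show "x ^ j \<le> real (card {w. y # w \<in> C (Suc j) S})" by simp
  qed
  also have "\<dots> \<le> (\<Sum>y\<in>S. real (card {w. y # w \<in> C (Suc j) S}))"
    by (rule sum_mono2) (auto simp: finS Y_def)
  also have "\<dots> = real (card (C (Suc j) S))"
  proof -
    have "C (Suc j) S \<subseteq> {xs. length xs = Suc j \<and> set xs \<subseteq> S}" by (auto simp: C_def)
    from card_lists_fibres[OF finS this] show ?thesis by simp
  qed
  finally show ?case by (simp add: C_def)
qed

text \<open>The remaining coordinates are filled arbitrarily, which is why no box may be empty. It
  puts any two vertices of different boxes on one common list, from which their adjacency is read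
  off.\<close>

lemma listset_obtain_nth:
  assumes "\<forall>B\<in>set Bs. B \<noteq> {}" "i < i'" "i' < length Bs" "u \<in> Bs ! i" "v \<in> Bs ! i'"
  shows "\<exists>xs\<in>listset Bs. length xs = length Bs \<and> xs ! i = u \<and> xs ! i' = v"
proof -
  define xs where "xs = (map (\<lambda>B. SOME y. y \<in> B) Bs)[i := u, i' := v]"
  have "length ys = length As \<Longrightarrow> (\<forall>l<length As. ys ! l \<in> As ! l) \<Longrightarrow> ys \<in> listset As" for ys :: "'a list" and As
  proof (induction As arbitrary: ys)
    case (Cons A As)
    then obtain y ys' where ys: "ys = y # ys'" by (cases ys) auto
    have "y \<in> A" using Cons.prems(2) ys by force
    moreover have "ys' \<in> listset As" using Cons ys by fastforce
    ultimately show ?case using ys by (auto simp: set_Cons_def)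
  qed simp
  moreover have "\<forall>l<length Bs. xs ! l \<in> Bs ! l"
    using assms by (auto simp: xs_def nth_list_update some_in_eq)
  ultimately have "xs \<in> listset Bs" by (simp add: xs_def)
  moreover have "xs ! i = u" "xs ! i' = v" using assms by (auto simp: xs_def nth_list_update)
  moreover have "length xs = length Bs" by (simp add: xs_def)
  ultimately show ?thesis by blast
qed

text \<open>Richness makes a proportion \<open>\<epsilon> ^ j\<close> of all lists of length
  \<open>j\<close> cliques, and a box consisting of cliques is a complete multipartite subgraph.
  Disjointness of the parts follows from the absence of loops.\<close>

lemma rich_contains_complete_multipartite:
  fixes \<epsilon> :: real and t :: nat
  assumes "\<epsilon> > 0" "t > 0"
  shows "\<exists>N. \<forall>G :: 'a ugraph. ugraph G \<and> card (verts G) \<ge> N \<and> rich G (\<epsilon> * card (verts G)) j (verts G) \<longrightarrow>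
    (\<exists>B. \<forall>i<j. B i \<subseteq> verts G \<and> card (B i) = t \<and> (\<forall>i'<j. i \<noteq> i' \<longrightarrow> (\<forall>u\<in>B i. \<forall>v\<in>B i'. {u, v} \<in> edges G)))"
proof -
  have "\<epsilon> ^ j > 0" using assms by simp
  from dense_lists_contain_box[OF this, of j t] obtain N where
    N: "\<forall>V Q. finite (V :: 'a set) \<and> card V \<ge> N \<and>
      Q \<subseteq> {xs. length xs = j \<and> set xs \<subseteq> V} \<and> real (card Q) \<ge> \<epsilon> ^ j * real (card V) ^ j \<longrightarrow>
      (\<exists>Bs. length Bs = j \<and> (\<forall>B\<in>set Bs. B \<subseteq> V \<and> card B = t) \<and> listset Bs \<subseteq> Q)" ..
  show ?thesis
  proof (intro exI[of _ N] allI impI, elim conjE)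
    fix G :: "'a ugraph"
    assume G: "ugraph G" "card (verts G) \<ge> N" "rich G (\<epsilon> * card (verts G)) j (verts G)"
    define Q where "Q = {xs. length xs = j \<and> set xs \<subseteq> verts G \<and> sorted_wrt (\<lambda>u v. {u, v} \<in> edges G) xs}"
    have "real (card Q) \<ge> \<epsilon> ^ j * real (card (verts G)) ^ j"
      using rich_many_cliques[OF G(1) _ _ G(3)] assms(1) by (simp add: Q_def power_mult_distrib)
    moreover have "Q \<subseteq> {xs. length xs = j \<and> set xs \<subseteq> verts G}" by (auto simp: Q_def)
    ultimately have "\<exists>Bs. length Bs = j \<and> (\<forall>B\<in>set Bs. B \<subseteq> verts G \<and> card B = t) \<and> listset Bs \<subseteq> Q"
      using N G(2) ugraph_finite[OF G(1)] by blast
    then obtain Bs where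
      Bs: "length Bs = j" "\<forall>B\<in>set Bs. B \<subseteq> verts G \<and> card B = t" "listset Bs \<subseteq> Q"
      by blast
    have ne: "\<forall>B\<in>set Bs. B \<noteq> {}" using Bs(2) assms(2) by auto
    have adj: "{u, v} \<in> edges G" if h: "i < i'" "i' < j" "u \<in> Bs ! i" "v \<in> Bs ! i'" for i i' u v
    proof -
      have "\<exists>xs\<in>listset Bs. length xs = length Bs \<and> xs ! i = u \<and> xs ! i' = v"
        using listset_obtain_nth[OF ne h(1) _ h(3,4)] Bs(1) h(2) by simp
      then obtain xs where "xs \<in> Q" "length xs = j" "xs ! i = u" "xs ! i' = v"
        using Bs(1,3) by auto
      then show ?thesis using h by (auto simp: Q_def sorted_wrt_iff_nth_less)
    qed
    have "{u, v} \<in> edges G" if "i \<noteq> i'" "i < j" "i' < j" "u \<in> Bs ! i" "v \<in> Bs ! i'" for i i' u v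
      using adj[of i i' u v] adj[of i' i v u] that by (cases "i < i'") (auto simp: insert_commute)
    then show "\<exists>B. \<forall>i<j. B i \<subseteq> verts G \<and> card (B i) = t \<and>
        (\<forall>i'<j. i \<noteq> i' \<longrightarrow> (\<forall>u\<in>B i. \<forall>v\<in>B i'. {u, v} \<in> edges G))"
      using Bs by (intro exI[of _ "\<lambda>i. Bs ! i"]) auto
  qed
qed

section \<open>Functions of the degree\<close>

text \<open>The mean value estimate with the bound s n^(s-1) on the derivative. Multiplying by
  \<open>n\<close> avoids the exponent s - 1 and hence a case distinction at s = 0; the same device
  recurs below.\<close>

lemma power_diff_le:
  fixes a b n :: real
  assumes "0 \<le> a" "a \<le> n" "0 \<le> b" "b \<le> n"
  shows "\<bar>a ^ s - b ^ s\<bar> * n \<le> real s * \<bar>a - b\<bar> * n ^ s"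
proof (induction s)
  case (Suc s)
  have n: "n \<ge> 0" using assms by linarith
  have "a ^ Suc s - b ^ Suc s = a * (a ^ s - b ^ s) + (a - b) * b ^ s" by (simp add: algebra_simps)
  then have "\<bar>a ^ Suc s - b ^ Suc s\<bar> \<le> a * \<bar>a ^ s - b ^ s\<bar> + \<bar>a - b\<bar> * b ^ s"
    using assms by (metis abs_mult abs_of_nonneg abs_triangle_ineq zero_le_power)
  also have "\<dots> \<le> n * \<bar>a ^ s - b ^ s\<bar> + \<bar>a - b\<bar> * n ^ s"
    using assms by (intro add_mono mult_right_mono mult_left_mono power_mono) auto
  finally have "\<bar>a ^ Suc s - b ^ Suc s\<bar> * n \<le> (n * \<bar>a ^ s - b ^ s\<bar> + \<bar>a - b\<bar> * n ^ s) * n"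
    using n by (rule mult_right_mono)
  also have "\<dots> = n * (\<bar>a ^ s - b ^ s\<bar> * n) + \<bar>a - b\<bar> * n ^ Suc s" by (simp add: algebra_simps)
  also have "\<dots> \<le> n * (real s * \<bar>a - b\<bar> * n ^ s) + \<bar>a - b\<bar> * n ^ Suc s"
    using n Suc.IH by (intro add_mono mult_left_mono) auto
  finally show ?case by (simp add: algebra_simps)
qed simp

text \<open>The binomial expansion to first order, with error O(n^(s-1)) uniformly for all
  \<open>d \<le> n\<close>.\<close>

lemma power_increment:
  "\<exists>C\<ge>0. \<forall>n d :: nat. 1 \<le> n \<longrightarrow> d \<le> n \<longrightarrow>
     \<bar>real (Suc d) ^ Suc s - real d ^ Suc s - real (Suc s) * real d ^ s\<bar> * real n \<le> C * real n ^ s"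
proof (induction s)
  case 0
  show ?case by (intro exI[of _ 0]) auto
next
  case (Suc s)
  then obtain C where C: "C \<ge> 0" "\<And>n d :: nat. 1 \<le> n \<Longrightarrow> d \<le> n \<Longrightarrow>
     \<bar>real (Suc d) ^ Suc s - real d ^ Suc s - real (Suc s) * real d ^ s\<bar> * real n \<le> C * real n ^ s"
    by auto
  show ?case
  proof (intro exI[of _ "2 * C + real (Suc s)"] conjI allI impI)
    show "2 * C + real (Suc s) \<ge> 0" using C by simp
    fix n d :: nat assume nd: "1 \<le> n" "d \<le> n"
    define x where "x = real (Suc d) ^ Suc s - real d ^ Suc s - real (Suc s) * real d ^ s"
    have "real (Suc d) ^ Suc (Suc s) - real d ^ Suc (Suc s) - real (Suc (Suc s)) * real d ^ Suc s
        = (1 + real d) * x + real (Suc s) * real d ^ s"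
      unfolding x_def by (simp add: algebra_simps)
    then have "\<bar>real (Suc d) ^ Suc (Suc s) - real d ^ Suc (Suc s) - real (Suc (Suc s)) * real d ^ Suc s\<bar>
       \<le> (1 + real d) * \<bar>x\<bar> + real (Suc s) * real d ^ s"
      by (simp add: abs_mult order_trans[OF abs_triangle_ineq])
    also have "\<dots> \<le> (2 * real n) * \<bar>x\<bar> + real (Suc s) * real n ^ s"
      using nd by (intro add_mono mult_right_mono mult_left_mono power_mono) auto
    finally have "\<bar>real (Suc d) ^ Suc (Suc s) - real d ^ Suc (Suc s) - real (Suc (Suc s)) * real d ^ Suc s\<bar> * real n
       \<le> ((2 * real n) * \<bar>x\<bar> + real (Suc s) * real n ^ s) * real n"
      by (rule mult_right_mono) simp
    also have "\<dots> = 2 * real n * (\<bar>x\<bar> * real n) + real (Suc s) * real n ^ Suc s" by (simp add: algebra_simps)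
    also have "\<dots> \<le> 2 * real n * (C * real n ^ s) + real (Suc s) * real n ^ Suc s"
      using C(2)[OF nd] unfolding x_def by (intro add_mono mult_left_mono) auto
    finally show "\<bar>real (Suc d) ^ Suc (Suc s) - real d ^ Suc (Suc s) - real (Suc (Suc s)) * real d ^ Suc s\<bar> * real n
       \<le> (2 * C + real (Suc s)) * real n ^ Suc s" by (simp add: algebra_simps)
  qed
qed

text \<open>Superadditivity of the power function. It needs no positive lower bound on
  \<open>b\<close>, so it applies before anything is known about small degrees.\<close>

lemma power_diff_ge_diff_power:
  fixes a b :: real
  assumes "0 \<le> b" "b \<le> a"
  shows "(a - b) ^ Suc s \<le> a ^ Suc s - b ^ Suc s"
proof (induction s)
  case (Suc s)
  have "(a - b) ^ Suc (Suc s) = (a - b) * (a - b) ^ Suc s" by simp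
  also have "\<dots> \<le> (a - b) * (a ^ Suc s - b ^ Suc s)"
    using assms Suc by (intro mult_left_mono) auto
  also have "\<dots> = a ^ Suc (Suc s) - b ^ Suc (Suc s) - (b * (a ^ Suc s - b ^ Suc s) + b ^ Suc s * (a - b))"
    by (simp add: algebra_simps)
  also have "\<dots> \<le> a ^ Suc (Suc s) - b ^ Suc (Suc s)"
  proof -
    have "b ^ Suc s \<le> a ^ Suc s" using assms by (intro power_mono)
    then have "0 \<le> b * (a ^ Suc s - b ^ Suc s)" using assms by simp
    moreover have "0 \<le> b ^ Suc s * (a - b)" using assms by simp
    ultimately show ?thesis by linarith
  qed
  finally show ?case .
qed (use assms in simp)

text \<open>This covers both \<open>d ^ r\<close> and \<open>r! * (d choose r)\<close>, with \<open>r = Suc s\<close>.\<close>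

locale degree_function =
  fixes g :: "nat \<Rightarrow> real" and s :: nat and C :: real
  assumes g0: "g 0 = 0" and g_mono: "mono g" and C_nonneg: "C \<ge> 0"
    and increment: "\<And>n d. 1 \<le> n \<Longrightarrow> d \<le> n \<Longrightarrow>
      \<bar>g (Suc d) - g d - real (Suc s) * real d ^ s\<bar> * real n \<le> C * real n ^ s"
begin

text \<open>A Lipschitz factor: on degrees up to \<open>n\<close>, one step changes \<open>g\<close>
  by at most \<open>L * real n ^ s\<close>, the main term giving \<open>Suc s\<close> and the error
  giving \<open>C\<close>.\<close>

definition L :: real where "L = real (Suc s) + C"

lemma L_pos: "L \<ge> 1" using C_nonneg by (simp add: L_def)

lemma g_nonneg: "0 \<le> g d"
  using g_mono g0 by (metis le0 monoD)

lemma increment': "1 \<le> n \<Longrightarrow> d \<le> n \<Longrightarrow>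
    \<bar>g (Suc d) - g d - real (Suc s) * real d ^ s\<bar> \<le> C * real n ^ s / real n"
  using increment[of n d] by (simp add: field_simps)

lemma div_n_le: "1 \<le> n \<Longrightarrow> 0 \<le> K \<Longrightarrow> K * real n ^ s / real n \<le> K * real n ^ s"
  using divide_left_mono[of 1 "real n" "K * real n ^ s"] by simp

lemma increment_le:
  assumes "1 \<le> n" "d \<le> n"
  shows "g (Suc d) - g d \<le> L * real n ^ s"
proof -
  have "real d ^ s \<le> real n ^ s" using assms by (intro power_mono) auto
  then have "real (Suc s) * real d ^ s \<le> real (Suc s) * real n ^ s" by (intro mult_left_mono) auto
  moreover have "g (Suc d) - g d - real (Suc s) * real d ^ s \<le> C * real n ^ s"
    using increment'[OF assms] div_n_le[OF assms(1) C_nonneg] by linarith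
  ultimately show ?thesis unfolding L_def by (simp add: algebra_simps)
qed

lemma g_diff_le:
  assumes "1 \<le> n" "a \<le> b" "b \<le> n"
  shows "g b - g a \<le> (real b - real a) * (L * real n ^ s)"
  using assms(2,3)
proof (induction b rule: dec_induct)
  case (step m)
  then have "g (Suc m) - g m \<le> L * real n ^ s" using increment_le[OF assms(1)] by simp
  then show ?case using step by (simp add: algebra_simps)
qed simp

lemma g_le:
  assumes "1 \<le> n" "d \<le> n"
  shows "g d \<le> L * real n ^ Suc s"
proof -
  have "g d \<le> real d * (L * real n ^ s)" using g_diff_le[OF assms(1), of 0 d] assms g0 by simp
  also have "\<dots> \<le> real n * (L * real n ^ s)"
    using assms L_pos by (intro mult_right_mono) auto
  finally show ?thesis by (simp add: algebra_simps)
qed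

text \<open>The increments of \<open>g\<close> and of the power agree up to O(n^(s-1)), and at most
  \<open>n\<close> of them are summed. The resulting error is one order below the values
  themselves.\<close>

lemma g_approx_power:
  "\<exists>K\<ge>0. \<forall>n d. 1 \<le> n \<longrightarrow> d \<le> n \<longrightarrow> \<bar>g d - real d ^ Suc s\<bar> \<le> K * real n ^ s"
proof -
  obtain Cp where Cp: "Cp \<ge> 0" "\<And>n d :: nat. 1 \<le> n \<Longrightarrow> d \<le> n \<Longrightarrow>
     \<bar>real (Suc d) ^ Suc s - real d ^ Suc s - real (Suc s) * real d ^ s\<bar> * real n \<le> Cp * real n ^ s"
    using power_increment[of s] by auto
  show ?thesis
  proof (intro exI[of _ "C + Cp"] conjI allI impI)
    fix n d :: nat assume nd: "1 \<le> n" "d \<le> n"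
    have "\<bar>g d - real d ^ Suc s\<bar> * real n \<le> real d * ((C + Cp) * real n ^ s)"
      using nd(2)
    proof (induction d)
      case (Suc d)
      have "\<bar>g (Suc d) - real (Suc d) ^ Suc s\<bar> \<le> \<bar>g d - real d ^ Suc s\<bar> +
         \<bar>g (Suc d) - g d - real (Suc s) * real d ^ s\<bar> +
         \<bar>real (Suc d) ^ Suc s - real d ^ Suc s - real (Suc s) * real d ^ s\<bar>" by linarith
      then have "\<bar>g (Suc d) - real (Suc d) ^ Suc s\<bar> * real n \<le> (\<bar>g d - real d ^ Suc s\<bar> +
         \<bar>g (Suc d) - g d - real (Suc s) * real d ^ s\<bar> +
         \<bar>real (Suc d) ^ Suc s - real d ^ Suc s - real (Suc s) * real d ^ s\<bar>) * real n"
        by (rule mult_right_mono) simp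
      also have "\<dots> \<le> real d * ((C + Cp) * real n ^ s) + C * real n ^ s + Cp * real n ^ s"
        using Suc increment[OF nd(1), of d] Cp(2)[OF nd(1), of d] by (simp add: distrib_right del: of_nat_Suc power_Suc)
      finally show ?case by (simp add: algebra_simps)
    qed (simp add: g0)
    also have "\<dots> \<le> real n * ((C + Cp) * real n ^ s)"
      using nd C_nonneg Cp by (intro mult_right_mono) auto
    finally have "\<bar>g d - real d ^ Suc s\<bar> * real n \<le> ((C + Cp) * real n ^ s) * real n" by (simp only: mult.commute)
    then show "\<bar>g d - real d ^ Suc s\<bar> \<le> (C + Cp) * real n ^ s"
      using nd(1) by (simp only: mult_le_cancel_right split: if_splits)
  qed (simp add: Cp C_nonneg)
qed

text \<open>For degrees of linear size the main term of an increment is at least (\<alpha> n)^s, and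
  for large \<open>n\<close> the error of order n^(s-1) consumes at most half of it.\<close>

lemma g_diff_ge:
  assumes "\<alpha> > 0"
  shows "\<exists>N\<ge>1. \<forall>n a b. n \<ge> N \<longrightarrow> \<alpha> * real n \<le> real a \<longrightarrow> a \<le> b \<longrightarrow> b \<le> n \<longrightarrow>
    (real b - real a) * (\<alpha> ^ s / 2 * real n ^ s) \<le> g b - g a"
proof -
  define N where "N = nat \<lceil>2 * C / \<alpha> ^ s\<rceil> + 1"
  show ?thesis
  proof (intro exI[of _ N] conjI allI impI)
    show "N \<ge> 1" by (simp add: N_def)
    fix n a b assume n: "N \<le> n" and a: "\<alpha> * real n \<le> real a" and "a \<le> b" "b \<le> n"
    have n1: "1 \<le> n" using n by (simp add: N_def)
    have "real n \<ge> 2 * C / \<alpha> ^ s" using n unfolding N_def by linarith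
    then have "2 * C \<le> \<alpha> ^ s * real n" using assms by (simp add: field_simps)
    then have "C / real n \<le> \<alpha> ^ s / 2" using n1 by (simp add: field_simps)
    then have "C / real n * real n ^ s \<le> \<alpha> ^ s / 2 * real n ^ s" by (intro mult_right_mono) auto
    then have small: "C * real n ^ s / real n \<le> \<alpha> ^ s / 2 * real n ^ s" by simp
    have inc: "\<alpha> ^ s / 2 * real n ^ s \<le> g (Suc d) - g d" if "a \<le> d" "d \<le> n" for d
    proof -
      have "(\<alpha> * real n) ^ s \<le> real d ^ s"
        using a that assms by (intro power_mono) auto
      also have "\<dots> \<le> real (Suc s) * real d ^ s" by (simp add: algebra_simps)
      finally have "\<alpha> ^ s * real n ^ s \<le> real (Suc s) * real d ^ s" by (simp add: power_mult_distrib)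
      then show ?thesis using small increment'[OF n1 that(2)] by linarith
    qed
    show "(real b - real a) * (\<alpha> ^ s / 2 * real n ^ s) \<le> g b - g a"
      using \<open>a \<le> b\<close> \<open>b \<le> n\<close>
    proof (induction b rule: dec_induct)
      case (step m)
      then have "\<alpha> ^ s / 2 * real n ^ s \<le> g (Suc m) - g m" by (intro inc) auto
      moreover have "(real (Suc m) - real a) * (\<alpha> ^ s / 2 * real n ^ s) =
          (real m - real a) * (\<alpha> ^ s / 2 * real n ^ s) + \<alpha> ^ s / 2 * real n ^ s"
        by (simp add: field_simps)
      ultimately show ?case using step by simp
    qed simp
  qed
qed

text \<open>First-order expansion at \<open>D\<close> for bounded changes of degree. Each of at most
  \<open>q\<close> steps is off by O(n^(s-1)); the second summand of \<open>K\<close> below pays for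
  replacing d^s by D^s in the main term.\<close>

lemma g_linear_approx:
  "\<exists>K\<ge>0. \<forall>n d D. 1 \<le> n \<longrightarrow> d \<le> n \<longrightarrow> D \<le> n \<longrightarrow> \<bar>real d - real D\<bar> \<le> real q \<longrightarrow>
     \<bar>g d - g D - (real d - real D) * (real (Suc s) * real D ^ s)\<bar> \<le> K * real n ^ s / real n"
proof -
  define K where "K = C + real (Suc s) * (real s * real q)"
  have K: "K \<ge> 0" unfolding K_def using C_nonneg by simp
  have inc: "\<bar>g (Suc d) - g d - real (Suc s) * real D ^ s\<bar> \<le> K * real n ^ s / real n"
    if n: "1 \<le> n" and d: "d \<le> n" "D \<le> n" "\<bar>real d - real D\<bar> \<le> real q" for n d D
  proof -
    have "\<bar>real d ^ s - real D ^ s\<bar> * real n \<le> real s * \<bar>real d - real D\<bar> * real n ^ s"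
      using d by (intro power_diff_le) auto
    also have "\<dots> \<le> real s * real q * real n ^ s"
      using d by (intro mult_right_mono mult_left_mono) simp_all
    finally have "\<bar>real d ^ s - real D ^ s\<bar> \<le> real s * real q * real n ^ s / real n"
      using n by (simp add: field_simps)
    then have "real (Suc s) * \<bar>real d ^ s - real D ^ s\<bar> \<le> real (Suc s) * (real s * real q * real n ^ s / real n)"
      by (intro mult_left_mono) auto
    moreover have "\<bar>real (Suc s) * real d ^ s - real (Suc s) * real D ^ s\<bar> = real (Suc s) * \<bar>real d ^ s - real D ^ s\<bar>"
      by (simp only: right_diff_distrib[symmetric] abs_mult abs_of_nat)
    moreover have "K * real n ^ s / real n = C * real n ^ s / real n + real (Suc s) * (real s * real q * real n ^ s / real n)"
      unfolding K_def using n by (simp add: field_simps)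
    ultimately show ?thesis using increment'[OF n d(1)] by linarith
  qed
  show ?thesis
  proof (intro exI[of _ "real q * K"] conjI allI impI)
    fix n d D :: nat
    assume n: "1 \<le> n" and d: "d \<le> n" "D \<le> n" "\<bar>real d - real D\<bar> \<le> real q"
    define e where "e = K * real n ^ s / real n"
    have e: "e \<ge> 0" using K by (simp add: e_def)
    have "\<bar>g d - g D - (real d - real D) * (real (Suc s) * real D ^ s)\<bar> \<le> \<bar>real d - real D\<bar> * e"
    proof (cases "D \<le> d")
      case True
      then show ?thesis using d(1,3)
      proof (induction d rule: dec_induct)
        case (step m)
        then have "\<bar>real m - real D\<bar> \<le> real q" by linarith
        then have "\<bar>g (Suc m) - g m - real (Suc s) * real D ^ s\<bar> \<le> e"
          unfolding e_def using step d by (intro inc[OF n]) auto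
        moreover have "\<bar>g m - g D - (real m - real D) * (real (Suc s) * real D ^ s)\<bar> \<le> \<bar>real m - real D\<bar> * e"
          using step \<open>\<bar>real m - real D\<bar> \<le> real q\<close> by auto
        moreover have "(real (Suc m) - real D) * (real (Suc s) * real D ^ s) =
           (real m - real D) * (real (Suc s) * real D ^ s) + real (Suc s) * real D ^ s"
          by (simp add: algebra_simps)
        moreover have "\<bar>real (Suc m) - real D\<bar> * e = \<bar>real m - real D\<bar> * e + e"
          using step by (simp add: algebra_simps)
        ultimately show ?case by linarith
      qed simp
    next
      case False
      then have "d \<le> D" by simp
      then show ?thesis using d(3)
      proof (induction d rule: inc_induct)
        case (step m)
        have q: "\<bar>real m - real D\<bar> \<le> real q" "\<bar>real (Suc m) - real D\<bar> \<le> real q" using step by linarith+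
        then have "\<bar>g (Suc m) - g m - real (Suc s) * real D ^ s\<bar> \<le> e"
          unfolding e_def using step d by (intro inc[OF n]) auto
        moreover have "\<bar>g (Suc m) - g D - (real (Suc m) - real D) * (real (Suc s) * real D ^ s)\<bar> \<le> \<bar>real (Suc m) - real D\<bar> * e"
          using step q by auto
        moreover have "(real (Suc m) - real D) * (real (Suc s) * real D ^ s) =
           (real m - real D) * (real (Suc s) * real D ^ s) + real (Suc s) * real D ^ s"
          by (simp add: algebra_simps)
        moreover have "\<bar>real m - real D\<bar> * e = \<bar>real (Suc m) - real D\<bar> * e + e"
          using step by (simp add: algebra_simps)
        ultimately show ?case by linarith
      qed simp
    qed
    also have "\<dots> \<le> real q * e" using d e by (intro mult_right_mono) auto
    finally show "\<bar>g d - g D - (real d - real D) * (real (Suc s) * real D ^ s)\<bar> \<le> real q * K * real n ^ s / real n"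
      by (simp add: e_def mult.assoc)
  qed (use K in simp)
qed

end

section \<open>Powers and binomial coefficients as degree functions\<close>

lemma degree_function_power: "\<exists>C. degree_function (\<lambda>d. real d ^ Suc s) s C"
proof -
  obtain C where "C \<ge> 0" "\<And>n d :: nat. 1 \<le> n \<Longrightarrow> d \<le> n \<Longrightarrow>
     \<bar>real (Suc d) ^ Suc s - real d ^ Suc s - real (Suc s) * real d ^ s\<bar> * real n \<le> C * real n ^ s"
    using power_increment[of s] by auto
  then have "degree_function (\<lambda>d. real d ^ Suc s) s C"
    by unfold_locales (auto intro!: monoI power_mono simp del: power_Suc of_nat_Suc)
  then show ?thesis ..
qed

text \<open>The left term is the falling factorial; passing from \<open>s\<close> to s + 1
  multiplies it by d - s, and replacing this factor by d changes only lower-order terms.\<close>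

lemma fact_mult_choose_approx_power:
  "\<exists>C\<ge>0. \<forall>n d :: nat. 1 \<le> n \<longrightarrow> d \<le> n \<longrightarrow>
     \<bar>fact s * real (d choose s) - real d ^ s\<bar> * real n \<le> C * real n ^ s"
proof (induction s)
  case 0
  show ?case by (intro exI[of _ 0]) auto
next
  case (Suc s)
  then obtain C where C: "C \<ge> 0" "\<And>n d :: nat. 1 \<le> n \<Longrightarrow> d \<le> n \<Longrightarrow>
     \<bar>fact s * real (d choose s) - real d ^ s\<bar> * real n \<le> C * real n ^ s" by auto
  show ?case
  proof (intro exI[of _ "2 * C + real s"] conjI allI impI)
    show "2 * C + real s \<ge> 0" using C by simp
    fix n d :: nat assume nd: "1 \<le> n" "d \<le> n"
    define x where "x = fact s * real (d choose s) - real d ^ s"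
    have c: "real (Suc s) * real (d choose Suc s) = (real d - real s) * real (d choose s)"
    proof (cases "s \<le> d")
      case True
      have "Suc s * (d choose Suc s) = (d - s) * (d choose s)"
        using binomial_absorb_comp[of d s] binomial_absorption[of s "d"] True
        by (metis binomial_absorption binomial_absorb_comp)
      then have "real (Suc s * (d choose Suc s)) = real ((d - s) * (d choose s))" by (rule arg_cong)
      then show ?thesis using True by (simp only: of_nat_mult of_nat_diff)
    qed (simp add: binomial_eq_0)
    have x_eq: "fact s * real (d choose s) = x + real d ^ s" by (simp add: x_def)
    have "fact (Suc s) * real (d choose Suc s) = fact s * (real (Suc s) * real (d choose Suc s))"
      by (simp add: algebra_simps)
    also have "\<dots> = (real d - real s) * (fact s * real (d choose s))" unfolding c by (simp add: algebra_simps)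
    also have "\<dots> = real d ^ Suc s + (real d * x - real s * (fact s * real (d choose s)))"
      unfolding x_eq by (simp add: algebra_simps)
    finally have eq: "fact (Suc s) * real (d choose Suc s) - real d ^ Suc s =
        real d * x - real s * (fact s * real (d choose s))" by linarith
    have ff: "fact s * real (d choose s) \<le> real n ^ s"
    proof -
      have "fact s * (d choose s) \<le> d ^ s"
      proof (cases "s \<le> d")
        case True
        then show ?thesis using binomial_fact_pow[of d s] by (simp add: mult.commute)
      qed (simp add: binomial_eq_0)
      then have "real (fact s * (d choose s)) \<le> real (d ^ s)" by (rule of_nat_mono)
      also have "\<dots> \<le> real n ^ s" using nd by (simp add: power_mono)
      finally show ?thesis by simp
    qed
    have "\<bar>fact (Suc s) * real (d choose Suc s) - real d ^ Suc s\<bar> \<le> real n * \<bar>x\<bar> + real s * real n ^ s"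
    proof -
      have "\<bar>real d * x\<bar> \<le> real n * \<bar>x\<bar>" using nd by (simp add: abs_mult mult_right_mono)
      moreover have "0 \<le> real s * (fact s * real (d choose s))" by simp
      moreover have "real s * (fact s * real (d choose s)) \<le> real s * real n ^ s" using ff by (intro mult_left_mono) auto
      ultimately show ?thesis unfolding eq by linarith
    qed
    then have "\<bar>fact (Suc s) * real (d choose Suc s) - real d ^ Suc s\<bar> * real n \<le> (real n * \<bar>x\<bar> + real s * real n ^ s) * real n"
      by (rule mult_right_mono) simp
    also have "\<dots> = real n * (\<bar>x\<bar> * real n) + real s * real n ^ Suc s" by (simp add: algebra_simps)
    also have "\<dots> \<le> real n * (C * real n ^ s) + real s * real n ^ Suc s"
      using C(2)[OF nd] unfolding x_def by (intro add_mono mult_left_mono) auto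
    also have "\<dots> \<le> (2 * C + real s) * real n ^ Suc s"
      using C(1) by (simp add: algebra_simps)
    finally show "\<bar>fact (Suc s) * real (d choose Suc s) - real d ^ Suc s\<bar> * real n \<le> (2 * C + real s) * real n ^ Suc s" .
  qed
qed

text \<open>By Pascal's rule the increment is exactly (s+1) times the falling factorial of length s,
  so the preceding approximation is all that is needed.\<close>

lemma degree_function_choose: "\<exists>C. degree_function (\<lambda>d. fact (Suc s) * real (d choose Suc s)) s C"
proof -
  obtain C where C: "C \<ge> 0" "\<And>n d :: nat. 1 \<le> n \<Longrightarrow> d \<le> n \<Longrightarrow>
     \<bar>fact s * real (d choose s) - real d ^ s\<bar> * real n \<le> C * real n ^ s"
    using fact_mult_choose_approx_power[of s] by auto
  have "degree_function (\<lambda>d. fact (Suc s) * real (d choose Suc s)) s (real (Suc s) * C)"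
  proof
    show "mono (\<lambda>d. fact (Suc s) * real (d choose Suc s))"
      by (intro monoI mult_left_mono) (auto intro: binomial_right_mono)
    fix n d :: nat assume nd: "1 \<le> n" "d \<le> n"
    have "fact (Suc s) * real (Suc d choose Suc s) - fact (Suc s) * real (d choose Suc s) - real (Suc s) * real d ^ s
      = real (Suc s) * (fact s * real (d choose s) - real d ^ s)"
      by (simp add: algebra_simps)
    then have "\<bar>fact (Suc s) * real (Suc d choose Suc s) - fact (Suc s) * real (d choose Suc s) - real (Suc s) * real d ^ s\<bar> * real n
       = real (Suc s) * (\<bar>fact s * real (d choose s) - real d ^ s\<bar> * real n)"
      by (simp only: abs_mult abs_of_nat mult.assoc)
    also have "\<dots> \<le> real (Suc s) * (C * real n ^ s)" using C(2)[OF nd] by (intro mult_left_mono) auto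
    finally show "\<bar>fact (Suc s) * real (Suc d choose Suc s) - fact (Suc s) * real (d choose Suc s) - real (Suc s) * real d ^ s\<bar> * real n
      \<le> real (Suc s) * C * real n ^ s" by (simp add: mult.assoc)
  qed (use C in auto)
  then show ?thesis ..
qed

section \<open>Peeling and balanced extensions\<close>

lemma sum_card_swap:
  assumes "finite A" "finite B"
  shows "(\<Sum>v\<in>A. card {u \<in> B. P v u}) = (\<Sum>u\<in>B. card {v \<in> A. P v u})"
proof -
  have "(\<Sum>v\<in>A. card {u \<in> B. P v u}) = (\<Sum>v\<in>A. \<Sum>u\<in>B. if P v u then 1 else 0)"
    using assms by (simp add: sum.If_cases Int_def)
  also have "\<dots> = (\<Sum>u\<in>B. \<Sum>v\<in>A. if P v u then 1 else 0)" by (rule sum.swap)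
  finally show ?thesis using assms by (simp add: sum.If_cases Int_def)
qed

lemma obtain_maximizer:
  fixes f :: "'a \<Rightarrow> 'b::linorder"
  assumes "finite T" "T \<noteq> {}"
  obtains x where "x \<in> T" "\<And>y. y \<in> T \<Longrightarrow> f y \<le> f x"
proof -
  have "Max (f ` T) \<in> f ` T" using assms by simp
  then obtain x where "x \<in> T" "f x = Max (f ` T)" by auto
  then show ?thesis using assms that by (metis Max_ge finite_imageI imageI)
qed

text \<open>Repeatedly splitting off the non-neighbours of a vertex of maximum degree, as in Erdos's proof
  of Turan's theorem. The deficits in the degree bounds then also control the number of
  missing pairs between different classes.\<close>

lemma peeling:
  assumes G: "ugraph G"
  shows "S \<subseteq> verts G \<Longrightarrow> \<not> rich G x (Suc j) S \<Longrightarrow>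
    \<exists>U c. U \<subseteq> S \<and> c ` U \<subseteq> {..<j} \<and> real (card (S - U)) \<le> real (Suc j) * x \<and>
      (\<forall>v\<in>U. card (neighbours G v \<inter> S) + card (colour_class U c (c v)) \<le> card S) \<and>
      (\<Sum>v\<in>U. card (non_neighbours G U c v)) \<le>
        2 * (\<Sum>v\<in>U. card S - card (colour_class U c (c v)) - card (neighbours G v \<inter> S))"
proof (induction j arbitrary: S)
  case 0
  then show ?case by (intro exI[of _ "{}"]) simp
next
  case (Suc j)
  have finS: "finite S" using Suc.prems(1) ugraph_finite[OF G] finite_subset by blast
  \<comment> \<open>Vertices whose neighbourhood in \<open>S\<close> is still rich. As
    \<open>S\<close> fails to be rich one level higher, there are fewer than \<open>x\<close> of
    them; they stay uncoloured.\<close>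
  define Bd where "Bd = {y \<in> S. rich G x (Suc j) (neighbours G y \<inter> S)}"
  have "\<not> real (card Bd) \<ge> x"
    using Suc.prems(2) unfolding Bd_def rich.simps(2)[of G x "Suc j" S] .
  then have Bd: "real (card Bd) < x" by simp
  then have xpos: "x > 0" by (rule order.strict_trans1[rotated]) simp
  show ?case
  proof (cases "S - Bd = {}")
    case True
    then have "S = Bd" by (auto simp: Bd_def)
    have "x \<le> real (Suc (Suc j)) * x" using xpos by simp
    with Bd have "real (card S) \<le> real (Suc (Suc j)) * x" unfolding \<open>S = Bd\<close> by linarith
    then show ?thesis by (intro exI[of _ "{}"]) simp
  next
    case False
    have "finite (S - Bd)" using finS by simp
    then obtain x0 where x0: "x0 \<in> S - Bd"
      and max: "\<And>y. y \<in> S - Bd \<Longrightarrow> card (neighbours G y \<inter> S) \<le> card (neighbours G x0 \<inter> S)"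
      using obtain_maximizer[OF _ False, of "\<lambda>y. card (neighbours G y \<inter> S)"] by blast
    define S1 where "S1 = neighbours G x0 \<inter> S"
    have "\<not> rich G x (Suc j) S1" using x0 by (simp add: Bd_def S1_def del: rich.simps)
    moreover have S1: "S1 \<subseteq> S" by (simp add: S1_def)
    ultimately have "\<exists>U c. U \<subseteq> S1 \<and> c ` U \<subseteq> {..<j} \<and> real (card (S1 - U)) \<le> real (Suc j) * x \<and>
      (\<forall>v\<in>U. card (neighbours G v \<inter> S1) + card (colour_class U c (c v)) \<le> card S1) \<and>
      (\<Sum>v\<in>U. card (non_neighbours G U c v)) \<le>
        2 * (\<Sum>v\<in>U. card S1 - card (colour_class U c (c v)) - card (neighbours G v \<inter> S1))"
      using Suc.prems(1) by (intro Suc.IH) auto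
    then obtain U1 c1 where U1: "U1 \<subseteq> S1" "c1 ` U1 \<subseteq> {..<j}" "real (card (S1 - U1)) \<le> real (Suc j) * x"
      and deg1: "\<forall>v\<in>U1. card (neighbours G v \<inter> S1) + card (colour_class U1 c1 (c1 v)) \<le> card S1"
      and sum1: "(\<Sum>v\<in>U1. card (non_neighbours G U1 c1 v)) \<le>
        2 * (\<Sum>v\<in>U1. card S1 - card (colour_class U1 c1 (c1 v)) - card (neighbours G v \<inter> S1))"
      by (elim exE conjE)
    \<comment> \<open>The new class consists of the non-neighbours of \<open>x0\<close>, including
      \<open>x0\<close> itself, apart from \<open>Bd\<close>; it receives the colour
      \<open>j\<close>, which the induction hypothesis leaves free.\<close>
    define A where "A = S - Bd - S1"
    define U where "U = U1 \<union> A"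
    define c where "c = (\<lambda>v. if v \<in> U1 then c1 v else j)"
    have AU1: "A \<inter> U1 = {}" using U1(1) by (auto simp: A_def)
    have fin: "finite S1" "finite U1" "finite A" "finite U" "finite Bd"
      using finS U1(1) S1 by (auto simp: A_def U_def Bd_def intro: finite_subset)
    have c1_less: "c1 v < j" if "v \<in> U1" for v using U1(2) that by auto
    have cA: "c v = j" if "v \<in> A" for v using that AU1 by (auto simp: c_def)
    have clA: "colour_class U c (c v) = A" if "v \<in> A" for v
    proof -
      have "c v = j" using cA that by simp
      moreover have "c w \<noteq> j" if "w \<in> U1" for w using c1_less[OF that] that by (simp add: c_def)
      ultimately show ?thesis using cA by (auto simp: colour_class_def U_def)
    qed
    have cU1: "c v = c1 v" if "v \<in> U1" for v using that by (simp add: c_def)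
    have c_ne: "c w \<noteq> c1 v" if "w \<in> A" "v \<in> U1" for v w
      using cA[OF that(1)] c1_less[OF that(2)] by simp
    have cl1: "colour_class U c (c v) = colour_class U1 c1 (c1 v)" if "v \<in> U1" for v
      using that cU1 c_ne by (auto simp: colour_class_def U_def)
    have nn1: "card (non_neighbours G U c v) = card (non_neighbours G U1 c1 v) + card {u \<in> A. u \<notin> neighbours G v}" if "v \<in> U1" for v
    proof -
      have "non_neighbours G U c v = non_neighbours G U1 c1 v \<union> {u \<in> A. u \<notin> neighbours G v}"
        using that cU1 c_ne by (auto simp: non_neighbours_def U_def)
      moreover have "non_neighbours G U1 c1 v \<inter> {u \<in> A. u \<notin> neighbours G v} = {}"
        using AU1 by (auto simp: non_neighbours_def)
      moreover have "finite (non_neighbours G U1 c1 v)" using fin by (simp add: non_neighbours_def)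
      ultimately show ?thesis using fin by (simp add: card_Un_disjoint)
    qed
    have nnA: "non_neighbours G U c v = {u \<in> U1. u \<notin> neighbours G v}" if "v \<in> A" for v
    proof -
      have "c v = j" using cA that by simp
      moreover have "c w \<noteq> j" if "w \<in> U1" for w using c1_less[OF that] cU1[OF that] by simp
      ultimately show ?thesis using cA by (auto simp: non_neighbours_def U_def)
    qed
    have cardS: "card S = card S1 + card (S - S1)"
      using card_Un_disjoint[of S1 "S - S1"] fin finS S1 by (simp add: Un_absorb1)
    have degS: "card (neighbours G v \<inter> S) = card (neighbours G v \<inter> S1) + card (neighbours G v \<inter> (S - S1))" for v
    proof -
      have "neighbours G v \<inter> S = (neighbours G v \<inter> S1) \<union> (neighbours G v \<inter> (S - S1))" using S1 by blast
      also have "card \<dots> = card (neighbours G v \<inter> S1) + card (neighbours G v \<inter> (S - S1))"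
        by (rule card_Un_disjoint) (use finS fin in auto)
      finally show ?thesis .
    qed
    have split: "card (S - S1) \<ge> card (neighbours G v \<inter> (S - S1)) + card {u \<in> A. u \<notin> neighbours G v}" for v
    proof -
      have "card (neighbours G v \<inter> (S - S1)) + card {u \<in> A. u \<notin> neighbours G v} =
         card ((neighbours G v \<inter> (S - S1)) \<union> {u \<in> A. u \<notin> neighbours G v})"
        using finS fin by (subst card_Un_disjoint) auto
      also have "\<dots> \<le> card (S - S1)" using finS by (intro card_mono) (auto simp: A_def)
      finally show ?thesis .
    qed
    have cardA: "card A \<le> card (S - S1)" using finS by (intro card_mono) (auto simp: A_def)
    have deg: "card (neighbours G v \<inter> S) + card (colour_class U c (c v)) \<le> card S" if "v \<in> U" for v
    proof (cases "v \<in> U1")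
      case True
      then have "card (neighbours G v \<inter> S1) + card (colour_class U1 c1 (c1 v)) \<le> card S1" using deg1 by blast
      then show ?thesis unfolding cl1[OF True] using cardS degS[of v] split[of v] by linarith
    next
      case False
      then have "v \<in> A" using that by (simp add: U_def)
      \<comment> \<open>Maximality of \<open>x0\<close> bounds the degree of every vertex of the new
        class by \<open>card S1\<close>, and the class itself lies in \<open>S - S1\<close>.\<close>
      then have "card (neighbours G v \<inter> S) \<le> card S1" using max unfolding S1_def A_def by blast
      then show ?thesis using clA[OF \<open>v \<in> A\<close>] cardS cardA by simp
    qed
    \<comment> \<open>A missing pair between \<open>U1\<close> and \<open>A\<close> is counted from
      both ends. Both counts are charged to its end in \<open>U1\<close>, whose degree into
      \<open>S - S1\<close> it lowers; this produces the factor 2.\<close>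
    have "(\<Sum>v\<in>U. card (non_neighbours G U c v)) = (\<Sum>v\<in>U1. card (non_neighbours G U c v)) + (\<Sum>v\<in>A. card (non_neighbours G U c v))"
      unfolding U_def using fin AU1 by (intro sum.union_disjoint) auto
    also have "(\<Sum>v\<in>A. card (non_neighbours G U c v)) = (\<Sum>v\<in>A. card {u \<in> U1. u \<notin> neighbours G v})"
      using nnA by simp
    also have "\<dots> = (\<Sum>v\<in>U1. card {u \<in> A. u \<notin> neighbours G v})"
    proof -
      have "{v \<in> A. u \<notin> neighbours G v} = {v \<in> A. v \<notin> neighbours G u}" for u
        by (simp add: mem_neighbours insert_commute)
      then show ?thesis using sum_card_swap[OF fin(3,2), of "\<lambda>v u. u \<notin> neighbours G v"] by simp
    qed
    also have "(\<Sum>v\<in>U1. card (non_neighbours G U c v)) = (\<Sum>v\<in>U1. card (non_neighbours G U1 c1 v)) + (\<Sum>v\<in>U1. card {u \<in> A. u \<notin> neighbours G v})"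
      using nn1 by (simp add: sum.distrib)
    finally have "(\<Sum>v\<in>U. card (non_neighbours G U c v)) =
       (\<Sum>v\<in>U1. card (non_neighbours G U1 c1 v)) + 2 * (\<Sum>v\<in>U1. card {u \<in> A. u \<notin> neighbours G v})" by simp
    also have "\<dots> \<le> 2 * (\<Sum>v\<in>U1. (card S1 - card (colour_class U1 c1 (c1 v)) - card (neighbours G v \<inter> S1)) + card {u \<in> A. u \<notin> neighbours G v})"
      using sum1 by (simp add: sum.distrib)
    also have "\<dots> \<le> 2 * (\<Sum>v\<in>U1. card S - card (colour_class U c (c v)) - card (neighbours G v \<inter> S))"
    proof (intro mult_left_mono sum_mono)
      fix v assume v: "v \<in> U1"
      then have "card (neighbours G v \<inter> S1) + card (colour_class U1 c1 (c1 v)) \<le> card S1" using deg1 by blast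
      then show "card S1 - card (colour_class U1 c1 (c1 v)) - card (neighbours G v \<inter> S1) + card {u \<in> A. u \<notin> neighbours G v}
        \<le> card S - card (colour_class U c (c v)) - card (neighbours G v \<inter> S)"
        unfolding cl1[OF v] using cardS degS[of v] split[of v] by linarith
    qed simp
    also have "\<dots> \<le> 2 * (\<Sum>v\<in>U. card S - card (colour_class U c (c v)) - card (neighbours G v \<inter> S))"
      using fin by (intro mult_left_mono sum_mono2) (auto simp: U_def)
    finally have sum: "(\<Sum>v\<in>U. card (non_neighbours G U c v)) \<le> 2 * (\<Sum>v\<in>U. card S - card (colour_class U c (c v)) - card (neighbours G v \<inter> S))" .
    have "card (S - U) \<le> card ((S1 - U1) \<union> Bd)"
      using fin by (intro card_mono) (auto simp: U_def A_def)
    also have "\<dots> \<le> card (S1 - U1) + card Bd" by (rule card_Un_le)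
    finally have "real (card (S - U)) \<le> real (card (S1 - U1)) + real (card Bd)" by linarith
    also have "\<dots> \<le> real (Suc j) * x + x" using U1(3) Bd by linarith
    also have "\<dots> = real (Suc (Suc j)) * x" by (simp add: algebra_simps)
    finally have rest: "real (card (S - U)) \<le> real (Suc (Suc j)) * x" .
    have "U \<subseteq> S" using U1(1) S1 by (auto simp: U_def A_def)
    moreover have "c ` U \<subseteq> {..<Suc j}" using c1_less cA cU1 by (auto simp: U_def less_Suc_eq)
    ultimately show ?thesis using rest deg sum by (intro exI[of _ U] exI[of _ c] conjI ballI)
  qed
qed

text \<open>Greedy completion, one class at a time. At any moment at most \<open>k * m\<close>
  vertices are chosen, each excluding itself and at most \<open>z\<close> non-neighbours, so at
  least \<open>m\<close> candidates of the current colour remain. Vertices added later are adjacent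
  to everything of another colour, hence missing pairs stay inside \<open>X\<close>.\<close>

lemma extend_balanced:
  assumes G: "ugraph G" and fin: "finite U" "finite X" and cX: "c ` X \<subseteq> {..<k}"
    and X_small: "\<And>i. i < k \<Longrightarrow> card (colour_class X c i) \<le> m"
    and few: "\<And>x. x \<in> X \<union> U \<Longrightarrow> card (non_neighbours G U c x) \<le> z"
    and large: "\<And>i. i < k \<Longrightarrow> card (colour_class U c i) \<ge> k * m * (z + 1) + m"
  shows "\<exists>B. X \<subseteq> B \<and> B \<subseteq> X \<union> U \<and> c ` B \<subseteq> {..<k} \<and> (\<forall>i<k. card (colour_class B c i) = m) \<and>
    (\<forall>u\<in>B. \<forall>v\<in>B. c u \<noteq> c v \<longrightarrow> u \<in> X \<and> v \<in> X \<or> v \<in> neighbours G u)"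
proof -
  \<comment> \<open>The induction runs over the number \<open>l\<close> of completed classes; the
    classes from \<open>l\<close> on still coincide with those of \<open>X\<close>.\<close>
  have "\<exists>B. X \<subseteq> B \<and> B \<subseteq> X \<union> U \<and> c ` B \<subseteq> {..<k} \<and> (\<forall>i<l. card (colour_class B c i) = m) \<and>
    (\<forall>i. l \<le> i \<longrightarrow> colour_class B c i = colour_class X c i) \<and>
    (\<forall>u\<in>B. \<forall>v\<in>B. c u \<noteq> c v \<longrightarrow> u \<in> X \<and> v \<in> X \<or> v \<in> neighbours G u)" if "l \<le> k" for l
    using that
  proof (induction l)
    case 0
    then show ?case using cX by (intro exI[of _ X]) auto
  next
    case (Suc l)
    then have lk: "l < k" by simp
    obtain B where B: "X \<subseteq> B" "B \<subseteq> X \<union> U" "c ` B \<subseteq> {..<k}" "\<forall>i<l. card (colour_class B c i) = m"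
      "\<forall>i. l \<le> i \<longrightarrow> colour_class B c i = colour_class X c i"
      and adj: "\<forall>u\<in>B. \<forall>v\<in>B. c u \<noteq> c v \<longrightarrow> u \<in> X \<and> v \<in> X \<or> v \<in> neighbours G u"
      using Suc.IH[OF less_imp_le[OF lk]] by (elim exE conjE)
    have finB: "finite B" using B(2) fin finite_subset by blast
    have "card B = (\<Sum>i<k. card (colour_class B c i))" by (rule card_eq_sum_colour_class[OF finB B(3)])
    also have "\<dots> \<le> (\<Sum>i<k. m)"
    proof (rule sum_mono)
      fix i assume "i \<in> {..<k}"
      then show "card (colour_class B c i) \<le> m" using B(4,5) X_small by (cases "i < l") auto
    qed
    finally have cB: "card B \<le> k * m" by simp
    define Y where "Y = colour_class U c l - (B \<union> (\<Union>x\<in>B. non_neighbours G U c x))"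
    have "card (B \<union> (\<Union>x\<in>B. non_neighbours G U c x)) \<le> card B + card (\<Union>x\<in>B. non_neighbours G U c x)"
      by (rule card_Un_le)
    also have "\<dots> \<le> card B + (\<Sum>x\<in>B. card (non_neighbours G U c x))"
      using finB by (intro add_left_mono card_UN_le)
    also have "\<dots> \<le> card B + (\<Sum>x\<in>B. z)"
      using few B(2) by (intro add_left_mono sum_mono) auto
    also have "\<dots> = card B * (z + 1)" by simp
    also have "\<dots> \<le> k * m * (z + 1)" using cB by (rule mult_right_mono) simp
    finally have "card (B \<union> (\<Union>x\<in>B. non_neighbours G U c x)) \<le> k * m * (z + 1)" .
    moreover have "finite (\<Union>x\<in>B. non_neighbours G U c x)" using finB fin by (auto simp: non_neighbours_def)
    ultimately have "card Y \<ge> m"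
      unfolding Y_def using large[OF lk] diff_card_le_card_Diff[of "B \<union> (\<Union>x\<in>B. non_neighbours G U c x)" "colour_class U c l"] finB
      by simp
    then have "m - card (colour_class X c l) \<le> card Y" by simp
    then obtain Z where Z: "Z \<subseteq> Y" "card Z = m - card (colour_class X c l)" by (metis obtain_subset_with_card_n)
    have Zl: "c u = l" "u \<in> U" "u \<notin> B" if "u \<in> Z" for u using Z(1) that by (auto simp: Y_def colour_class_def)
    have finZ: "finite Z" using Z(1) fin(1) by (auto simp: Y_def colour_class_def intro: finite_subset)
    have adjZ: "u \<in> neighbours G x" if "u \<in> Z" "x \<in> B" "c x \<noteq> l" for u x
    proof -
      have "u \<notin> non_neighbours G U c x" using that(1,2) Z(1) by (auto simp: Y_def)
      then show ?thesis using Zl[OF that(1)] that(3) by (simp add: non_neighbours_def)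
    qed
    have cli: "colour_class (B \<union> Z) c i = colour_class B c i" if "i \<noteq> l" for i using Zl that by (auto simp: colour_class_def)
    have "colour_class (B \<union> Z) c l = colour_class X c l \<union> Z" using Zl B(5) by (auto simp: colour_class_def)
    moreover have "colour_class X c l \<inter> Z = {}" using Zl(3) B(1) by (auto simp: colour_class_def)
    ultimately have cll: "card (colour_class (B \<union> Z) c l) = m"
      using Z(2) X_small[OF lk] finZ fin(2) by (simp add: card_Un_disjoint finite_colour_class)
    show ?case
    proof (intro exI[of _ "B \<union> Z"] conjI)
      show "X \<subseteq> B \<union> Z" using B(1) by auto
      show "B \<union> Z \<subseteq> X \<union> U" using B(2) Zl by auto
      show "c ` (B \<union> Z) \<subseteq> {..<k}" using B(3) Zl lk by auto
      show "\<forall>i<Suc l. card (colour_class (B \<union> Z) c i) = m" using cli cll B(4) by (auto simp: less_Suc_eq)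
      show "\<forall>i\<ge>Suc l. colour_class (B \<union> Z) c i = colour_class X c i" using cli B(5) by auto
      show "\<forall>u\<in>B \<union> Z. \<forall>v\<in>B \<union> Z. c u \<noteq> c v \<longrightarrow> u \<in> X \<and> v \<in> X \<or> v \<in> neighbours G u"
      proof (intro ballI impI)
        fix u v assume uv: "u \<in> B \<union> Z" "v \<in> B \<union> Z" "c u \<noteq> c v"
        then consider "u \<in> B" "v \<in> B" | "u \<in> B" "v \<in> Z" | "u \<in> Z" "v \<in> B" | "u \<in> Z" "v \<in> Z" by blast
        then show "u \<in> X \<and> v \<in> X \<or> v \<in> neighbours G u"
        proof cases
          case 1 then show ?thesis using adj uv by blast
        next
          case 2 then show ?thesis using adjZ Zl(1) uv by metis
        next
          case 3
          then have "u \<in> neighbours G v" using adjZ Zl(1) uv by metis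
          then show ?thesis using neighbours_sym[of u G v] by simp
        next
          case 4 then show ?thesis using Zl(1) uv by metis
        qed
      qed
    qed
  qed
  from this[of k] show ?thesis by blast
qed

section \<open>Stability\<close>

text \<open>The properties of \<open>F\<close>-free graphs that the stability argument uses; \<open>h\<close> stands for the number of
  vertices of \<open>F\<close>.\<close>

locale excess_bounded =
  fixes Free :: "nat ugraph \<Rightarrow> bool" and k b h m0 :: nat
  assumes k_ge_2: "k \<ge> 2"
    and excess: "\<And>G B c m. ugraph G \<Longrightarrow> Free G \<Longrightarrow> B \<subseteq> verts G \<Longrightarrow> c ` B \<subseteq> {..<k} \<Longrightarrow> m \<ge> m0 \<Longrightarrow>
      (\<And>i. i < k \<Longrightarrow> card (colour_class B c i) = m) \<Longrightarrow> card {e \<in> edges G. e \<subseteq> B} \<le> card (cross_edges B c) + b"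
    and add_edges: "\<And>V c i. finite V \<Longrightarrow> c ` V \<subseteq> {..<k} \<Longrightarrow> i < k \<Longrightarrow> 2 * b \<le> card (colour_class V c i) \<Longrightarrow>
      \<exists>I. card I = b \<and> (\<forall>e\<in>I. e \<subseteq> colour_class V c i \<and> card e = 2) \<and> Free (V, cross_edges V c \<union> I)"
    and subgraph_Free: "\<And>G G'. ugraph G \<Longrightarrow> Free G \<Longrightarrow> ugraph G' \<Longrightarrow> verts G' \<subseteq> verts G \<Longrightarrow>
      edges G' \<subseteq> edges G \<Longrightarrow> Free G'"
    and replace_Free: "\<And>G v N. ugraph G \<Longrightarrow> Free G \<Longrightarrow> v \<in> verts G \<Longrightarrow> N \<subseteq> verts G - {v} \<Longrightarrow>
      (\<And>Q. Q \<subseteq> N \<Longrightarrow> card Q \<le> h \<Longrightarrow> h \<le> card {u \<in> verts G - {v}. Q \<subseteq> neighbours G u}) \<Longrightarrow>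
      Free (verts G, {e \<in> edges G. v \<notin> e} \<union> {{v, u} |u. u \<in> N})"
begin

text \<open>The form in which \<open>excess\<close> yields contradictions: once all cross pairs of a
  balanced set are present, more than \<open>b\<close> further edges are impossible.\<close>

lemma extra_edges_le:
  assumes G: "ugraph G" "Free G" and B: "B \<subseteq> verts G" "c ` B \<subseteq> {..<k}" "m \<ge> m0"
    "\<And>i. i < k \<Longrightarrow> card (colour_class B c i) = m"
    and cross_edges: "cross_edges B c \<subseteq> edges G" and J: "J \<subseteq> edges G" "\<forall>e\<in>J. e \<subseteq> B" "J \<inter> cross_edges B c = {}"
  shows "card J \<le> b"
proof -
  have fin: "finite (edges G)" "finite B" using G(1) B(1) ugraph_finite_edges ugraph_finite finite_subset by blast+
  have "card (cross_edges B c) + card J = card (cross_edges B c \<union> J)"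
    using fin J cross_edges by (subst card_Un_disjoint) (auto intro: finite_subset)
  also have "\<dots> \<le> card {e \<in> edges G. e \<subseteq> B}"
  proof (rule card_mono)
    have "e \<subseteq> B" if "e \<in> cross_edges B c" for e using that by (auto elim: cross_edges_cases)
    then show "cross_edges B c \<union> J \<subseteq> {e \<in> edges G. e \<subseteq> B}" using J cross_edges by auto
  qed (use fin in simp)
  also have "\<dots> \<le> card (cross_edges B c) + b" by (rule excess[OF G B])
  finally show ?thesis by simp
qed

text \<open>By pigeonhole some class has at least \<open>2 * b\<close> vertices; add
  \<open>b\<close> edges there by \<open>add_edges\<close> and delete them again.\<close>

lemma cross_edges_Free:
  assumes V: "finite V" "c ` V \<subseteq> {..<k}" and large: "2 * b * k \<le> card V"
  shows "Free (V, cross_edges V c)"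
proof -
  have "\<exists>i<k. 2 * b \<le> card (colour_class V c i)"
  proof (rule ccontr)
    assume "\<not> ?thesis"
    then have less: "\<And>i. i < k \<Longrightarrow> card (colour_class V c i) < 2 * b" by force
    have "card V = (\<Sum>i<k. card (colour_class V c i))" by (rule card_eq_sum_colour_class[OF V])
    also have "\<dots> < (\<Sum>i<k. 2 * b)"
      using less k_ge_2 by (intro sum_strict_mono) (auto simp: lessThan_empty_iff)
    finally show False using large by (simp add: mult.commute)
  qed
  then obtain i where i: "i < k" "2 * b \<le> card (colour_class V c i)" by blast
  then obtain I where I: "card I = b" "\<forall>e\<in>I. e \<subseteq> colour_class V c i \<and> card e = 2" "Free (V, cross_edges V c \<union> I)"
    using add_edges[OF V i] by blast
  have "ugraph (V, cross_edges V c \<union> I)"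
    using ugraph_cross_edges[OF V(1), of c] I(2) colour_class_subset[of V c i] unfolding ugraph_def by auto
  from subgraph_Free[OF this I(3) ugraph_cross_edges[OF V(1), of c]] show ?thesis by simp
qed

text \<open>Richness would give a complete (k+1)-partite subgraph with parts of size
  \<open>2 * M\<close>. Merging halves of its last two parts produces a balanced
  \<open>k\<close>-colouring all of whose cross pairs are edges, with far too many edges inside the
  merged class.\<close>

lemma Free_not_rich:
  assumes "\<epsilon> > (0::real)"
  shows "\<exists>N. \<forall>G. ugraph G \<and> Free G \<and> card (verts G) \<ge> N \<longrightarrow> \<not> rich G (\<epsilon> * card (verts G)) (Suc k) (verts G)"
proof -
  define M where "M = max m0 (b + 1)"
  have M: "M \<ge> m0" "M > b" by (auto simp: M_def)
  then have "2 * M > 0" by simp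
  from rich_contains_complete_multipartite[OF assms this, of "Suc k"] obtain N where
    N: "\<forall>G :: nat ugraph. ugraph G \<and> card (verts G) \<ge> N \<and> rich G (\<epsilon> * card (verts G)) (Suc k) (verts G) \<longrightarrow>
    (\<exists>B. \<forall>i<Suc k. B i \<subseteq> verts G \<and> card (B i) = 2 * M \<and>
      (\<forall>i'<Suc k. i \<noteq> i' \<longrightarrow> (\<forall>u\<in>B i. \<forall>v\<in>B i'. {u, v} \<in> edges G)))" ..
  show ?thesis
  proof (intro exI[of _ N] allI impI notI)
    fix G :: "nat ugraph"
    assume a: "ugraph G \<and> Free G \<and> card (verts G) \<ge> N" and rich: "rich G (\<epsilon> * card (verts G)) (Suc k) (verts G)"
    then have G: "ugraph G" "Free G" by auto
    have "\<exists>B. \<forall>i<Suc k. B i \<subseteq> verts G \<and> card (B i) = 2 * M \<and>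
      (\<forall>i'<Suc k. i \<noteq> i' \<longrightarrow> (\<forall>u\<in>B i. \<forall>v\<in>B i'. {u, v} \<in> edges G))"
      using N a rich by (elim allE[of _ G] impE) (simp_all del: rich.simps)
    then obtain A where A: "\<forall>i<Suc k. A i \<subseteq> verts G \<and> card (A i) = 2 * M \<and>
      (\<forall>i'<Suc k. i \<noteq> i' \<longrightarrow> (\<forall>u\<in>A i. \<forall>v\<in>A i'. {u, v} \<in> edges G))" ..
    then have A_sub: "A i \<subseteq> verts G" and A_card: "card (A i) = 2 * M" if "i \<le> k" for i
      using that by (simp_all add: less_Suc_eq_le)
    have A_adj: "{u, v} \<in> edges G" if "i \<le> k" "i' \<le> k" "i \<noteq> i'" "u \<in> A i" "v \<in> A i'" for i i' u v
      using A that by (simp add: less_Suc_eq_le)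
    have A_disj: "i = i'" if "i \<le> k" "i' \<le> k" "u \<in> A i" "u \<in> A i'" for i i' u
      using A_adj[OF that(1,2) _ that(3,4)] ugraph_edgeD(3)[OF G(1), of u u] by blast
    have "M \<le> card (A (k - 1))" "M \<le> card (A k)" using A_card by auto
    then obtain P Q where P: "P \<subseteq> A (k - 1)" "card P = M" and Q: "Q \<subseteq> A k" "card Q = M"
      by (metis obtain_subset_with_card_n)
    have fin: "finite P" "finite Q" using P(2) Q(2) M(2) by (metis card.infinite not_less0)+
    define B where "B = (\<Union>i<k-1. A i) \<union> P \<union> Q"
    define idx where "idx v = (THE i. i \<le> k \<and> v \<in> A i)" for v
    have idx: "idx v = i" if "i \<le> k" "v \<in> A i" for i v
      unfolding idx_def using that A_disj by (intro the_equality) auto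
    \<comment> \<open>Truncation at \<open>k - 1\<close> merges the two halves \<open>P\<close> and
      \<open>Q\<close> into one class of the common size \<open>2 * M\<close>.\<close>
    define c where "c v = min (idx v) (k - 1)" for v
    have c_A: "c v = min i (k - 1)" if "i \<le> k" "v \<in> A i" for i v using idx[OF that] by (simp add: c_def)
    have B_cases: "\<exists>i\<le>k. v \<in> A i" if "v \<in> B" for v
    proof -
      from that consider i where "i < k - 1" "v \<in> A i" | "v \<in> P" | "v \<in> Q" unfolding B_def by blast
      then show ?thesis
      proof cases
        case 1 then show ?thesis by (intro exI[of _ i]) auto
      next
        case 2 then show ?thesis using P(1) by (intro exI[of _ "k-1"]) auto
      next
        case 3 then show ?thesis using Q(1) by blast
      qed
    qed
    have BV: "B \<subseteq> verts G" using B_cases A_sub by blast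
    have cB: "c ` B \<subseteq> {..<k}" using k_ge_2 by (auto simp: c_def)
    have cl1: "colour_class B c i = A i" if "i < k - 1" for i
    proof (intro equalityI subsetI)
      fix v assume "v \<in> colour_class B c i"
      then have v: "v \<in> B" "c v = i" by (auto simp: colour_class_def)
      then obtain i' where "i' \<le> k" "v \<in> A i'" using B_cases by blast
      then show "v \<in> A i" using c_A[of i' v] v that by (auto simp: min_def split: if_splits)
    next
      fix v assume v: "v \<in> A i"
      then have "c v = i" using c_A[of i v] that by simp
      then show "v \<in> colour_class B c i" using v that by (auto simp: colour_class_def B_def)
    qed
    have cl2: "colour_class B c (k - 1) = P \<union> Q"
    proof (intro equalityI subsetI)
      fix v assume "v \<in> colour_class B c (k - 1)"
      then have v: "v \<in> B" "c v = k - 1" by (auto simp: colour_class_def)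
      moreover have "c v = i" if "v \<in> A i" "i < k - 1" for i using c_A[of i v] that by simp
      ultimately show "v \<in> P \<union> Q" unfolding B_def by fastforce
    next
      fix v assume v: "v \<in> P \<union> Q"
      then have "c v = k - 1" using P(1) Q(1) c_A[of "k-1" v] c_A[of k v] by auto
      then show "v \<in> colour_class B c (k - 1)" using v by (auto simp: colour_class_def B_def)
    qed
    have PQ: "P \<inter> Q = {}" using P(1) Q(1) A_disj[of "k-1" k] k_ge_2 by fastforce
    have card_cl: "card (colour_class B c i) = 2 * M" if "i < k" for i
    proof (cases "i = k - 1")
      case True
      then show ?thesis using cl2 P(2) Q(2) PQ fin by (simp add: card_Un_disjoint)
    next
      case False
      then show ?thesis using cl1[of i] A_card[of i] that by simp
    qed
    have cross_edges: "cross_edges B c \<subseteq> edges G"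
    proof
      fix e assume "e \<in> cross_edges B c"
      then obtain u v where uv: "e = {u, v}" "u \<in> B" "v \<in> B" "c u \<noteq> c v" by (rule cross_edges_cases)
      then obtain i i' where "i \<le> k" "u \<in> A i" "i' \<le> k" "v \<in> A i'" using B_cases by metis
      moreover from this have "i \<noteq> i'" using uv(4) c_A by metis
      ultimately show "e \<in> edges G" using A_adj uv(1) by blast
    qed
    have "P \<noteq> {}" using P(2) M(2) by auto
    then obtain p where p: "p \<in> P" by blast
    \<comment> \<open>A star from one vertex of \<open>P\<close> to \<open>Q\<close> already has
      \<open>M > b\<close> edges inside the merged class.\<close>
    define J where "J = (\<lambda>q. {p, q}) ` Q"
    have "card J = M" unfolding J_def using Q(2) by (subst card_image) (auto simp: inj_on_def doubleton_eq_iff)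
    moreover have "card J \<le> b"
    proof (rule extra_edges_le[OF G BV cB _ card_cl cross_edges])
      show "m0 \<le> 2 * M" using M by simp
      have "k - 1 \<noteq> k" using k_ge_2 by simp
      then show "J \<subseteq> edges G" unfolding J_def using p P(1) Q(1) A_adj[of "k-1" k] by fastforce
      show "\<forall>e\<in>J. e \<subseteq> B" using p unfolding J_def B_def by auto
      have "c q = c p" if "q \<in> Q" for q
      proof -
        have "p \<in> colour_class B c (k - 1)" "q \<in> colour_class B c (k - 1)" using cl2 that p by auto
        then show ?thesis by (simp add: colour_class_def)
      qed
      then show "J \<inter> cross_edges B c = {}" unfolding J_def using cross_edges_iff[of p _ B c] by auto
    qed
    ultimately show False using M(2) by simp
  qed
qed

end

section \<open>Optimal graphs are close to complete multipartite graphs\<close>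

locale extremal_setting = excess_bounded + degree_function
begin

definition opt :: "nat ugraph \<Rightarrow> bool" where
  "opt G \<longleftrightarrow> ugraph G \<and> Free G \<and>
     (\<forall>G'. ugraph G' \<and> Free G' \<and> card (verts G') = card (verts G) \<longrightarrow> degree_sum g G' \<le> degree_sum g G)"

text \<open>Every colouring, balanced or not, gives a complete multipartite competitor. All lower
  bounds for the optimum are of this kind until single edges matter.\<close>

lemma opt_ge_cross_edges:
  assumes "opt G" "2 * b * k \<le> card (verts G)" "c ` verts G \<subseteq> {..<k}"
  shows "(\<Sum>v\<in>verts G. g (card (verts G) - card (colour_class (verts G) c (c v)))) \<le> degree_sum g G"
proof -
  have fin: "finite (verts G)" using assms(1) ugraph_finite[of G] by (simp add: opt_def)
  have "degree_sum g (verts G, cross_edges (verts G) c) \<le> degree_sum g G"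
    using assms(1) cross_edges_Free[OF fin assms(3,2)] ugraph_cross_edges[OF fin, of c] by (auto simp: opt_def)
  moreover have "degree_sum g (verts G, cross_edges (verts G) c) = (\<Sum>v\<in>verts G. g (card (verts G) - card (colour_class (verts G) c (c v))))"
    unfolding degree_sum_def using degree_cross_edges[OF fin] by simp
  ultimately show ?thesis by simp
qed

lemma degree_le: "ugraph G \<Longrightarrow> degree G v \<le> card (verts G)"
  by (simp add: degree_eq_card_neighbours card_mono neighbours_subset ugraph_finite)

lemma opt_ugraph: "opt G \<Longrightarrow> ugraph G" by (simp add: opt_def)
lemma opt_Free: "opt G \<Longrightarrow> Free G" by (simp add: opt_def)
lemma opt_finite: "opt G \<Longrightarrow> finite (verts G)" by (simp add: opt_def ugraph_finite)

text \<open>Deficits up to \<tau> are paid for by the additive term, larger ones by superadditivity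
  of the power. This turns a bound on the total loss of powers into one on the total loss of
  degrees, even where degrees may be small.\<close>

lemma deficit_le:
  fixes a d \<tau> :: real
  assumes "0 \<le> d" "d \<le> a" "0 \<le> \<tau>"
  shows "(a - d) * \<tau> ^ s \<le> \<tau> ^ Suc s + (a ^ Suc s - d ^ Suc s)"
proof (cases "a - d \<le> \<tau>")
  case True
  have "(a - d) * \<tau> ^ s \<le> \<tau> * \<tau> ^ s" using True assms by (intro mult_right_mono) auto
  moreover have "d ^ Suc s \<le> a ^ Suc s" using assms by (intro power_mono)
  ultimately show ?thesis by simp
next
  case False
  have "(a - d) * \<tau> ^ s \<le> (a - d) * (a - d) ^ s"
    using False assms by (intro mult_left_mono power_mono) auto
  also have "\<dots> \<le> a ^ Suc s - d ^ Suc s" using power_diff_ge_diff_power[OF assms(1,2), of s] by simp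
  also have "\<dots> \<le> \<tau> ^ Suc s + (a ^ Suc s - d ^ Suc s)" using assms(3) by simp
  finally show ?thesis .
qed

text \<open>Peeling bounds each degree by that in the complete multipartite graph on the peeled
  classes. Optimality makes the total loss in \<open>g\<close> small, \<open>deficit_le\<close>
  converts it into a small total loss of degrees, and peeling bounds the missing pairs by twice the
  latter.\<close>

lemma approximate_structure:
  assumes "\<eta> > (0::real)"
  shows "\<exists>N. \<forall>G. opt G \<and> card (verts G) \<ge> N \<longrightarrow>
    (\<exists>U c. U \<subseteq> verts G \<and> c ` U \<subseteq> {..<k} \<and> real (card (verts G - U)) \<le> \<eta> * card (verts G) \<and>
      (\<forall>v\<in>U. degree G v + card (colour_class U c (c v)) \<le> card (verts G)) \<and>
      real (\<Sum>v\<in>U. card (non_neighbours G U c v)) \<le> \<eta> * real (card (verts G)) ^ 2)"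
proof -
  \<comment> \<open>The total degree deficit will be at most \<open>3 * \<tau> * n ^ 2\<close>, and
    missing pairs are at most twice that.\<close>
  define \<tau> where "\<tau> = \<eta> / 6"
  have \<tau>: "\<tau> > 0" using assms by (simp add: \<tau>_def)
  \<comment> \<open>Bounds the proportion of uncoloured vertices. They lower the degrees of the
    coloured ones in the competitor and have uncontrolled degrees in \<open>G\<close>; either effect
    is at most \<open>L * \<rho> * n ^ (s + 2)\<close>.\<close>
  define \<rho> where "\<rho> = min \<eta> (\<tau> ^ Suc s / (2 * L))"
  have \<rho>: "\<rho> > 0" "\<rho> \<le> \<eta>" "2 * L * \<rho> \<le> \<tau> ^ Suc s"
  proof -
    show "\<rho> > 0" "\<rho> \<le> \<eta>" using assms \<tau> L_pos by (auto simp: \<rho>_def)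
    have "\<rho> \<le> \<tau> ^ Suc s / (2 * L)" by (simp add: \<rho>_def)
    then show "2 * L * \<rho> \<le> \<tau> ^ Suc s" using L_pos by (simp add: field_simps)
  qed
  \<comment> \<open>Peeling with \<open>x = \<epsilon> * n\<close> leaves at most
    \<open>Suc k * x\<close> vertices uncoloured.\<close>
  define \<epsilon> where "\<epsilon> = \<rho> / real (Suc k)"
  have \<epsilon>: "\<epsilon> > 0" using \<rho> by (simp add: \<epsilon>_def)
  obtain K where K: "K \<ge> 0" "\<And>n d. 1 \<le> n \<Longrightarrow> d \<le> n \<Longrightarrow> \<bar>g d - real d ^ Suc s\<bar> \<le> K * real n ^ s"
    using g_approx_power by auto
  from Free_not_rich[OF \<epsilon>] obtain N1 where N1: "\<forall>G. ugraph G \<and> Free G \<and> card (verts G) \<ge> N1 \<longrightarrow>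
    \<not> rich G (\<epsilon> * card (verts G)) (Suc k) (verts G)" ..
  define N where "N = N1 + 2 * b * k + 1 + nat \<lceil>2 * K / \<tau> ^ Suc s\<rceil>"
  show ?thesis
  proof (intro exI[of _ N] allI impI, elim conjE)
    fix G assume G: "opt G" and N: "N \<le> card (verts G)"
    define V where "V = verts G"
    define n where "n = card V"
    have uG: "ugraph G" and finV: "finite V" using G opt_ugraph opt_finite by (auto simp: V_def)
    have n: "n \<ge> 1" "n \<ge> N1" "n \<ge> 2 * b * k" using N by (auto simp: N_def n_def V_def)
    have nK: "2 * K \<le> \<tau> ^ Suc s * real n"
    proof -
      have "real n \<ge> 2 * K / \<tau> ^ Suc s" using N unfolding N_def n_def V_def by linarith
      then show ?thesis using \<tau> by (simp add: field_simps)
    qed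
    have "\<not> rich G (\<epsilon> * real n) (Suc k) V"
      using N1 uG opt_Free[OF G] n(2) unfolding n_def V_def by blast
    from peeling[OF uG _ this] have "\<exists>U c. U \<subseteq> V \<and> c ` U \<subseteq> {..<k} \<and>
      real (card (V - U)) \<le> real (Suc k) * (\<epsilon> * real n) \<and>
      (\<forall>v\<in>U. card (neighbours G v \<inter> V) + card (colour_class U c (c v)) \<le> card V) \<and>
      (\<Sum>v\<in>U. card (non_neighbours G U c v)) \<le> 2 * (\<Sum>v\<in>U. card V - card (colour_class U c (c v)) - card (neighbours G v \<inter> V))"
      by (simp add: V_def)
    then obtain U c where U: "U \<subseteq> V" "c ` U \<subseteq> {..<k}"
      and R: "real (card (V - U)) \<le> real (Suc k) * (\<epsilon> * real n)"
      and deg: "\<forall>v\<in>U. card (neighbours G v \<inter> V) + card (colour_class U c (c v)) \<le> card V"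
      and miss: "(\<Sum>v\<in>U. card (non_neighbours G U c v)) \<le> 2 * (\<Sum>v\<in>U. card V - card (colour_class U c (c v)) - card (neighbours G v \<inter> V))"
      by (elim exE conjE)
    have finU: "finite U" using U finV finite_subset by blast
    have nbsV: "card (neighbours G v \<inter> V) = degree G v" for v
      using neighbours_subset[OF uG, of v] by (simp add: degree_eq_card_neighbours[OF uG] V_def Int_absorb2)
    define R where "R = V - U"
    have cR: "real (card R) \<le> \<rho> * real n" using R by (simp add: R_def \<epsilon>_def del: of_nat_Suc)
    define a where "a v = n - card (colour_class U c (c v))" for v
    have d_le: "degree G v + card (colour_class U c (c v)) \<le> n" if "v \<in> U" for v
      using deg that nbsV by (simp add: n_def)
    then have da: "degree G v \<le> a v" if "v \<in> U" for v using that by (force simp: a_def)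
    have an: "a v \<le> n" for v by (simp add: a_def)
    \<comment> \<open>The competitor needs all vertices; the uncoloured ones join class 0, which
      enlarges any class by at most \<open>card R\<close>.\<close>
    define c' where "c' v = (if v \<in> U then c v else 0)" for v
    have c': "c' ` V \<subseteq> {..<k}" using U(2) k_ge_2 by (auto simp: c'_def)
    have "(\<Sum>v\<in>U. g (a v) - real (card R) * (L * real n ^ s)) \<le> (\<Sum>v\<in>U. g (n - card (colour_class V c' (c' v))))"
    proof (rule sum_mono)
      fix v assume v: "v \<in> U"
      have "colour_class V c' (c' v) \<subseteq> colour_class U c (c v) \<union> R" using v by (auto simp: colour_class_def c'_def R_def)
      then have "card (colour_class V c' (c' v)) \<le> card (colour_class U c (c v) \<union> R)"
        using finV finU by (intro card_mono) (auto simp: R_def finite_colour_class)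
      also have "\<dots> \<le> card (colour_class U c (c v)) + card R" by (rule card_Un_le)
      finally have "a v - card R \<le> n - card (colour_class V c' (c' v))" by (simp add: a_def)
      then have "g (a v - card R) \<le> g (n - card (colour_class V c' (c' v)))" by (rule monoD[OF g_mono])
      moreover have "g (a v) - g (a v - card R) \<le> (real (a v) - real (a v - card R)) * (L * real n ^ s)"
        using n(1) an by (intro g_diff_le) auto
      moreover have "(real (a v) - real (a v - card R)) * (L * real n ^ s) \<le> real (card R) * (L * real n ^ s)"
        using L_pos by (intro mult_right_mono) auto
      ultimately show "g (a v) - real (card R) * (L * real n ^ s) \<le> g (n - card (colour_class V c' (c' v)))" by linarith
    qed
    also have "\<dots> \<le> (\<Sum>v\<in>V. g (n - card (colour_class V c' (c' v))))"
      using finV U(1) g_nonneg by (intro sum_mono2) auto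
    also have "\<dots> \<le> degree_sum g G"
      using opt_ge_cross_edges[OF G _ c'[unfolded V_def]] n(3) by (simp add: n_def V_def)
    also have "degree_sum g G = (\<Sum>v\<in>U. g (degree G v)) + (\<Sum>v\<in>R. g (degree G v))"
      unfolding degree_sum_def R_def V_def[symmetric] using sum.subset_diff[OF U(1) finV] by (simp add: add.commute)
    also have "(\<Sum>v\<in>R. g (degree G v)) \<le> (\<Sum>v\<in>R. L * real n ^ Suc s)"
      using degree_le[OF uG] n(1) by (intro sum_mono g_le) (auto simp: n_def V_def)
    finally have "(\<Sum>v\<in>U. g (a v)) - real (card U) * (real (card R) * (L * real n ^ s)) \<le> (\<Sum>v\<in>U. g (degree G v)) + real (card R) * (L * real n ^ Suc s)"
      by (simp add: sum_subtractf)
    moreover have "real (card U) * (real (card R) * (L * real n ^ s)) \<le> real n * (real (card R) * (L * real n ^ s))"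
      using L_pos U finV card_mono[of V U] by (intro mult_right_mono) (auto simp: n_def)
    ultimately have "(\<Sum>v\<in>U. g (a v) - g (degree G v)) \<le> 2 * L * real (card R) * real n ^ Suc s"
      by (simp add: sum_subtractf algebra_simps)
    also have "\<dots> \<le> 2 * L * (\<rho> * real n) * real n ^ Suc s"
      using cR L_pos by (intro mult_right_mono mult_left_mono) auto
    also have "\<dots> = (2 * L * \<rho>) * real n ^ Suc (Suc s)" by (simp add: algebra_simps)
    also have "\<dots> \<le> \<tau> ^ Suc s * real n ^ Suc (Suc s)" using \<rho>(3) by (intro mult_right_mono) auto
    finally have gsum: "(\<Sum>v\<in>U. g (a v) - g (degree G v)) \<le> \<tau> ^ Suc s * real n ^ Suc (Suc s)" .
    define D where "D = (\<Sum>v\<in>U. real (a v) - real (degree G v))"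
    have "D * (\<tau> * real n) ^ s = (\<Sum>v\<in>U. (real (a v) - real (degree G v)) * (\<tau> * real n) ^ s)"
      by (simp add: D_def sum_distrib_right)
    also have "\<dots> \<le> (\<Sum>v\<in>U. ((\<tau> * real n) ^ Suc s + 2 * K * real n ^ s) + (g (a v) - g (degree G v)))"
    proof (rule sum_mono)
      fix v assume v: "v \<in> U"
      have "(real (a v) - real (degree G v)) * (\<tau> * real n) ^ s \<le>
        (\<tau> * real n) ^ Suc s + (real (a v) ^ Suc s - real (degree G v) ^ Suc s)"
        using da[OF v] \<tau> by (intro deficit_le) auto
      moreover have "\<bar>g (a v) - real (a v) ^ Suc s\<bar> \<le> K * real n ^ s"
        using K(2) n(1) an by blast
      moreover have "\<bar>g (degree G v) - real (degree G v) ^ Suc s\<bar> \<le> K * real n ^ s"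
        using da[OF v] an[of v] by (intro K(2)[OF n(1)]) linarith
      ultimately show "(real (a v) - real (degree G v)) * (\<tau> * real n) ^ s \<le>
        ((\<tau> * real n) ^ Suc s + 2 * K * real n ^ s) + (g (a v) - g (degree G v))" by linarith
    qed
    also have "\<dots> = real (card U) * ((\<tau> * real n) ^ Suc s + 2 * K * real n ^ s) + (\<Sum>v\<in>U. g (a v) - g (degree G v))"
      by (simp add: sum.distrib)
    also have "\<dots> \<le> real n * ((\<tau> * real n) ^ Suc s + 2 * K * real n ^ s) + \<tau> ^ Suc s * real n ^ Suc (Suc s)"
      using gsum K(1) \<tau> U finV card_mono[of V U] by (intro add_mono mult_right_mono) (auto simp: n_def)
    also have "\<dots> \<le> real n * ((\<tau> * real n) ^ Suc s + (\<tau> ^ Suc s * real n) * real n ^ s) + \<tau> ^ Suc s * real n ^ Suc (Suc s)"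
      using nK by (intro add_mono mult_left_mono mult_right_mono order_refl) auto
    also have "\<dots> = (3 * \<tau> * real n ^ 2) * (\<tau> * real n) ^ s"
      by (simp add: algebra_simps power2_eq_square power_mult_distrib)
    finally have "D * (\<tau> * real n) ^ s \<le> (3 * \<tau> * real n ^ 2) * (\<tau> * real n) ^ s" .
    moreover have "(\<tau> * real n) ^ s > 0" using \<tau> n(1) by simp
    ultimately have D: "D \<le> 3 * \<tau> * real n ^ 2" by simp
    have "real (\<Sum>v\<in>U. card (non_neighbours G U c v)) \<le> real (2 * (\<Sum>v\<in>U. a v - degree G v))"
      using miss unfolding nbsV a_def n_def by (rule of_nat_mono)
    also have "\<dots> = 2 * (\<Sum>v\<in>U. real (a v - degree G v))" by simp
    also have "(\<Sum>v\<in>U. real (a v - degree G v)) = D"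
      unfolding D_def using da by (intro sum.cong of_nat_diff) auto
    also have "2 * D \<le> \<eta> * real n ^ 2" using D by (simp add: \<tau>_def)
    finally have miss': "real (\<Sum>v\<in>U. card (non_neighbours G U c v)) \<le> \<eta> * real n ^ 2" .
    have "\<rho> * real n \<le> \<eta> * real n" using \<rho>(2) by (intro mult_right_mono) auto
    with cR have "real (card (V - U)) \<le> \<eta> * real n" by (simp add: R_def)
    then show "\<exists>U c. U \<subseteq> verts G \<and> c ` U \<subseteq> {..<k} \<and> real (card (verts G - U)) \<le> \<eta> * card (verts G) \<and>
      (\<forall>v\<in>U. degree G v + card (colour_class U c (c v)) \<le> card (verts G)) \<and>
      real (\<Sum>v\<in>U. card (non_neighbours G U c v)) \<le> \<eta> * real (card (verts G)) ^ 2"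
      using U d_le miss' unfolding n_def V_def by (intro exI[of _ U] exI[of _ c] conjI ballI)
  qed
qed

text \<open>If one class were very small, moving a linear number of vertices from the largest class
  into it would raise each of their degrees linearly. This gain of order n^(s+2) has a constant
  independent of \<kappa>, whereas what is lost is proportional to \<kappa>.\<close>

lemma classes_linear:
  "\<exists>\<kappa>>(0::real). \<exists>N. \<forall>G U c. opt G \<longrightarrow> card (verts G) \<ge> N \<longrightarrow> U \<subseteq> verts G \<longrightarrow> c ` U \<subseteq> {..<k} \<longrightarrow>
      real (card (verts G - U)) \<le> \<kappa> * card (verts G) \<longrightarrow>
      (\<forall>v\<in>U. degree G v + card (colour_class U c (c v)) \<le> card (verts G)) \<longrightarrow>
      (\<forall>i<k. \<kappa> * card (verts G) \<le> real (card (colour_class U c i)))"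
proof -
  obtain K where K: "K \<ge> 0" "\<And>n d. 1 \<le> n \<Longrightarrow> d \<le> n \<Longrightarrow> \<bar>g d - real d ^ Suc s\<bar> \<le> K * real n ^ s"
    using g_approx_power by auto
  have k0: "real k > 0" using k_ge_2 by simp
  define \<beta> where "\<beta> = 1 / (8 * real k)"
  define \<theta> where "\<theta> = (1 / (4 * real k)) ^ Suc s / 2"
  \<comment> \<open>About \<open>\<beta> * n\<close> vertices move and each gains
    \<open>\<theta> * n ^ Suc s\<close>, where \<theta> is half of the power gain, the other half
    covering the approximation of \<open>g\<close>. The loss is at most
    \<open>2 * \<kappa> * L * n ^ (s + 2)\<close>, which the second term of the minimum makes
    smaller.\<close>
  define \<kappa> where "\<kappa> = min (1 / (16 * real k)) (\<beta> * \<theta> / (8 * L))"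
  have pos: "\<beta> > 0" "\<theta> > 0" "\<kappa> > 0" using k0 L_pos by (auto simp: \<beta>_def \<theta>_def \<kappa>_def)
  have \<kappa>: "\<kappa> \<le> 1 / (16 * real k)" "8 * \<kappa> * L \<le> \<beta> * \<theta>"
  proof -
    show "\<kappa> \<le> 1 / (16 * real k)" by (simp add: \<kappa>_def)
    have "\<kappa> \<le> \<beta> * \<theta> / (8 * L)" by (simp add: \<kappa>_def)
    then show "8 * \<kappa> * L \<le> \<beta> * \<theta>" using L_pos by (simp add: field_simps)
  qed
  define N where "N = 2 * b * k + 1 + nat \<lceil>2 / \<beta>\<rceil> + nat \<lceil>2 * K / \<theta>\<rceil>"
  show ?thesis
  proof (rule exI[of _ \<kappa>], intro conjI exI[of _ N] allI impI, rule pos(3), rule ccontr)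
    fix G U c i0
    assume G: "opt G" and N: "N \<le> card (verts G)" and U: "U \<subseteq> verts G" "c ` U \<subseteq> {..<k}"
      and cR: "real (card (verts G - U)) \<le> \<kappa> * card (verts G)"
      and deg: "\<forall>v\<in>U. degree G v + card (colour_class U c (c v)) \<le> card (verts G)"
      and i0: "i0 < k" and "\<not> \<kappa> * card (verts G) \<le> real (card (colour_class U c i0))"
    define V where "V = verts G"
    define n where "n = card V"
    define R where "R = V - U"
    define u where "u i = card (colour_class U c i)" for i
    define a where "a v = n - u (c v)" for v
    have uG: "ugraph G" and finV: "finite V" using G opt_ugraph opt_finite by (auto simp: V_def)
    have finU: "finite U" using U finV finite_subset V_def by blast
    have fin: "finite R" using finV by (simp add: R_def)
    have ui0: "real (u i0) < \<kappa> * real n" using \<open>\<not> \<kappa> * card (verts G) \<le> real (card (colour_class U c i0))\<close> by (simp add: u_def n_def V_def)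
    have cR': "real (card R) \<le> \<kappa> * real n" using cR by (simp add: R_def n_def V_def)
    have n: "n \<ge> 1" "n \<ge> 2 * b * k" using N by (auto simp: N_def n_def V_def)
    have n\<beta>: "2 \<le> \<beta> * real n"
    proof -
      have "real n \<ge> 2 / \<beta>" using N unfolding N_def n_def V_def by linarith
      then show ?thesis using pos by (simp add: field_simps)
    qed
    have nK: "2 * K \<le> \<theta> * real n"
    proof -
      have "real n \<ge> 2 * K / \<theta>" using N unfolding N_def n_def V_def by linarith
      then show ?thesis using pos by (simp add: field_simps)
    qed
    have "{..<k} \<noteq> {}" using i0 by auto
    then obtain j where j: "j < k" "\<And>i. i < k \<Longrightarrow> u i \<le> u j"
      using obtain_maximizer[of "{..<k}" u] by auto
    have "real n / (2 * real k) \<le> real (u j)"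
    proof -
      have "card U = (\<Sum>i<k. u i)" unfolding u_def by (rule card_eq_sum_colour_class[OF finU U(2)])
      also have "\<dots> \<le> (\<Sum>i<k. u j)" using j(2) by (intro sum_mono) auto
      finally have "real (card U) \<le> real k * real (u j)" by (simp flip: of_nat_mult)
      moreover have "real n = real (card U) + real (card R)"
        using U(1) finV finU card_mono[of V U] by (simp add: R_def n_def V_def card_Diff_subset)
      moreover have "\<kappa> * real n \<le> real n / 2"
      proof -
        have "1 / (16 * real k) \<le> 1 / 2" using k_ge_2 by (simp add: field_simps)
        then have "\<kappa> \<le> 1 / 2" using \<kappa>(1) by linarith
        then have "\<kappa> * real n \<le> 1 / 2 * real n" by (rule mult_right_mono) simp
        then show ?thesis by simp
      qed
      ultimately have "real n / 2 \<le> real k * real (u j)" using cR' by linarith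
      then show ?thesis using k0 by (simp add: field_simps)
    qed
    note uj = this
    have \<kappa>n: "\<kappa> * real n \<le> real n / (16 * real k)"
    proof -
      have "\<kappa> * real n \<le> 1 / (16 * real k) * real n" using \<kappa>(1) by (intro mult_right_mono) auto
      then show ?thesis by simp
    qed
    have \<beta>n: "\<beta> * real n = real n / (8 * real k)" by (simp add: \<beta>_def)
    \<comment> \<open>A unit of size: the largest class has at least 8 units, at most 2 are moved,
      and the small class and the uncoloured rest have at most 1 each. Moved vertices thus gain at
      least 4 units of degree.\<close>
    define q where "q = real n / (16 * real k)"
    have q: "q > 0" "real n / (2 * real k) = 8 * q" "real n / (8 * real k) = 2 * q" "real n / (4 * real k) = 4 * q"
      using n(1) k0 by (auto simp: q_def field_simps)
    define y where "y = nat \<lfloor>\<beta> * real n\<rfloor>"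
    have y: "real y \<le> \<beta> * real n" "\<beta> * real n \<le> 2 * real y"
    proof -
      have "real y = of_int \<lfloor>\<beta> * real n\<rfloor>" unfolding y_def using n\<beta> by simp
      then show "real y \<le> \<beta> * real n" "\<beta> * real n \<le> 2 * real y" using n\<beta> by linarith+
    qed
    have "i0 \<noteq> j"
    proof
      assume "i0 = j"
      then show False using ui0 uj \<kappa>n q unfolding q_def[symmetric] by auto
    qed
    have "real y \<le> real (u j)" using y(1) \<beta>n uj q by linarith
    then obtain Y where Y: "Y \<subseteq> colour_class U c j" "card Y = y"
      unfolding u_def by (metis obtain_subset_with_card_n of_nat_le_iff)
    have cY: "c v = j" if "v \<in> Y" for v using Y(1) that by (auto simp: colour_class_def)
    have YU: "Y \<subseteq> U" using Y(1) by (auto simp: colour_class_def)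
    have finY: "finite Y" by (rule finite_subset[OF YU finU])
    \<comment> \<open>Besides \<open>Y\<close>, the uncoloured vertices also go to the small class,
      so that no other class grows.\<close>
    define c'' where "c'' v = (if v \<in> U - Y then c v else i0)" for v
    have c'': "c'' ` V \<subseteq> {..<k}" using U(2) i0 by (auto simp: c''_def)
    define S where "S = U - Y - colour_class U c i0"
    define A where "A = n - card (colour_class V c'' i0)"
    define Bb where "Bb = n - u j"
    have An: "A \<le> n" "Bb \<le> n" by (auto simp: A_def Bb_def)
    have "colour_class V c'' i0 \<subseteq> colour_class U c i0 \<union> Y \<union> R" by (auto simp: colour_class_def c''_def R_def split: if_splits)
    then have "card (colour_class V c'' i0) \<le> card (colour_class U c i0 \<union> Y \<union> R)"
      using finU finY fin by (intro card_mono) (auto simp: finite_colour_class)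
    also have "\<dots> \<le> u i0 + y + card R"
      using card_Un_le[of "colour_class U c i0 \<union> Y" R] card_Un_le[of "colour_class U c i0" Y] Y(2) by (simp add: u_def)
    finally have "real (card (colour_class V c'' i0)) \<le> real (u i0) + real y + real (card R)" by linarith
    then have A_ge: "real A \<ge> real n - (real (u i0) + real y + real (card R))" unfolding A_def by linarith
    have uj_n: "u j \<le> n" unfolding u_def n_def using finV U(1) colour_class_subset[of U c j]
      by (intro card_mono) (auto simp: V_def)
    then have Bb_eq: "real Bb = real n - real (u j)" by (simp add: Bb_def)
    have diff: "real n / (4 * real k) \<le> real A - real Bb"
    proof -
      have "real (u i0) + real y + real (card R) \<le> q + 2 * q + q"
        using ui0 cR' \<kappa>n \<beta>n y(1) q unfolding q_def[symmetric] by linarith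
      then show ?thesis using A_ge Bb_eq uj q by linarith
    qed
    have gain: "\<theta> * real n ^ Suc s \<le> g A - g Bb"
    proof -
      have "real Bb \<le> real A" using diff q by linarith
      then have "(real A - real Bb) ^ Suc s \<le> real A ^ Suc s - real Bb ^ Suc s"
        by (intro power_diff_ge_diff_power) auto
      moreover have "(real n / (4 * real k)) ^ Suc s \<le> (real A - real Bb) ^ Suc s"
        using diff q by (intro power_mono) auto
      moreover have "(real n / (4 * real k)) ^ Suc s = 2 * \<theta> * real n ^ Suc s"
        by (simp add: \<theta>_def power_divide power_mult_distrib)
      moreover have "\<bar>g A - real A ^ Suc s\<bar> \<le> K * real n ^ s" "\<bar>g Bb - real Bb ^ Suc s\<bar> \<le> K * real n ^ s"
        using K(2)[OF n(1)] An by blast+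
      moreover have "2 * K * real n ^ s \<le> \<theta> * real n * real n ^ s"
        using nK by (intro mult_right_mono) auto
      ultimately show ?thesis by (simp add: algebra_simps)
    qed
    have SY: "S \<inter> Y = {}" by (auto simp: S_def)
    have "(\<Sum>v\<in>S. g (a v)) + (\<Sum>v\<in>Y. g A) \<le> (\<Sum>v\<in>S. g (n - card (colour_class V c'' (c'' v)))) + (\<Sum>v\<in>Y. g (n - card (colour_class V c'' (c'' v))))"
    proof (intro add_mono sum_mono)
      fix v assume v: "v \<in> S"
      then have cv: "c'' v = c v" "c v \<noteq> i0" by (auto simp: S_def c''_def colour_class_def)
      then have "colour_class V c'' (c'' v) \<subseteq> colour_class U c (c v)" by (auto simp: colour_class_def c''_def split: if_splits)
      then have "card (colour_class V c'' (c'' v)) \<le> u (c v)" unfolding u_def using finU by (intro card_mono) (auto simp: finite_colour_class)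
      then show "g (a v) \<le> g (n - card (colour_class V c'' (c'' v)))"
        unfolding a_def by (intro monoD[OF g_mono]) simp
    next
      fix v assume "v \<in> Y"
      then have "c'' v = i0" by (simp add: c''_def)
      then show "g A \<le> g (n - card (colour_class V c'' (c'' v)))" by (simp add: A_def)
    qed
    also have "\<dots> = (\<Sum>v\<in>S \<union> Y. g (n - card (colour_class V c'' (c'' v))))"
      using finU finY SY by (subst sum.union_disjoint) (auto simp: S_def)
    also have "\<dots> \<le> (\<Sum>v\<in>V. g (n - card (colour_class V c'' (c'' v))))"
      using finV U(1) YU g_nonneg by (intro sum_mono2) (auto simp: S_def V_def)
    also have "\<dots> \<le> degree_sum g G"
      using opt_ge_cross_edges[OF G _ c''[unfolded V_def]] n(2) by (simp add: n_def V_def)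
    finally have lower: "(\<Sum>v\<in>S. g (a v)) + real y * g A \<le> degree_sum g G" using Y(2) by simp
    \<comment> \<open>Vertices of the small class may lose degree; together with the uncoloured ones
      they are few enough for the trivial bound on \<open>g\<close>.\<close>
    define Z where "Z = colour_class U c i0 - Y"
    have Ud: "V = S \<union> Y \<union> (Z \<union> R)" using U(1) YU by (auto simp: S_def Z_def R_def V_def colour_class_def)
    have Zfin: "finite Z" "finite S" using finU by (auto simp: Z_def S_def finite_colour_class)
    have disj: "(S \<union> Y) \<inter> (Z \<union> R) = {}" using YU by (auto simp: S_def Z_def R_def)
    have ZR: "card (Z \<union> R) \<le> u i0 + card R"
      using card_Un_le[of Z R] card_mono[OF finite_colour_class[OF finU, of c i0], of Z] by (simp add: u_def Z_def)
    have "degree_sum g G = (\<Sum>v\<in>S. g (degree G v)) + (\<Sum>v\<in>Y. g (degree G v)) + (\<Sum>v\<in>Z \<union> R. g (degree G v))"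
      unfolding degree_sum_def V_def[symmetric] using Zfin fin finY disj SY
      by (subst Ud) (simp add: sum.union_disjoint)
    also have "\<dots> \<le> (\<Sum>v\<in>S. g (a v)) + (\<Sum>v\<in>Y. g Bb) + (\<Sum>v\<in>Z \<union> R. L * real n ^ Suc s)"
    proof (intro add_mono sum_mono)
      fix v assume "v \<in> S"
      then have "degree G v + u (c v) \<le> n" using deg by (simp add: S_def u_def n_def V_def)
      then show "g (degree G v) \<le> g (a v)" unfolding a_def by (intro monoD[OF g_mono]) simp
    next
      fix v assume v: "v \<in> Y"
      then have "degree G v + u (c v) \<le> n" using deg YU by (auto simp: u_def n_def V_def)
      then show "g (degree G v) \<le> g Bb" unfolding Bb_def cY[OF v] by (intro monoD[OF g_mono]) simp
    next
      fix v show "g (degree G v) \<le> L * real n ^ Suc s"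
        using degree_le[OF uG, of v] n(1) by (intro g_le) (auto simp: n_def V_def)
    qed
    also have "\<dots> = (\<Sum>v\<in>S. g (a v)) + real y * g Bb + real (card (Z \<union> R)) * (L * real n ^ Suc s)"
      using Y(2) by simp
    finally have "real y * (g A - g Bb) \<le> real (card (Z \<union> R)) * (L * real n ^ Suc s)"
      using lower by (simp add: algebra_simps)
    moreover have "real (card (Z \<union> R)) * (L * real n ^ Suc s) \<le> (2 * \<kappa> * real n) * (L * real n ^ Suc s)"
    proof -
      have "real (card (Z \<union> R)) \<le> 2 * \<kappa> * real n" using ZR ui0 cR' by linarith
      then show ?thesis using L_pos by (intro mult_right_mono) auto
    qed
    moreover have "real y * (\<theta> * real n ^ Suc s) \<le> real y * (g A - g Bb)"
      using gain by (intro mult_left_mono) auto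
    moreover have "\<beta> * real n / 2 * (\<theta> * real n ^ Suc s) \<le> real y * (\<theta> * real n ^ Suc s)"
      using y(2) pos by (intro mult_right_mono) auto
    ultimately have "\<beta> * real n / 2 * (\<theta> * real n ^ Suc s) \<le> (2 * \<kappa> * real n) * (L * real n ^ Suc s)" by linarith
    then have "(\<beta> * \<theta> / 2) * real n ^ Suc (Suc s) \<le> (2 * \<kappa> * L) * real n ^ Suc (Suc s)"
      by (simp add: algebra_simps)
    moreover have "real n ^ Suc (Suc s) > 0" using n(1) by simp
    ultimately have "\<beta> * \<theta> / 2 \<le> 2 * \<kappa> * L" by (simp only: mult_le_cancel_right_pos)
    then show False using \<kappa>(2) mult_pos_pos[OF pos(1,2)] by linarith
  qed
qed

end

section \<open>Choosing a class for every vertex\<close>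

context excess_bounded
begin

text \<open>A vertex with many neighbours in every class would be adjacent to all of some balanced
  complete \<open>k\<close>-partite set. Exchanging it for a vertex \<open>w\<close> of class 0
  keeps the set balanced and creates \<open>m - 1 > b\<close> edges inside that class.\<close>

lemma few_common_class:
  assumes "\<eta> > (0::real)"
  shows "\<exists>\<epsilon>>(0::real). \<exists>N. \<forall>G U c v. ugraph G \<longrightarrow> Free G \<longrightarrow> card (verts G) \<ge> N \<longrightarrow> v \<in> verts G \<longrightarrow>
    U \<subseteq> verts G \<longrightarrow> c ` U \<subseteq> {..<k} \<longrightarrow> (\<forall>u\<in>U. real (card (non_neighbours G U c u)) \<le> \<epsilon> * card (verts G)) \<longrightarrow>
    (\<exists>i<k. real (card (neighbours G v \<inter> colour_class U c i)) < \<eta> * card (verts G))"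
proof -
  define m where "m = max m0 (b + 2)"
  have m: "m \<ge> m0" "m \<ge> b + 2" by (auto simp: m_def)
  have km: "real (k * m) > 0" using k_ge_2 m by simp
  define \<epsilon> where "\<epsilon> = \<eta> / (2 * real (k * m))"
  have \<epsilon>: "\<epsilon> > 0" "real (k * m) * \<epsilon> = \<eta> / 2" using assms km k_ge_2 m(2) by (auto simp: \<epsilon>_def)
  define N where "N = nat \<lceil>2 * (real (k * m) + real m) / \<eta>\<rceil>"
  show ?thesis
  proof (rule exI[of _ \<epsilon>], rule conjI, rule \<epsilon>(1), rule exI[of _ N], intro allI impI, rule ccontr)
    fix G U c v
    assume G: "ugraph G" "Free G" and N: "N \<le> card (verts G)" and v: "v \<in> verts G"
      and U: "U \<subseteq> verts G" "c ` U \<subseteq> {..<k}"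
      and few: "\<forall>u\<in>U. real (card (non_neighbours G U c u)) \<le> \<epsilon> * card (verts G)"
      and contr: "\<not> (\<exists>i<k. real (card (neighbours G v \<inter> colour_class U c i)) < \<eta> * card (verts G))"
    define n where "n = card (verts G)"
    define U' where "U' = neighbours G v \<inter> U"
    define z where "z = nat \<lfloor>\<epsilon> * real n\<rfloor>"
    have z: "real z \<le> \<epsilon> * real n" using \<epsilon> by (simp add: z_def)
    have finU: "finite U" using finite_subset[OF U(1) ugraph_finite[OF G(1)]] .
    then have fin: "finite U'" by (simp add: U'_def)
    have few': "card (non_neighbours G U' c u) \<le> z" if "u \<in> {} \<union> U'" for u
    proof -
      have "card (non_neighbours G U' c u) \<le> card (non_neighbours G U c u)"
        using finU by (intro card_mono) (auto simp: non_neighbours_def U'_def)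
      moreover have "real (card (non_neighbours G U c u)) \<le> \<epsilon> * real n" using few that by (simp add: U'_def n_def)
      ultimately show ?thesis unfolding z_def by linarith
    qed
    have large: "k * m * (z + 1) + m \<le> card (colour_class U' c i)" if "i < k" for i
    proof -
      have "real n \<ge> 2 * (real (k * m) + real m) / \<eta>" using N unfolding N_def n_def by linarith
      then have n: "2 * (real (k * m) + real m) \<le> \<eta> * real n" using assms by (simp add: field_simps)
      have "real (k * m * (z + 1) + m) = real (k * m) * real z + (real (k * m) + real m)"
        by (simp add: algebra_simps)
      also have "\<dots> \<le> real (k * m) * (\<epsilon> * real n) + (real (k * m) + real m)"
        using z by (intro add_mono mult_left_mono order_refl) auto
      also have "\<dots> = \<eta> / 2 * real n + (real (k * m) + real m)" using \<epsilon>(2) by (simp only: mult.assoc[symmetric])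
      also have "\<dots> \<le> \<eta> * real n" using n by (simp add: field_simps)
      also have "\<dots> \<le> real (card (neighbours G v \<inter> colour_class U c i))" using contr that by (force simp: n_def)
      also have "neighbours G v \<inter> colour_class U c i = colour_class U' c i" by (auto simp: colour_class_def U'_def)
      finally show ?thesis by linarith
    qed
    have "\<exists>B. {} \<subseteq> B \<and> B \<subseteq> {} \<union> U' \<and> c ` B \<subseteq> {..<k} \<and> (\<forall>i<k. card (colour_class B c i) = m) \<and>
      (\<forall>u\<in>B. \<forall>w\<in>B. c u \<noteq> c w \<longrightarrow> u \<in> {} \<and> w \<in> {} \<or> w \<in> neighbours G u)"
      by (rule extend_balanced[OF G(1) fin, of "{}" c k m z]) (use few' large in \<open>auto simp: colour_class_def\<close>)
    then obtain B where B: "B \<subseteq> U'" "c ` B \<subseteq> {..<k}" "\<forall>i<k. card (colour_class B c i) = m"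
      "\<forall>u\<in>B. \<forall>w\<in>B. c u \<noteq> c w \<longrightarrow> w \<in> neighbours G u" by auto
    have finB: "finite B" using finite_subset[OF B(1) fin] .
    have vB: "v \<notin> B" using B(1) not_self_neighbours[OF G(1), of v] by (auto simp: U'_def)
    have c0: "card (colour_class B c 0) = m" using B(3) k_ge_2 by simp
    then have "colour_class B c 0 \<noteq> {}" using m(2) by auto
    then obtain w where w: "w \<in> colour_class B c 0" by blast
    define B' where "B' = insert v (B - {w})"
    \<comment> \<open>The vertex \<open>v\<close> may have any colour under \<open>c\<close>, so it
      is recoloured to take the place of \<open>w\<close>.\<close>
    define c' where "c' = c(v := 0)"
    have cl0: "colour_class B' c' 0 = insert v (colour_class B c 0 - {w})" using vB by (auto simp: colour_class_def B'_def c'_def)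
    have cli: "colour_class B' c' i = colour_class B c i" if "i \<noteq> 0" for i using that vB w by (auto simp: colour_class_def B'_def c'_def)
    define J where "J = (\<lambda>u. {v, u}) ` (colour_class B c 0 - {w})"
    have "card J = m - 1"
      unfolding J_def using c0 w finB
      by (subst card_image) (auto simp: inj_on_def doubleton_eq_iff card_Diff_singleton_if)
    moreover have "card J \<le> b"
    proof (rule extra_edges_le[OF G, of B' c' m])
      show "B' \<subseteq> verts G" using B(1) U v by (auto simp: B'_def U'_def)
      show "c' ` B' \<subseteq> {..<k}" using B(2) k_ge_2 by (auto simp: B'_def c'_def)
      show "m0 \<le> m" by (rule m)
      show "card (colour_class B' c' i) = m" if "i < k" for i
      proof (cases "i = 0")
        case True
        have "v \<notin> colour_class B c 0 - {w}" using vB by (auto simp: colour_class_def)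
        then have "card (colour_class B' c' 0) = Suc (card (colour_class B c 0 - {w}))" using finB cl0 by (simp add: finite_colour_class)
        also have "\<dots> = m" using w c0 m(2) by (simp add: card_Diff_singleton)
        finally show ?thesis using True by simp
      next
        case False
        then show ?thesis using cli B(3) that by simp
      qed
      show "cross_edges B' c' \<subseteq> edges G"
      proof
        fix e assume "e \<in> cross_edges B' c'"
        then obtain x y where xy: "e = {x, y}" "x \<in> B'" "y \<in> B'" "c' x \<noteq> c' y" by (rule cross_edges_cases)
        have nb: "{v, x} \<in> edges G" if "x \<in> B" for x using B(1) that by (auto simp: U'_def mem_neighbours)
        show "e \<in> edges G"
        proof (cases "x = v \<or> y = v")
          case True
          then show ?thesis using xy nb[of x] nb[of y] by (auto simp: B'_def insert_commute)
        next
          case False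
          then have "y \<in> neighbours G x" using xy B(4) by (auto simp: B'_def c'_def)
          then show ?thesis using xy(1) by (simp add: mem_neighbours)
        qed
      qed
      show "J \<subseteq> edges G" using B(1) unfolding J_def by (auto simp: U'_def mem_neighbours colour_class_def)
      show "\<forall>e\<in>J. e \<subseteq> B'" unfolding J_def B'_def by (auto simp: colour_class_def)
      show "J \<inter> cross_edges B' c' = {}"
      proof -
        have "{v, u} \<notin> cross_edges B' c'" if "u \<in> colour_class B c 0 - {w}" for u
          using that unfolding cross_edges_iff by (simp add: c'_def colour_class_def)
        then show ?thesis unfolding J_def by auto
      qed
    qed
    ultimately show False using m(2) by simp
  qed
qed

end

context extremal_setting
begin

text \<open>Averaging over the missing pairs: vertices with many non-neighbours are few and can be
  discarded. The constant \<kappa> is fixed before \<epsilon>, since later \<epsilon> has to be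
  small compared with it.\<close>

lemma typical_structure:
  "\<exists>\<kappa>>(0::real). \<forall>\<epsilon>>(0::real). \<exists>N. \<forall>G. opt G \<and> card (verts G) \<ge> N \<longrightarrow>
    (\<exists>U c. U \<subseteq> verts G \<and> c ` U \<subseteq> {..<k} \<and> real (card (verts G - U)) \<le> \<epsilon> * card (verts G) \<and>
      (\<forall>i<k. \<kappa> * card (verts G) \<le> real (card (colour_class U c i))) \<and>
      (\<forall>v\<in>U. real (card (non_neighbours G U c v)) \<le> \<epsilon> * card (verts G)))"
proof -
  from classes_linear obtain \<kappa> N1 where \<kappa>: "\<kappa> > (0::real)" and
    N1: "\<forall>G U c. opt G \<longrightarrow> card (verts G) \<ge> N1 \<longrightarrow> U \<subseteq> verts G \<longrightarrow> c ` U \<subseteq> {..<k} \<longrightarrow>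
      real (card (verts G - U)) \<le> \<kappa> * card (verts G) \<longrightarrow>
      (\<forall>v\<in>U. degree G v + card (colour_class U c (c v)) \<le> card (verts G)) \<longrightarrow>
      (\<forall>i<k. \<kappa> * card (verts G) \<le> real (card (colour_class U c i)))"
    by (elim exE conjE)
  show ?thesis
  proof (rule exI[of _ "\<kappa> / 2"], intro conjI allI impI)
    show "\<kappa> / 2 > 0" using \<kappa> by simp
    fix \<epsilon> :: real assume \<epsilon>: "\<epsilon> > 0"
    define \<epsilon>' where "\<epsilon>' = min \<epsilon> \<kappa>"
    \<comment> \<open>Each discarded vertex accounts for \<open>\<epsilon> * n\<close> missing
      pairs, so the product term leaves at most \<open>\<epsilon>' / 2 * n\<close> of them; the
      other terms serve \<open>classes_linear\<close> and the vertices uncoloured before.\<close>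
    define \<eta> where "\<eta> = min \<kappa> (min (\<epsilon>' / 2) (\<epsilon> * \<epsilon>' / 2))"
    have pos: "\<epsilon>' > 0" "\<eta> > 0" using \<epsilon> \<kappa> by (auto simp: \<epsilon>'_def \<eta>_def)
    have \<eta>: "\<eta> \<le> \<kappa>" "\<eta> \<le> \<epsilon>' / 2" "\<eta> \<le> \<epsilon> * \<epsilon>' / 2" by (auto simp: \<eta>_def)
    have \<epsilon>': "\<epsilon>' \<le> \<epsilon>" "\<epsilon>' \<le> \<kappa>" by (auto simp: \<epsilon>'_def)
    from approximate_structure[OF pos(2)] obtain N2 where N2: "\<forall>G. opt G \<and> card (verts G) \<ge> N2 \<longrightarrow>
      (\<exists>U c. U \<subseteq> verts G \<and> c ` U \<subseteq> {..<k} \<and> real (card (verts G - U)) \<le> \<eta> * card (verts G) \<and>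
      (\<forall>v\<in>U. degree G v + card (colour_class U c (c v)) \<le> card (verts G)) \<and>
      real (\<Sum>v\<in>U. card (non_neighbours G U c v)) \<le> \<eta> * real (card (verts G)) ^ 2)" ..
    show "\<exists>N. \<forall>G. opt G \<and> card (verts G) \<ge> N \<longrightarrow>
    (\<exists>U c. U \<subseteq> verts G \<and> c ` U \<subseteq> {..<k} \<and> real (card (verts G - U)) \<le> \<epsilon> * card (verts G) \<and>
      (\<forall>i<k. \<kappa> / 2 * card (verts G) \<le> real (card (colour_class U c i))) \<and>
      (\<forall>v\<in>U. real (card (non_neighbours G U c v)) \<le> \<epsilon> * card (verts G)))"
    proof (intro exI[of _ "N1 + N2 + 1"] allI impI, elim conjE)
      fix G assume G: "opt G" and N: "N1 + N2 + 1 \<le> card (verts G)"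
      define n where "n = real (card (verts G))"
      have n: "n > 0" using N by (simp add: n_def)
      have "\<exists>U c. U \<subseteq> verts G \<and> c ` U \<subseteq> {..<k} \<and> real (card (verts G - U)) \<le> \<eta> * card (verts G) \<and>
      (\<forall>v\<in>U. degree G v + card (colour_class U c (c v)) \<le> card (verts G)) \<and>
      real (\<Sum>v\<in>U. card (non_neighbours G U c v)) \<le> \<eta> * real (card (verts G)) ^ 2"
        by (rule N2[rule_format]) (use G N in simp)
      then obtain U c where U: "U \<subseteq> verts G" "c ` U \<subseteq> {..<k}" and R: "real (card (verts G - U)) \<le> \<eta> * n"
        and deg: "\<forall>v\<in>U. degree G v + card (colour_class U c (c v)) \<le> card (verts G)"
        and miss: "real (\<Sum>v\<in>U. card (non_neighbours G U c v)) \<le> \<eta> * n ^ 2"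
        unfolding n_def by (elim exE conjE)
      have fin: "finite U" "finite (verts G)" using finite_subset[OF U(1) opt_finite[OF G]] opt_finite[OF G] by auto
      have "\<eta> * n \<le> \<kappa> * n" using \<eta>(1) n by simp
      then have "real (card (verts G - U)) \<le> \<kappa> * card (verts G)" using R by (simp add: n_def)
      then have colour_class: "\<forall>i<k. \<kappa> * card (verts G) \<le> real (card (colour_class U c i))"
        using N1 G N U deg by (elim allE[of _ G] allE[of _ U] allE[of _ c] impE) simp_all
      define Z where "Z = {v \<in> U. real (card (non_neighbours G U c v)) > \<epsilon> * n}"
      have finZ: "finite Z" using fin by (simp add: Z_def)
      have "real (card Z) * (\<epsilon> * n) = (\<Sum>v\<in>Z. \<epsilon> * n)" by simp
      also have "\<dots> \<le> (\<Sum>v\<in>Z. real (card (non_neighbours G U c v)))" by (rule sum_mono) (simp add: Z_def)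
      also have "\<dots> \<le> (\<Sum>v\<in>U. real (card (non_neighbours G U c v)))"
        using fin by (intro sum_mono2) (auto simp: Z_def)
      also have "\<dots> \<le> \<eta> * n ^ 2" using miss by simp
      also have "\<dots> \<le> (\<epsilon> * \<epsilon>' / 2) * n ^ 2" using \<eta>(3) by (intro mult_right_mono) auto
      also have "\<dots> = (\<epsilon>' / 2 * n) * (\<epsilon> * n)" by (simp add: power2_eq_square)
      finally have cZ: "real (card Z) \<le> \<epsilon>' / 2 * n" using \<epsilon> n by simp
      define U' where "U' = U - Z"
      show "\<exists>U c. U \<subseteq> verts G \<and> c ` U \<subseteq> {..<k} \<and> real (card (verts G - U)) \<le> \<epsilon> * card (verts G) \<and>
        (\<forall>i<k. \<kappa> / 2 * card (verts G) \<le> real (card (colour_class U c i))) \<and>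
        (\<forall>v\<in>U. real (card (non_neighbours G U c v)) \<le> \<epsilon> * card (verts G))"
      proof (intro exI[of _ U'] exI[of _ c] conjI allI impI ballI)
        show "U' \<subseteq> verts G" "c ` U' \<subseteq> {..<k}" using U by (auto simp: U'_def)
        have "card (verts G - U') \<le> card ((verts G - U) \<union> Z)"
          using fin finZ by (intro card_mono) (auto simp: U'_def)
        also have "\<dots> \<le> card (verts G - U) + card Z" by (rule card_Un_le)
        finally have "real (card (verts G - U')) \<le> \<eta> * n + \<epsilon>' / 2 * n" using R cZ by linarith
        also have "\<dots> \<le> \<epsilon>' / 2 * n + \<epsilon>' / 2 * n"
          using \<eta>(2) n by (intro add_right_mono mult_right_mono) auto
        also have "\<dots> \<le> \<epsilon> * n" using \<epsilon>'(1) n by simp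
        finally show "real (card (verts G - U')) \<le> \<epsilon> * card (verts G)" by (simp add: n_def)
      next
        fix i assume i: "i < k"
        have "card (colour_class U c i) \<le> card (colour_class U' c i \<union> Z)"
          using fin finZ by (intro card_mono) (auto simp: U'_def colour_class_def)
        also have "\<dots> \<le> card (colour_class U' c i) + card Z" by (rule card_Un_le)
        finally have "real (card (colour_class U c i)) \<le> real (card (colour_class U' c i)) + real (card Z)" by linarith
        moreover have "\<kappa> * n \<le> real (card (colour_class U c i))" using colour_class i by (simp add: n_def)
        moreover have "\<epsilon>' / 2 * n \<le> \<kappa> / 2 * n" using \<epsilon>'(2) n by simp
        ultimately have "\<kappa> / 2 * n \<le> real (card (colour_class U' c i))" using cZ by linarith
        then show "\<kappa> / 2 * card (verts G) \<le> real (card (colour_class U' c i))" by (simp add: n_def)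
      next
        fix v assume v: "v \<in> U'"
        have "card (non_neighbours G U' c v) \<le> card (non_neighbours G U c v)"
          using fin by (intro card_mono) (auto simp: U'_def non_neighbours_def)
        moreover have "real (card (non_neighbours G U c v)) \<le> \<epsilon> * n" using v by (auto simp: U'_def Z_def)
        ultimately show "real (card (non_neighbours G U' c v)) \<le> \<epsilon> * card (verts G)" by (simp add: n_def)
      qed
    qed
  qed
qed

end

section \<open>Minimum degree conditions\<close>

context extremal_setting
begin

lemma opt_le:
  "opt G \<Longrightarrow> ugraph G' \<Longrightarrow> Free G' \<Longrightarrow> card (verts G') = card (verts G) \<Longrightarrow> degree_sum g G' \<le> degree_sum g G"
  unfolding opt_def by blast

text \<open>Replacing the neighbourhood of a vertex \<open>v\<close> by all typical vertices outside one class keeps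
  the graph free of \<open>F\<close>, so that optimality bounds the number of typical non-neighbours of \<open>v\<close>.\<close>

lemma replacement_bound:
  assumes G: "opt G" and n_def: "n = card (verts G)" and v: "v \<in> verts G"
    and N: "N \<subseteq> verts G - {v}"
    and common: "\<And>Q. Q \<subseteq> N \<Longrightarrow> card Q \<le> h \<Longrightarrow> h \<le> card {u \<in> verts G - {v}. Q \<subseteq> neighbours G u}"
    and gain: "\<And>u. u \<in> N \<Longrightarrow> u \<notin> neighbours G v \<Longrightarrow> \<mu> \<le> g (Suc (degree G u)) - g (degree G u)"
    and "0 \<le> \<mu>"
  shows "real (card (N - neighbours G v)) * \<mu> \<le> 2 * real (card (neighbours G v - N)) * (L * real n ^ s)"
proof -
  have uG: "ugraph G" and fin: "finite (verts G)" using G opt_ugraph opt_finite by auto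
  define G' where "G' = (verts G, {e \<in> edges G. v \<notin> e} \<union> {{v, u} |u. u \<in> N})"
  have V': "verts G' = verts G" by (simp add: G'_def)
  have edges': "edges G' = {e \<in> edges G. v \<notin> e} \<union> {{v, u} |u. u \<in> N}" by (simp add: G'_def)
  have uG': "ugraph G'"
    using uG v N fin unfolding ugraph_def V' edges' by (auto simp: card_insert_if)
  have "Free G'" unfolding G'_def by (rule replace_Free[OF uG opt_Free[OF G] v N common])
  then have le: "degree_sum g G' \<le> degree_sum g G" using opt_le[OF G uG'] V' by simp
  have n1: "n \<ge> 1" using v fin n_def by (metis One_nat_def Suc_leI card_gt_0_iff empty_iff)
  have nbs_v: "neighbours G' v = N"
    using N unfolding neighbours_def edges' by (auto simp: doubleton_eq_iff)
  have nbs_u: "neighbours G' u = (neighbours G u - {v}) \<union> (if u \<in> N then {v} else {})" if "u \<noteq> v" for u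
    using that N unfolding neighbours_def edges' by (auto simp: doubleton_eq_iff)
  define M where "M = N - neighbours G v"
  define P where "P = neighbours G v - N"
  have finMP: "finite M" "finite P" "finite N" "finite (neighbours G v)"
    using fin N finite_neighbours[OF uG, of v] finite_subset[OF N] by (auto simp: M_def P_def)
  have deg': "degree G' u = card (neighbours G' u)" and deg: "degree G u = card (neighbours G u)" for u
    by (rule degree_eq_card_neighbours[OF uG'], rule degree_eq_card_neighbours[OF uG])
  have degn: "degree G u \<le> n" for u using degree_le[OF uG] n_def by simp
  have other: "g (degree G u) + (if u \<in> M then \<mu> else 0) - (if u \<in> P then L * real n ^ s else 0) \<le> g (degree G' u)"
    if u: "u \<in> verts G - {v}" for u
  proof -
    consider "u \<in> M" | "u \<in> P" | "u \<notin> M" "u \<notin> P" by blast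
    then show ?thesis
    proof cases
      case 1
      then have "v \<notin> neighbours G u" "u \<in> N" "u \<notin> P" using neighbours_sym[of u G v] by (auto simp: M_def P_def)
      then have "degree G' u = Suc (degree G u)"
      proof -
        have "neighbours G' u = insert v (neighbours G u)"
          using nbs_u[of u] u \<open>u \<in> N\<close> by (simp add: insert_absorb)
        then show ?thesis unfolding deg' deg using \<open>v \<notin> neighbours G u\<close> finite_neighbours[OF uG, of u] by simp
      qed
      then show ?thesis using gain[of u] 1 \<open>u \<notin> P\<close> by (simp add: M_def)
    next
      case 2
      then have vu: "v \<in> neighbours G u" "u \<notin> N" "u \<notin> M" using neighbours_sym[of u G v] by (auto simp: M_def P_def)
      then have "degree G u = Suc (degree G' u)"
      proof -
        have "neighbours G' u = neighbours G u - {v}" using nbs_u[of u] u vu(2) by simp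
        then show ?thesis unfolding deg' deg
          using card.remove[OF finite_neighbours[OF uG, of u] vu(1)] by simp
      qed
      then have "g (degree G u) - g (degree G' u) \<le> L * real n ^ s"
        using increment_le[OF n1, of "degree G' u"] degn[of u] by simp
      then show ?thesis using 2 vu by simp
    next
      case 3
      have "neighbours G' u = neighbours G u"
        using nbs_u[of u] u 3 neighbours_sym[of u G v] by (auto simp: M_def P_def)
      then show ?thesis using 3 by (simp add: deg' deg)
    qed
  qed
  have "card (neighbours G v) = card (neighbours G v \<inter> N) + card P"
    unfolding P_def using finMP card_Int_Diff by blast
  also have "card (neighbours G v \<inter> N) \<le> card N" using finMP by (intro card_mono) auto
  finally have dv: "degree G v \<le> degree G' v + card P" unfolding deg' deg nbs_v by simp
  \<comment> \<open>Each lost neighbour costs at most one step of \<open>g\<close> at its own end,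
    by \<open>other\<close>, and one at \<open>v\<close>; hence the factor 2 in the
    conclusion.\<close>
  have gv: "g (degree G v) - real (card P) * (L * real n ^ s) \<le> g (degree G' v)"
  proof (cases "degree G' v \<le> degree G v")
    case True
    have "g (degree G v) - g (degree G' v) \<le> (real (degree G v) - real (degree G' v)) * (L * real n ^ s)"
      using True degn by (intro g_diff_le n1) auto
    also have "\<dots> \<le> real (card P) * (L * real n ^ s)"
      using dv L_pos by (intro mult_right_mono) auto
    finally show ?thesis by linarith
  next
    case False
    then have "g (degree G v) \<le> g (degree G' v)" by (intro monoD[OF g_mono]) simp
    moreover have "0 \<le> real (card P) * (L * real n ^ s)" using L_pos by simp
    ultimately show ?thesis by linarith
  qed
  have MV: "(verts G - {v}) \<inter> {u. u \<in> M} = M" "(verts G - {v}) \<inter> {u. u \<in> P} = P"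
    using N neighbours_subset[OF uG, of v] not_self_neighbours[OF uG, of v] by (auto simp: M_def P_def)
  have "(\<Sum>u\<in>verts G - {v}. g (degree G u)) + real (card M) * \<mu> - real (card P) * (L * real n ^ s)
    = (\<Sum>u\<in>verts G - {v}. g (degree G u) + (if u \<in> M then \<mu> else 0) - (if u \<in> P then L * real n ^ s else 0))"
    using fin MV by (simp add: sum.distrib sum_subtractf sum.If_cases)
  also have "\<dots> \<le> (\<Sum>u\<in>verts G - {v}. g (degree G' u))" by (rule sum_mono[OF other])
  finally have "(\<Sum>u\<in>verts G - {v}. g (degree G u)) + real (card M) * \<mu> - real (card P) * (L * real n ^ s)
    \<le> (\<Sum>u\<in>verts G - {v}. g (degree G' u))" .
  moreover have "degree_sum g G = g (degree G v) + (\<Sum>u\<in>verts G - {v}. g (degree G u))"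
    "degree_sum g G' = g (degree G' v) + (\<Sum>u\<in>verts G - {v}. g (degree G' u))"
    unfolding degree_sum_def V' using fin v by (simp_all add: sum.remove)
  ultimately have "real (card M) * \<mu> \<le> 2 * (real (card P) * (L * real n ^ s))" using gv le by linarith
  then show ?thesis by (simp add: M_def P_def mult.assoc)
qed

text \<open>An exceptional vertex is placed in a class where it has few neighbours, which exists by
  \<open>few_common_class\<close>. Joining it instead to all typical vertices outside that class
  would give up few edges, so by optimality it already has nearly all of them.\<close>

lemma global_structure:
  "\<exists>\<kappa>>(0::real). \<forall>\<epsilon>>(0::real). \<exists>N. \<forall>G. opt G \<and> card (verts G) \<ge> N \<longrightarrow>
    (\<exists>c. c ` verts G \<subseteq> {..<k} \<and> (\<forall>i<k. \<kappa> * card (verts G) \<le> real (card (colour_class (verts G) c i))) \<and>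
      (\<forall>v\<in>verts G. real (card (non_neighbours G (verts G) c v)) \<le> \<epsilon> * card (verts G)))"
proof -
  from typical_structure obtain \<kappa> where \<kappa>: "\<kappa> > (0::real)" and
    typical: "\<forall>\<epsilon>>(0::real). \<exists>N. \<forall>G. opt G \<and> card (verts G) \<ge> N \<longrightarrow>
    (\<exists>U c. U \<subseteq> verts G \<and> c ` U \<subseteq> {..<k} \<and> real (card (verts G - U)) \<le> \<epsilon> * card (verts G) \<and>
      (\<forall>i<k. \<kappa> * card (verts G) \<le> real (card (colour_class U c i))) \<and>
      (\<forall>v\<in>U. real (card (non_neighbours G U c v)) \<le> \<epsilon> * card (verts G)))"
    by (elim exE conjE)
  define \<alpha> where "\<alpha> = \<kappa> / 2"
  have \<alpha>: "\<alpha> > 0" using \<kappa> by (simp add: \<alpha>_def)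
  define \<nu> where "\<nu> = \<alpha> ^ s / 2"
  have \<nu>: "\<nu> > 0" using \<alpha> by (simp add: \<nu>_def)
  from g_diff_ge[OF \<alpha>] obtain N1 where "N1 \<ge> 1" and N1: "\<forall>n a b. n \<ge> N1 \<longrightarrow> \<alpha> * real n \<le> real a \<longrightarrow> a \<le> b \<longrightarrow> b \<le> n \<longrightarrow>
    (real b - real a) * (\<nu> * real n ^ s) \<le> g b - g a"
    unfolding \<nu>_def by (elim exE conjE)
  show ?thesis
  proof (rule exI[of _ \<kappa>], intro conjI allI impI)
    show "\<kappa> > 0" by (rule \<kappa>)
    fix \<epsilon> :: real assume \<epsilon>: "\<epsilon> > 0"
    \<comment> \<open>A replacement gives up at most \<open>2 * \<eta> * n\<close> neighbours. By
      \<open>replacement_bound\<close> at most \<open>4 * L * \<eta> * n / \<nu>\<close> typical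
      ones are then missing, which is at most half of \<open>\<epsilon> * n\<close>; the other half
      is for exceptional vertices.\<close>
    define \<eta> where "\<eta> = min (\<kappa> / 2) (\<nu> * \<epsilon> / (8 * L))"
    have \<eta>: "\<eta> > 0" "\<eta> \<le> \<kappa> / 2" "8 * L * \<eta> \<le> \<nu> * \<epsilon>"
    proof -
      show "\<eta> > 0" "\<eta> \<le> \<kappa> / 2" using \<kappa> \<nu> \<epsilon> L_pos by (auto simp: \<eta>_def)
      have "\<eta> \<le> \<nu> * \<epsilon> / (8 * L)" by (simp add: \<eta>_def)
      then show "8 * L * \<eta> \<le> \<nu> * \<epsilon>" using L_pos by (simp add: field_simps)
    qed
    from few_common_class[OF \<eta>(1)] obtain \<epsilon>0 N2 where \<epsilon>0: "\<epsilon>0 > (0::real)" and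
      N2: "\<forall>G U c v. ugraph G \<longrightarrow> Free G \<longrightarrow> card (verts G) \<ge> N2 \<longrightarrow> v \<in> verts G \<longrightarrow>
      U \<subseteq> verts G \<longrightarrow> c ` U \<subseteq> {..<k} \<longrightarrow> (\<forall>u\<in>U. real (card (non_neighbours G U c u)) \<le> \<epsilon>0 * card (verts G)) \<longrightarrow>
      (\<exists>i<k. real (card (neighbours G v \<inter> colour_class U c i)) < \<eta> * card (verts G))"
      by (elim exE conjE)
    \<comment> \<open>The terms serve, in order: \<open>few_common_class\<close>, the exceptional
      neighbours given up, the exceptional non-neighbours, the identification of a typical vertex's
      own class together with the linear lower bound on degrees, and the common neighbours of
      \<open>h\<close> vertices.\<close>
    define \<epsilon>1 where "\<epsilon>1 = min (min \<epsilon>0 (\<eta> / 2)) (min (\<epsilon> / 2) (min (\<kappa> / 4) (\<kappa> / (2 * (real h + 1)))))"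
    have \<epsilon>1: "\<epsilon>1 > 0" "\<epsilon>1 \<le> \<epsilon>0" "\<epsilon>1 \<le> \<eta> / 2" "\<epsilon>1 \<le> \<epsilon> / 2" "\<epsilon>1 \<le> \<kappa> / 4" "\<epsilon>1 * (real h + 1) \<le> \<kappa> / 2"
    proof -
      show "\<epsilon>1 > 0" using \<epsilon>0 \<eta>(1) \<epsilon> \<kappa> by (simp add: \<epsilon>1_def)
      show "\<epsilon>1 \<le> \<epsilon>0" "\<epsilon>1 \<le> \<eta> / 2" "\<epsilon>1 \<le> \<epsilon> / 2" "\<epsilon>1 \<le> \<kappa> / 4" unfolding \<epsilon>1_def by linarith+
      have "\<epsilon>1 \<le> \<kappa> / (2 * (real h + 1))" by (simp add: \<epsilon>1_def)
      then show "\<epsilon>1 * (real h + 1) \<le> \<kappa> / 2" by (simp add: field_simps)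
    qed
    from typical[rule_format, OF \<epsilon>1(1)] obtain N3 where
      N3: "\<forall>G. opt G \<and> card (verts G) \<ge> N3 \<longrightarrow>
    (\<exists>U c. U \<subseteq> verts G \<and> c ` U \<subseteq> {..<k} \<and> real (card (verts G - U)) \<le> \<epsilon>1 * card (verts G) \<and>
      (\<forall>i<k. \<kappa> * card (verts G) \<le> real (card (colour_class U c i))) \<and>
      (\<forall>v\<in>U. real (card (non_neighbours G U c v)) \<le> \<epsilon>1 * card (verts G)))" ..
    define N where "N = N1 + N2 + N3 + nat \<lceil>2 * (real h + 1) / \<kappa>\<rceil>"
    show "\<exists>N. \<forall>G. opt G \<and> card (verts G) \<ge> N \<longrightarrow>
    (\<exists>c. c ` verts G \<subseteq> {..<k} \<and> (\<forall>i<k. \<kappa> * card (verts G) \<le> real (card (colour_class (verts G) c i))) \<and>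
      (\<forall>v\<in>verts G. real (card (non_neighbours G (verts G) c v)) \<le> \<epsilon> * card (verts G)))"
    proof (intro exI[of _ N] allI impI, elim conjE)
      fix G assume G: "opt G" and N: "N \<le> card (verts G)"
      define n where "n = card (verts G)"
      have uG: "ugraph G" and finV: "finite (verts G)" using G opt_ugraph opt_finite by auto
      have n: "n \<ge> N1" "n \<ge> N2" "n \<ge> N3" "n \<ge> 1" using N \<open>N1 \<ge> 1\<close> by (auto simp: N_def n_def)
      have nh: "2 * (real h + 1) \<le> \<kappa> * real n"
      proof -
        have "real n \<ge> 2 * (real h + 1) / \<kappa>" using N unfolding N_def n_def by linarith
        then show ?thesis using \<kappa> by (simp add: field_simps)
      qed
      have "\<exists>U c. U \<subseteq> verts G \<and> c ` U \<subseteq> {..<k} \<and> real (card (verts G - U)) \<le> \<epsilon>1 * card (verts G) \<and>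
      (\<forall>i<k. \<kappa> * card (verts G) \<le> real (card (colour_class U c i))) \<and>
      (\<forall>v\<in>U. real (card (non_neighbours G U c v)) \<le> \<epsilon>1 * card (verts G))"
        by (rule N3[rule_format]) (use G n in \<open>simp add: n_def\<close>)
      then obtain U c where U: "U \<subseteq> verts G" "c ` U \<subseteq> {..<k}" and R: "real (card (verts G - U)) \<le> \<epsilon>1 * real n"
        and cl_large: "\<forall>i<k. \<kappa> * real n \<le> real (card (colour_class U c i))"
        and few: "\<forall>v\<in>U. real (card (non_neighbours G U c v)) \<le> \<epsilon>1 * real n"
        unfolding n_def by (elim exE conjE)
      have finU: "finite U" using finite_subset[OF U(1) finV] .
      have some_class: "\<exists>i<k. real (card (neighbours G v \<inter> colour_class U c i)) < \<eta> * real n" if "v \<in> verts G" for v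
      proof -
        have "\<epsilon>1 * real n \<le> \<epsilon>0 * real n" using \<epsilon>1(2) by (intro mult_right_mono) auto
        then have "\<forall>u\<in>U. real (card (non_neighbours G U c u)) \<le> \<epsilon>0 * real n" using few by (meson order_trans)
        then show ?thesis
          unfolding n_def
          by (intro N2[rule_format, OF uG opt_Free[OF G] _ that U]) (use n in \<open>simp_all add: n_def\<close>)
      qed
      have own_class: "real (card (neighbours G v \<inter> colour_class U c (c v))) < \<eta> * real n" if v: "v \<in> U" for v
      proof -
        obtain i where i: "i < k" "real (card (neighbours G v \<inter> colour_class U c i)) < \<eta> * real n"
          using some_class U(1) v by blast
        \<comment> \<open>In any other class a typical vertex is adjacent to nearly all of the
          \<open>\<kappa> * n\<close> vertices, so its sparse class must be its own.\<close>
        have "i = c v"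
        proof (rule ccontr)
          assume "i \<noteq> c v"
          then have "colour_class U c i \<subseteq> (neighbours G v \<inter> colour_class U c i) \<union> non_neighbours G U c v"
            by (auto simp: colour_class_def non_neighbours_def)
          then have "card (colour_class U c i) \<le> card ((neighbours G v \<inter> colour_class U c i) \<union> non_neighbours G U c v)"
            using finU by (intro card_mono) (auto simp: finite_colour_class non_neighbours_def)
          also have "\<dots> \<le> card (neighbours G v \<inter> colour_class U c i) + card (non_neighbours G U c v)" by (rule card_Un_le)
          finally have "real (card (colour_class U c i)) \<le> real (card (neighbours G v \<inter> colour_class U c i)) + real (card (non_neighbours G U c v))" by linarith
          moreover have "\<epsilon>1 * real n \<le> \<kappa> / 4 * real n" "\<eta> * real n \<le> \<kappa> / 2 * real n"
            using \<epsilon>1(5) \<eta>(2) by (intro mult_right_mono; simp)+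
          moreover have "real (card (non_neighbours G U c v)) \<le> \<epsilon>1 * real n" "\<kappa> * real n \<le> real (card (colour_class U c i))"
            using few v cl_large i by auto
          moreover have "\<kappa> * real n > 0" using \<kappa> n(4) by simp
          ultimately show False using i(2) by linarith
        qed
        then show ?thesis using i by simp
      qed
      define c' where "c' v = (if v \<in> U then c v else (SOME i. i < k \<and> real (card (neighbours G v \<inter> colour_class U c i)) < \<eta> * real n))" for v
      have c': "c' v < k \<and> real (card (neighbours G v \<inter> colour_class U c (c' v))) < \<eta> * real n" if "v \<in> verts G" for v
      proof (cases "v \<in> U")
        case True
        then show ?thesis using own_class U(2) by (auto simp: c'_def)
      next
        case False
        then show ?thesis using someI_ex[OF some_class[OF that]] by (simp add: c'_def)
      qed
      have c'U: "c' u = c u" if "u \<in> U" for u using that by (simp add: c'_def)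
      have few': "real (card (non_neighbours G (verts G) c' v)) \<le> \<epsilon> * real n" if v: "v \<in> verts G" for v
      proof -
        define i where "i = c' v"
        have i: "i < k" "real (card (neighbours G v \<inter> colour_class U c i)) < \<eta> * real n" using c'[OF v] by (auto simp: i_def)
        define W where "W = {u \<in> U. c u \<noteq> i} - {v}"
        have WV: "W \<subseteq> verts G - {v}" using U(1) by (auto simp: W_def)
        have degW: "\<alpha> * real n \<le> real (degree G u)" if "u \<in> W" for u
        proof -
          have u: "u \<in> U" using that by (simp add: W_def)
          have "colour_class U c i \<subseteq> neighbours G u \<union> non_neighbours G U c u" using that by (auto simp: colour_class_def non_neighbours_def W_def)
          then have "card (colour_class U c i) \<le> card (neighbours G u \<union> non_neighbours G U c u)"
            using finU finite_neighbours[OF uG] by (intro card_mono) (auto simp: non_neighbours_def)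
          also have "\<dots> \<le> card (neighbours G u) + card (non_neighbours G U c u)" by (rule card_Un_le)
          finally have "real (card (colour_class U c i)) \<le> real (degree G u) + real (card (non_neighbours G U c u))"
            unfolding degree_eq_card_neighbours[OF uG] by linarith
          moreover have "\<epsilon>1 * real n \<le> \<kappa> / 4 * real n" using \<epsilon>1(5) by (intro mult_right_mono) auto
          moreover have "real (card (non_neighbours G U c u)) \<le> \<epsilon>1 * real n" "\<kappa> * real n \<le> real (card (colour_class U c i))"
            using few u cl_large i by auto
          ultimately have "\<kappa> * real n - \<kappa> / 4 * real n \<le> real (degree G u)" by linarith
          moreover have "0 \<le> \<kappa> * real n" using \<kappa> by simp
          ultimately show ?thesis unfolding \<alpha>_def by linarith
        qed
        have "real (card (W - neighbours G v)) * (\<nu> * real n ^ s) \<le> 2 * real (card (neighbours G v - W)) * (L * real n ^ s)"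
        proof (rule replacement_bound[OF G n_def v WV])
          \<comment> \<open>Class \<open>i\<close> itself supplies the common neighbours: each
            vertex of \<open>Q\<close> is typical and coloured differently, so all of
            \<open>Q\<close> together misses at most half of that class.\<close>
          fix Q assume Q: "Q \<subseteq> W" "card Q \<le> h"
          have finQ: "finite Q" using Q(1) finU finite_subset[of Q U] by (auto simp: W_def)
          have sub: "colour_class U c i - {v} - (\<Union>q\<in>Q. non_neighbours G U c q) \<subseteq> {u \<in> verts G - {v}. Q \<subseteq> neighbours G u}"
          proof
            fix u assume u: "u \<in> colour_class U c i - {v} - (\<Union>q\<in>Q. non_neighbours G U c q)"
            have "q \<in> neighbours G u" if "q \<in> Q" for q
            proof -
              have "u \<in> U" "c u = i" "u \<notin> non_neighbours G U c q" using u that by (auto simp: colour_class_def)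
              moreover have "c q \<noteq> i" using that Q(1) by (auto simp: W_def)
              ultimately have "u \<in> neighbours G q" by (simp add: non_neighbours_def)
              then show ?thesis using neighbours_sym[of u G q] by simp
            qed
            then show "u \<in> {u \<in> verts G - {v}. Q \<subseteq> neighbours G u}" using u U(1) by (auto simp: colour_class_def)
          qed
          have "real (card (\<Union>q\<in>Q. non_neighbours G U c q)) \<le> (\<Sum>q\<in>Q. real (card (non_neighbours G U c q)))"
            using card_UN_le[OF finQ, of "non_neighbours G U c"] by (simp flip: of_nat_sum)
          also have "\<dots> \<le> (\<Sum>q\<in>Q. \<epsilon>1 * real n)"
            using few Q(1) by (intro sum_mono) (auto simp: W_def)
          also have "\<dots> = real (card Q) * (\<epsilon>1 * real n)" by simp
          also have "\<dots> \<le> real h * (\<epsilon>1 * real n)" using Q(2) \<epsilon>1(1) by (intro mult_right_mono) auto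
          also have "\<dots> \<le> (\<epsilon>1 * (real h + 1)) * real n" using \<epsilon>1(1) by (simp add: algebra_simps)
          also have "\<dots> \<le> \<kappa> / 2 * real n" using \<epsilon>1(6) by (intro mult_right_mono) auto
          finally have union: "real (card (\<Union>q\<in>Q. non_neighbours G U c q)) \<le> \<kappa> / 2 * real n" .
          have "colour_class U c i \<subseteq> (colour_class U c i - {v} - (\<Union>q\<in>Q. non_neighbours G U c q)) \<union> ({v} \<union> (\<Union>q\<in>Q. non_neighbours G U c q))" by blast
          then have "card (colour_class U c i) \<le> card ((colour_class U c i - {v} - (\<Union>q\<in>Q. non_neighbours G U c q)) \<union> ({v} \<union> (\<Union>q\<in>Q. non_neighbours G U c q)))"
            using finU finQ by (intro card_mono) (auto simp: finite_colour_class non_neighbours_def)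
          also have "\<dots> \<le> card (colour_class U c i - {v} - (\<Union>q\<in>Q. non_neighbours G U c q)) + card ({v} \<union> (\<Union>q\<in>Q. non_neighbours G U c q))"
            by (rule card_Un_le)
          also have "card ({v} \<union> (\<Union>q\<in>Q. non_neighbours G U c q)) \<le> 1 + card (\<Union>q\<in>Q. non_neighbours G U c q)"
            using card_Un_le[of "{v}" "\<Union>q\<in>Q. non_neighbours G U c q"] by simp
          also have "card (colour_class U c i - {v} - (\<Union>q\<in>Q. non_neighbours G U c q)) \<le> card {u \<in> verts G - {v}. Q \<subseteq> neighbours G u}"
            using sub finV by (intro card_mono) auto
          finally have "real (card (colour_class U c i)) \<le> real (card {u \<in> verts G - {v}. Q \<subseteq> neighbours G u}) + (1 + real (card (\<Union>q\<in>Q. non_neighbours G U c q)))"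
            by linarith
          moreover have "\<kappa> * real n \<le> real (card (colour_class U c i))" using cl_large i by simp
          moreover have "\<kappa> / 2 * real n = (\<kappa> * real n) / 2" by simp
          ultimately have "real h \<le> real (card {u \<in> verts G - {v}. Q \<subseteq> neighbours G u})"
            using union nh by argo
          then show "h \<le> card {u \<in> verts G - {v}. Q \<subseteq> neighbours G u}" by simp
        next
          fix u assume u: "u \<in> W" "u \<notin> neighbours G v"
          have "neighbours G u \<subseteq> verts G - {u}" using neighbours_subset[OF uG] not_self_neighbours[OF uG] by blast
          then have "card (neighbours G u) \<le> card (verts G - {u})" using finV by (intro card_mono) auto
          moreover have "u \<in> verts G" using u U(1) by (auto simp: W_def)
          ultimately have "Suc (degree G u) \<le> n"
            unfolding degree_eq_card_neighbours[OF uG] n_def using finV n(4) by (simp add: n_def)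
          then show "\<nu> * real n ^ s \<le> g (Suc (degree G u)) - g (degree G u)"
            using N1[rule_format, OF n(1) degW[OF u(1)], of "Suc (degree G u)"] by simp
        qed (use \<nu> in simp)
        then have "(real (card (W - neighbours G v)) * \<nu>) * real n ^ s \<le> (2 * real (card (neighbours G v - W)) * L) * real n ^ s"
          by (simp only: mult.assoc)
        moreover have "real n ^ s > 0" using n(4) by simp
        ultimately have le: "real (card (W - neighbours G v)) * \<nu> \<le> 2 * real (card (neighbours G v - W)) * L"
          by (simp only: mult_le_cancel_right_pos)
        have "neighbours G v - W \<subseteq> (neighbours G v \<inter> colour_class U c i) \<union> (verts G - U)"
          using neighbours_subset[OF uG, of v] not_self_neighbours[OF uG, of v] by (auto simp: W_def colour_class_def)
        then have "card (neighbours G v - W) \<le> card ((neighbours G v \<inter> colour_class U c i) \<union> (verts G - U))"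
          using finV finU by (intro card_mono) (auto simp: finite_colour_class)
        also have "\<dots> \<le> card (neighbours G v \<inter> colour_class U c i) + card (verts G - U)" by (rule card_Un_le)
        finally have "real (card (neighbours G v - W)) \<le> \<eta> * real n + \<epsilon>1 * real n" using i(2) R by linarith
        also have "\<dots> \<le> 2 * \<eta> * real n"
        proof -
          have "\<epsilon>1 * real n \<le> \<eta> * real n" using \<epsilon>1(3) \<eta>(1) by (intro mult_right_mono) auto
          then show ?thesis by simp
        qed
        finally have "2 * L * real (card (neighbours G v - W)) \<le> 2 * L * (2 * \<eta> * real n)"
          using L_pos by (intro mult_left_mono) auto
        also have "\<dots> = (8 * L * \<eta>) * (real n / 2)" by simp
        also have "\<dots> \<le> (\<nu> * \<epsilon>) * (real n / 2)" using \<eta>(3) by (intro mult_right_mono) auto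
        finally have "\<nu> * real (card (W - neighbours G v)) \<le> \<nu> * (\<epsilon> / 2 * real n)" using le by (simp add: algebra_simps)
        then have cW: "real (card (W - neighbours G v)) \<le> \<epsilon> / 2 * real n" using \<nu> by simp
        have "non_neighbours G (verts G) c' v \<subseteq> (W - neighbours G v) \<union> (verts G - U)"
          unfolding non_neighbours_def W_def i_def using c'U by auto
        then have "card (non_neighbours G (verts G) c' v) \<le> card ((W - neighbours G v) \<union> (verts G - U))"
          using finV finU by (intro card_mono) (auto simp: W_def)
        also have "\<dots> \<le> card (W - neighbours G v) + card (verts G - U)" by (rule card_Un_le)
        finally have "real (card (non_neighbours G (verts G) c' v)) \<le> \<epsilon> / 2 * real n + \<epsilon>1 * real n" using cW R by linarith
        moreover have "\<epsilon>1 * real n \<le> \<epsilon> / 2 * real n" using \<epsilon>1(4) by (intro mult_right_mono) auto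
        ultimately show ?thesis by simp
      qed
      have colour_class': "\<kappa> * real n \<le> real (card (colour_class (verts G) c' i))" if "i < k" for i
      proof -
        have "card (colour_class U c i) \<le> card (colour_class (verts G) c' i)"
          using finV U(1) c'U by (intro card_mono) (auto simp: colour_class_def)
        then show ?thesis using cl_large that by (meson of_nat_le_iff order_trans)
      qed
      show "\<exists>c. c ` verts G \<subseteq> {..<k} \<and> (\<forall>i<k. \<kappa> * card (verts G) \<le> real (card (colour_class (verts G) c i))) \<and>
        (\<forall>v\<in>verts G. real (card (non_neighbours G (verts G) c v)) \<le> \<epsilon> * card (verts G))"
        using c' colour_class' few' unfolding n_def by (intro exI[of _ c']) auto
    qed
  qed
qed

end

section \<open>Comparison with the complete multipartite graph\<close>

text \<open>Summation over the levels of \<open>\<gamma>\<close>, by subtracting its minimum.\<close>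

lemma sum_threshold_le:
  fixes a \<gamma> :: "'a \<Rightarrow> real" and \<Gamma> B :: real
  assumes "finite J" "\<And>e. e \<in> J \<Longrightarrow> 0 \<le> \<gamma> e \<and> \<gamma> e \<le> \<Gamma>" "0 \<le> \<Gamma>" "0 \<le> B"
    "\<And>\<theta>. \<theta> > 0 \<Longrightarrow> (\<Sum>e | e \<in> J \<and> \<theta> \<le> \<gamma> e. a e) \<le> B"
  shows "(\<Sum>e\<in>J. a e * \<gamma> e) \<le> B * \<Gamma>"
  using assms
proof (induction "card J" arbitrary: J \<gamma> \<Gamma> rule: less_induct)
  case less
  show ?case
  proof (cases "J = {}")
    case True
    then show ?thesis using less.prems by simp
  next
    case False
    define x where "x = Min (\<gamma> ` J)"
    have x_le: "x \<le> \<gamma> e" if "e \<in> J" for e using that less.prems(1) by (simp add: x_def)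
    have "x \<in> \<gamma> ` J" unfolding x_def using less.prems(1) False by (intro Min_in) auto
    then obtain e0 where e0: "e0 \<in> J" "\<gamma> e0 = x" by auto
    have x0: "0 \<le> x" "x \<le> \<Gamma>" using less.prems(2)[OF e0(1)] e0(2) by auto
    define J' where "J' = {e \<in> J. x < \<gamma> e}"
    have "J' \<subset> J" using e0 by (auto simp: J'_def)
    then have "card J' < card J" using less.prems(1) by (rule psubset_card_mono[rotated])
    then have IH: "(\<Sum>e\<in>J'. a e * (\<gamma> e - x)) \<le> B * (\<Gamma> - x)"
    proof (rule less.hyps)
      show "finite J'" using less.prems(1) by (simp add: J'_def)
      show "0 \<le> \<gamma> e - x \<and> \<gamma> e - x \<le> \<Gamma> - x" if "e \<in> J'" for e
        using that less.prems(2) by (auto simp: J'_def)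
      show "0 \<le> \<Gamma> - x" using x0 by simp
      show "0 \<le> B" by (rule less.prems)
      fix \<theta> :: real assume \<theta>: "\<theta> > 0"
      have "{e. e \<in> J' \<and> \<theta> \<le> \<gamma> e - x} = {e. e \<in> J \<and> \<theta> + x \<le> \<gamma> e}"
        using \<theta> by (auto simp: J'_def)
      moreover have "\<theta> + x > 0" using \<theta> x0 by simp
      ultimately show "(\<Sum>e | e \<in> J' \<and> \<theta> \<le> \<gamma> e - x. a e) \<le> B" using less.prems(5) by simp
    qed
    \<comment> \<open>The threshold hypothesis covers positive thresholds only; a minimum of 0
      contributes nothing.\<close>
    have "x * (\<Sum>e\<in>J. a e) \<le> x * B"
    proof (cases "x = 0")
      case False
      then have "(\<Sum>e | e \<in> J \<and> x \<le> \<gamma> e. a e) \<le> B" using x0 by (intro less.prems(5)) simp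
      moreover have "{e. e \<in> J \<and> x \<le> \<gamma> e} = J" using x_le by auto
      ultimately show ?thesis using x0 by (simp add: mult_left_mono)
    qed simp
    moreover have "(\<Sum>e\<in>J. a e * (\<gamma> e - x)) = (\<Sum>e\<in>J'. a e * (\<gamma> e - x))"
    proof (rule sum.mono_neutral_right)
      show "\<forall>e\<in>J - J'. a e * (\<gamma> e - x) = 0"
        using x_le by (force simp: J'_def)
    qed (use less.prems(1) in \<open>auto simp: J'_def\<close>)
    moreover have "(\<Sum>e\<in>J. a e * \<gamma> e) = x * (\<Sum>e\<in>J. a e) + (\<Sum>e\<in>J. a e * (\<gamma> e - x))"
      by (simp add: sum_distrib_left sum.distrib[symmetric] algebra_simps)
    ultimately show ?thesis using IH by (simp add: algebra_simps)
  qed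
qed

text \<open>At the lowest level the whole sum counts, and there it is one unit below the bound,
  which saves \<open>x\<close>. This is the gain that will outweigh the approximation
  errors.\<close>

lemma sum_threshold_less:
  fixes a \<gamma> :: "'a \<Rightarrow> real" and \<Gamma> B x :: real
  assumes "finite J" "\<And>e. e \<in> J \<Longrightarrow> x \<le> \<gamma> e \<and> \<gamma> e \<le> \<Gamma>" "x \<le> \<Gamma>" "0 \<le> x" "0 \<le> B"
    "\<And>\<theta>. (\<Sum>e | e \<in> J \<and> \<theta> \<le> \<gamma> e. a e) \<le> B" and total: "(\<Sum>e\<in>J. a e) \<le> B - 1"
  shows "(\<Sum>e\<in>J. a e * \<gamma> e) \<le> B * \<Gamma> - x"
proof -
  have "(\<Sum>e\<in>J. a e * (\<gamma> e - x)) \<le> B * (\<Gamma> - x)"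
  proof (rule sum_threshold_le)
    fix \<theta> :: real
    have "{e. e \<in> J \<and> \<theta> \<le> \<gamma> e - x} = {e. e \<in> J \<and> \<theta> + x \<le> \<gamma> e}" by auto
    then show "(\<Sum>e | e \<in> J \<and> \<theta> \<le> \<gamma> e - x. a e) \<le> B" using assms(6) by simp
  qed (use assms in auto)
  moreover have "x * (\<Sum>e\<in>J. a e) \<le> x * (B - 1)" using total assms(4) by (rule mult_left_mono)
  moreover have "(\<Sum>e\<in>J. a e * \<gamma> e) = x * (\<Sum>e\<in>J. a e) + (\<Sum>e\<in>J. a e * (\<gamma> e - x))"
    by (simp add: sum_distrib_left sum.distrib[symmetric] algebra_simps)
  ultimately show ?thesis by (simp add: algebra_simps)
qed

lemma sum_incidences:
  fixes w :: "'a \<Rightarrow> real"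
  assumes "finite V" "finite I" "\<And>e. e \<in> I \<Longrightarrow> e \<subseteq> V"
  shows "(\<Sum>v\<in>V. real (card {e \<in> I. v \<in> e}) * w v) = (\<Sum>e\<in>I. \<Sum>v\<in>e. w v)"
proof -
  have "(\<Sum>v\<in>V. real (card {e \<in> I. v \<in> e}) * w v) = (\<Sum>v\<in>V. \<Sum>e\<in>I. if v \<in> e then w v else 0)"
    using assms(2) by (simp add: sum.If_cases Int_def)
  also have "\<dots> = (\<Sum>e\<in>I. \<Sum>v\<in>V. if v \<in> e then w v else 0)" by (rule sum.swap)
  also have "\<dots> = (\<Sum>e\<in>I. \<Sum>v\<in>e. w v)"
  proof (rule sum.cong)
    fix e assume "e \<in> I"
    then have "V \<inter> {v. v \<in> e} = e" using assms(3) by blast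
    then show "(\<Sum>v\<in>V. if v \<in> e then w v else 0) = (\<Sum>v\<in>e. w v)"
      using assms(1) by (simp add: sum.If_cases)
  qed simp
  finally show ?thesis .
qed

lemma card_Union_edges_le:
  assumes "finite I" "\<And>e. e \<in> I \<Longrightarrow> card e = 2"
  shows "card (\<Union>I) \<le> 2 * card I"
proof -
  have "card (\<Union>I) \<le> (\<Sum>e\<in>I. card e)" using card_Union_le_sum_card[of I] by simp
  then show ?thesis using assms(2) by simp
qed

text \<open>The bound in \<open>large\<close> is what extending small vertex sets greedily to balanced sets of class size
  \<open>m\<close> without new missing pairs requires.\<close>

locale near_multipartite = excess_bounded +
  fixes G :: "nat ugraph" and c :: "nat \<Rightarrow> nat" and m z :: nat
  assumes G_ugraph: "ugraph G" and G_Free: "Free G"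
    and col: "c ` verts G \<subseteq> {..<k}"
    and few: "\<And>v. v \<in> verts G \<Longrightarrow> card (non_neighbours G (verts G) c v) \<le> z"
    and large: "\<And>i. i < k \<Longrightarrow> k * m * (z + 1) + m \<le> card (colour_class (verts G) c i)"
    and m_ge: "m \<ge> m0" "m \<ge> 2 * (b + 1)"
begin

abbreviation "V \<equiv> verts G"

text \<open>\<open>G\<close> arises from the complete multipartite graph on its colour classes by
  adding \<open>I\<close>, the edges inside classes, and deleting \<open>M\<close>, the missing
  pairs.\<close>

definition I where "I = edges G - cross_edges V c"
definition M where "M = cross_edges V c - edges G"

lemma finV: "finite V" by (rule ugraph_finite[OF G_ugraph])

lemma fin: "finite (edges G)" "finite I" "finite M"
  using ugraph_finite_edges[OF G_ugraph] finite_cross_edges[OF finV] by (simp_all add: I_def M_def)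

lemma I_card: "e \<in> I \<Longrightarrow> card e = 2" and I_sub: "e \<in> I \<Longrightarrow> e \<subseteq> V"
  using G_ugraph by (auto simp: I_def ugraph_def)

lemma M_card: "e \<in> M \<Longrightarrow> card e = 2" and M_sub: "e \<in> M \<Longrightarrow> e \<subseteq> V"
  using ugraph_cross_edges[OF finV, of c] by (auto simp: M_def ugraph_def)

lemma I_cases:
  assumes "e \<in> I"
  obtains u v where "e = {u, v}" "u \<noteq> v" "u \<in> V" "v \<in> V" "c u = c v"
proof -
  have "e \<in> edges G" "e \<notin> cross_edges V c" using assms by (auto simp: I_def)
  then show ?thesis using that ugraph_edge_cases[OF G_ugraph] cross_edges_iff by metis
qed

lemma obtain_balanced:
  assumes "X \<subseteq> V" "card X \<le> m"
  obtains B where "X \<subseteq> B" "B \<subseteq> V" "c ` B \<subseteq> {..<k}" "\<And>i. i < k \<Longrightarrow> card (colour_class B c i) = m"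
    "\<And>e. e \<in> cross_edges B c \<Longrightarrow> e \<notin> edges G \<Longrightarrow> e \<subseteq> X"
proof -
  have finX: "finite X" using finite_subset[OF assms(1) finV] .
  have "\<exists>B. X \<subseteq> B \<and> B \<subseteq> X \<union> V \<and> c ` B \<subseteq> {..<k} \<and> (\<forall>i<k. card (colour_class B c i) = m) \<and>
    (\<forall>u\<in>B. \<forall>v\<in>B. c u \<noteq> c v \<longrightarrow> u \<in> X \<and> v \<in> X \<or> v \<in> neighbours G u)"
  proof (rule extend_balanced[OF G_ugraph finV finX])
    show "c ` X \<subseteq> {..<k}" using col assms(1) by blast
    show "card (colour_class X c i) \<le> m" for i
      using card_mono[OF finX colour_class_subset[of X c i]] assms(2) by simp
    show "card (non_neighbours G V c x) \<le> z" if "x \<in> X \<union> V" for x using few that assms(1) by blast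
    show "k * m * (z + 1) + m \<le> card (colour_class V c i)" if "i < k" for i by (rule large[OF that])
  qed
  then obtain B where B: "X \<subseteq> B" "B \<subseteq> X \<union> V" "c ` B \<subseteq> {..<k}" "\<forall>i<k. card (colour_class B c i) = m"
    and adj: "\<forall>u\<in>B. \<forall>v\<in>B. c u \<noteq> c v \<longrightarrow> u \<in> X \<and> v \<in> X \<or> v \<in> neighbours G u"
    by (elim exE conjE)
  show ?thesis
  proof (rule that[OF B(1) _ B(3)])
    show "B \<subseteq> V" using B(2) assms(1) by blast
    show "card (colour_class B c i) = m" if "i < k" for i using B(4) that by blast
    fix e assume "e \<in> cross_edges B c" "e \<notin> edges G"
    then show "e \<subseteq> X" using adj by (auto elim!: cross_edges_cases simp: mem_neighbours)
  qed
qed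

text \<open>The endpoints of \<open>b + 1\<close> edges inside one class number at most
  \<open>m\<close> and extend to a balanced set. Missing pairs of that set could only lie among
  these endpoints, which all have one colour; so there are none, and \<open>extra_edges_le\<close>
  applies.\<close>

lemma class_edges_le:
  assumes i: "i < k"
  shows "card {e \<in> edges G. e \<subseteq> colour_class V c i} \<le> b"
proof (rule ccontr)
  assume "\<not> ?thesis"
  then have "b + 1 \<le> card {e \<in> edges G. e \<subseteq> colour_class V c i}" by simp
  then obtain J where J: "J \<subseteq> {e \<in> edges G. e \<subseteq> colour_class V c i}" "card J = b + 1" and finJ: "finite J"
    by (rule obtain_subset_with_card_n)
  have "card e = 2" if "e \<in> J" for e using that J(1) G_ugraph by (auto simp: ugraph_def)
  then have "card (\<Union>J) \<le> 2 * card J" by (rule card_Union_edges_le[OF finJ])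
  then have "card (\<Union>J) \<le> m" using J(2) m_ge(2) by simp
  moreover have JV: "\<Union>J \<subseteq> colour_class V c i" using J(1) by blast
  then have JV': "\<Union>J \<subseteq> V" by (auto simp: colour_class_def)
  ultimately obtain B where B: "\<Union>J \<subseteq> B" "B \<subseteq> V" "c ` B \<subseteq> {..<k}" "\<And>i. i < k \<Longrightarrow> card (colour_class B c i) = m"
    "\<And>e. e \<in> cross_edges B c \<Longrightarrow> e \<notin> edges G \<Longrightarrow> e \<subseteq> \<Union>J"
    using obtain_balanced[OF JV'] by metis
  have "card J \<le> b"
  proof (rule extra_edges_le[OF G_ugraph G_Free B(2,3) m_ge(1) B(4)])
    show "cross_edges B c \<subseteq> edges G"
    proof
      fix e assume e: "e \<in> cross_edges B c"
      show "e \<in> edges G"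
      proof (rule ccontr)
        assume "e \<notin> edges G"
        then have "e \<subseteq> colour_class V c i" using B(5)[OF e] JV by blast
        with e show False by (auto elim!: cross_edges_cases simp: colour_class_def)
      qed
    qed
    show "J \<subseteq> edges G" using J(1) by blast
    show "\<forall>e\<in>J. e \<subseteq> B" using B(1) by blast
    show "J \<inter> cross_edges B c = {}"
    proof -
      have "e \<notin> cross_edges B c" if "e \<subseteq> colour_class V c i" for e
        using that by (auto elim!: cross_edges_cases simp: colour_class_def)
      then show ?thesis using JV by blast
    qed
  qed
  then show False using J(2) by simp
qed

lemma card_I_le: "card I \<le> k * b"
proof -
  have "I \<subseteq> (\<Union>i<k. {e \<in> edges G. e \<subseteq> colour_class V c i})"
  proof
    fix e assume e: "e \<in> I"
    then obtain u v where "e = {u, v}" "u \<in> V" "v \<in> V" "c u = c v" by (rule I_cases)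
    then show "e \<in> (\<Union>i<k. {e \<in> edges G. e \<subseteq> colour_class V c i})"
      using e col by (auto simp: I_def colour_class_def intro!: bexI[of _ "c v"])
  qed
  then have "card I \<le> card (\<Union>i<k. {e \<in> edges G. e \<subseteq> colour_class V c i})"
    using fin(1) by (intro card_mono) auto
  also have "\<dots> \<le> (\<Sum>i<k. card {e \<in> edges G. e \<subseteq> colour_class V c i})" by (rule card_UN_le) simp
  also have "\<dots> \<le> (\<Sum>i<k. b)" by (rule sum_mono) (simp add: class_edges_le)
  finally show ?thesis by simp
qed

lemma card_Union_IM:
  assumes "2 * (card I + card M) \<le> m"
  shows "card (\<Union>(I \<union> M)) \<le> m" "\<Union>(I \<union> M) \<subseteq> V"
proof -
  have "card (\<Union>(I \<union> M)) \<le> 2 * card (I \<union> M)"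
    using fin I_card M_card by (intro card_Union_edges_le) auto
  also have "\<dots> \<le> 2 * (card I + card M)" by (rule mult_le_mono2[OF card_Un_le])
  finally show "card (\<Union>(I \<union> M)) \<le> m" using assms by (rule order_trans)
  show "\<Union>(I \<union> M) \<subseteq> V" using I_sub M_sub by blast
qed

lemma balanced_edges_eq:
  assumes "B \<subseteq> V"
  shows "{e \<in> edges G. e \<subseteq> B} = (cross_edges B c - {e \<in> M. e \<subseteq> B}) \<union> {e \<in> I. e \<subseteq> B}"
    and "{e \<in> M. e \<subseteq> B} \<subseteq> cross_edges B c"
proof -
  have cpe_B: "e \<in> cross_edges B c \<longleftrightarrow> e \<in> cross_edges V c \<and> e \<subseteq> B" for e
    using assms unfolding cross_edges_def by blast
  show "{e \<in> edges G. e \<subseteq> B} = (cross_edges B c - {e \<in> M. e \<subseteq> B}) \<union> {e \<in> I. e \<subseteq> B}"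
    "{e \<in> M. e \<subseteq> B} \<subseteq> cross_edges B c"
    unfolding set_eq_iff subset_iff using cpe_B by (auto simp: I_def M_def)
qed

lemma card_balanced_edges:
  assumes "B \<subseteq> V"
  shows "card {e \<in> edges G. e \<subseteq> B} + card {e \<in> M. e \<subseteq> B} = card (cross_edges B c) + card {e \<in> I. e \<subseteq> B}"
proof -
  have finB: "finite (cross_edges B c)" by (rule finite_cross_edges[OF finite_subset[OF assms finV]])
  have "e \<notin> cross_edges B c" if "e \<in> I" for e
    using that assms unfolding I_def cross_edges_def by blast
  then have "(cross_edges B c - {e \<in> M. e \<subseteq> B}) \<inter> {e \<in> I. e \<subseteq> B} = {}" by blast
  then have "card {e \<in> edges G. e \<subseteq> B} = card (cross_edges B c - {e \<in> M. e \<subseteq> B}) + card {e \<in> I. e \<subseteq> B}"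
    unfolding balanced_edges_eq(1)[OF assms] using finB fin by (intro card_Un_disjoint) auto
  moreover have "card (cross_edges B c - {e \<in> M. e \<subseteq> B}) + card {e \<in> M. e \<subseteq> B} = card (cross_edges B c)"
    using card_Diff_subset[OF _ balanced_edges_eq(2)[OF assms]] card_mono[OF finB balanced_edges_eq(2)[OF assms]] fin
    by simp
  ultimately show ?thesis by simp
qed

text \<open>The vertices of the remaining colours can be chosen outside all missing pairs.\<close>

lemma threshold_excess:
  assumes small: "2 * (card I + card M) \<le> m"
  shows "card {e \<in> I. c ` e \<subseteq> T} \<le> card {e \<in> M. c ` e \<subseteq> T} + b"
proof -
  \<comment> \<open>Prescribing only vertices with colours in \<open>T\<close> keeps every inside
    edge of those colours, while every missing pair of \<open>B\<close> lies in \<open>X\<close> and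
    so has both colours in \<open>T\<close>.\<close>
  define X where "X = {v \<in> \<Union>(I \<union> M). c v \<in> T}"
  have "finite (\<Union>(I \<union> M))" using finite_subset[OF card_Union_IM(2)[OF small] finV] .
  then have "card X \<le> card (\<Union>(I \<union> M))" by (intro card_mono) (auto simp: X_def)
  then have "card X \<le> m" using card_Union_IM(1)[OF small] by simp
  moreover have XV: "X \<subseteq> V" using card_Union_IM(2)[OF small] by (auto simp: X_def)
  ultimately obtain B where B: "X \<subseteq> B" "B \<subseteq> V" "c ` B \<subseteq> {..<k}" "\<And>i. i < k \<Longrightarrow> card (colour_class B c i) = m"
    "\<And>e. e \<in> cross_edges B c \<Longrightarrow> e \<notin> edges G \<Longrightarrow> e \<subseteq> X"
    using obtain_balanced[OF XV] by metis
  have "{e \<in> I. c ` e \<subseteq> T} \<subseteq> {e \<in> I. e \<subseteq> B}" using B(1) by (fastforce simp: X_def)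
  then have "card {e \<in> I. c ` e \<subseteq> T} \<le> card {e \<in> I. e \<subseteq> B}" using fin by (intro card_mono) auto
  moreover have "{e \<in> M. e \<subseteq> B} \<subseteq> {e \<in> M. c ` e \<subseteq> T}"
  proof
    fix e assume e: "e \<in> {e \<in> M. e \<subseteq> B}"
    then have "e \<in> cross_edges B c" using balanced_edges_eq(2)[OF B(2)] by blast
    then have "e \<subseteq> X" using e by (intro B(5)) (auto simp: M_def)
    then show "e \<in> {e \<in> M. c ` e \<subseteq> T}" using e by (auto simp: X_def)
  qed
  then have "card {e \<in> M. e \<subseteq> B} \<le> card {e \<in> M. c ` e \<subseteq> T}" using fin by (intro card_mono) auto
  moreover have "card {e \<in> edges G. e \<subseteq> B} \<le> card (cross_edges B c) + b"
    by (rule excess[OF G_ugraph G_Free B(2,3) m_ge(1) B(4)])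
  ultimately show ?thesis using card_balanced_edges[OF B(2)] by linarith
qed

lemma balanced_superset:
  assumes small: "2 * (card I + card M) \<le> m"
  obtains B where "\<Union>(I \<union> M) \<subseteq> B" "B \<subseteq> V" "c ` B \<subseteq> {..<k}" "\<And>i. i < k \<Longrightarrow> card (colour_class B c i) = m"
    "card {e \<in> edges G. e \<subseteq> B} + card M = card (cross_edges B c) + card I"
proof -
  obtain B where B: "\<Union>(I \<union> M) \<subseteq> B" "B \<subseteq> V" "c ` B \<subseteq> {..<k}" "\<And>i. i < k \<Longrightarrow> card (colour_class B c i) = m"
    using obtain_balanced[OF card_Union_IM(2)[OF small] card_Union_IM(1)[OF small]] by metis
  have "{e \<in> M. e \<subseteq> B} = M" "{e \<in> I. e \<subseteq> B} = I" using B(1) by blast+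
  then have "card {e \<in> edges G. e \<subseteq> B} + card M = card (cross_edges B c) + card I"
    using card_balanced_edges[OF B(2)] by simp
  then show ?thesis using that B by blast
qed

lemma degree_identity:
  assumes "v \<in> V"
  shows "degree G v + card {e \<in> M. v \<in> e} = (card V - card (colour_class V c (c v))) + card {e \<in> I. v \<in> e}"
proof -
  have f: "finite (cross_edges V c)" by (rule finite_cross_edges[OF finV])
  have "degree G v + card {e \<in> M. v \<in> e} = card ({e \<in> edges G. v \<in> e} \<union> {e \<in> M. v \<in> e})"
    unfolding degree_def using fin by (subst card_Un_disjoint) (auto simp: M_def)
  also have "{e \<in> edges G. v \<in> e} \<union> {e \<in> M. v \<in> e} = {e \<in> cross_edges V c. v \<in> e} \<union> {e \<in> I. v \<in> e}"
    by (auto simp: M_def I_def)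
  also have "card \<dots> = card {e \<in> cross_edges V c. v \<in> e} + card {e \<in> I. v \<in> e}"
    using f fin by (intro card_Un_disjoint) (auto simp: I_def)
  also have "card {e \<in> cross_edges V c. v \<in> e} = card V - card (colour_class V c (c v))"
    using degree_cross_edges[OF finV assms, of c] by (simp add: degree_def)
  finally show ?thesis .
qed

lemma card_M_at_le:
  assumes "v \<in> V"
  shows "card {e \<in> M. v \<in> e} \<le> z"
proof -
  have f: "finite (non_neighbours G V c v)" using finV by (simp add: non_neighbours_def)
  have "{e \<in> M. v \<in> e} \<subseteq> (\<lambda>u. {v, u}) ` non_neighbours G V c v"
  proof
    fix e assume "e \<in> {e \<in> M. v \<in> e}"
    then have e: "e \<in> cross_edges V c" "e \<notin> edges G" "v \<in> e" by (auto simp: M_def)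
    then obtain x y where xy: "e = {x, y}" "x \<in> V" "y \<in> V" "c x \<noteq> c y" by (auto elim: cross_edges_cases)
    then consider "v = x" | "v = y" using e(3) by auto
    then show "e \<in> (\<lambda>u. {v, u}) ` non_neighbours G V c v"
    proof cases
      case 1
      then show ?thesis using xy e(2) by (intro image_eqI[of _ _ y]) (auto simp: non_neighbours_def mem_neighbours)
    next
      case 2
      then show ?thesis using xy e(2)
        by (intro image_eqI[of _ _ x]) (auto simp: non_neighbours_def mem_neighbours insert_commute)
    qed
  qed
  then have "card {e \<in> M. v \<in> e} \<le> card ((\<lambda>u. {v, u}) ` non_neighbours G V c v)" using f by (intro card_mono) auto
  also have "\<dots> \<le> card (non_neighbours G V c v)" by (rule card_image_le[OF f])
  finally show ?thesis using few[OF assms] by simp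
qed

end

section \<open>The optimum to first order\<close>

context extremal_setting
begin

text \<open>The set \<open>B\<close> covers every pair where \<open>G\<close> differs from the
  complete multipartite graph, so the known structure of the extremal graph on \<open>B\<close> will
  determine all of \<open>G\<close>. The final inequality will force the colouring \<open>c\<close>
  of \<open>B\<close> and its Turan partition to agree.\<close>

lemma extremal_structure:
  "\<exists>N. \<forall>G. opt G \<and> card (verts G) \<ge> N \<longrightarrow>
    (\<exists>c m B. c ` verts G \<subseteq> {..<k} \<and> m \<ge> m1 \<and> B \<subseteq> verts G \<and> (\<forall>i<k. card (colour_class B c i) = m) \<and>
      card {e \<in> edges G. e \<subseteq> B} = card (cross_edges B c) + b \<and>
      \<Union>((edges G - cross_edges (verts G) c) \<union> (cross_edges (verts G) c - edges G)) \<subseteq> B \<and>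
      card (edges G - cross_edges (verts G) c) + 2 < m)"
proof -
  from global_structure obtain \<kappa> where \<kappa>: "\<kappa> > (0::real)" and
    global: "\<forall>\<epsilon>>(0::real). \<exists>N. \<forall>G. opt G \<and> card (verts G) \<ge> N \<longrightarrow>
    (\<exists>c. c ` verts G \<subseteq> {..<k} \<and> (\<forall>i<k. \<kappa> * card (verts G) \<le> real (card (colour_class (verts G) c i))) \<and>
      (\<forall>v\<in>verts G. real (card (non_neighbours G (verts G) c v)) \<le> \<epsilon> * card (verts G)))"
    by (elim exE conjE)
  define \<alpha> where "\<alpha> = \<kappa> / 2"
  have \<alpha>: "\<alpha> > 0" using \<kappa> by (simp add: \<alpha>_def)
  define \<nu> where "\<nu> = \<alpha> ^ s / 2"
  have \<nu>: "\<nu> > 0" using \<alpha> by (simp add: \<nu>_def)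
  from g_diff_ge[OF \<alpha>] obtain N1 where "N1 \<ge> 1" and N1: "\<forall>n a b. n \<ge> N1 \<longrightarrow> \<alpha> * real n \<le> real a \<longrightarrow> a \<le> b \<longrightarrow> b \<le> n \<longrightarrow>
    (real b - real a) * (\<nu> * real n ^ s) \<le> g b - g a"
    unfolding \<nu>_def by (elim exE conjE)
  \<comment> \<open>A bound for \<open>card M\<close>: at each end, an inside edge gains at most
    \<open>L * n ^ s\<close> and a missing pair loses at least \<open>\<nu> * n ^ s\<close>, so
    optimality forces \<open>\<nu> * card M \<le> L * card I\<close>, and
    \<open>card I \<le> k * b\<close>.\<close>
  define Q where "Q = nat \<lfloor>real (k * b) * L / \<nu>\<rfloor>"
  define W where "W = k * b + Q"
  \<comment> \<open>Large enough to contain all endpoints of \<open>I\<close> and \<open>M\<close>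
    in a class, and above the number of inside edges by more than 2. It is chosen before \<epsilon>
    and \<open>n\<close>.\<close>
  define m where "m = m0 + m1 + 2 * (b + 1) + 2 * W + k * b + 3"
  have m: "m \<ge> m0" "m \<ge> m1" "m \<ge> 2 * (b + 1)" "m \<ge> 2 * W" "m > k * b + 2" "m \<ge> 1" by (auto simp: m_def)
  have km: "real (k * m) > 0" using m(6) k_ge_2 by simp
  define \<epsilon> where "\<epsilon> = min (\<kappa> / 2) (\<kappa> / (2 * real (k * m)))"
  have \<epsilon>: "\<epsilon> > 0" "\<epsilon> \<le> \<kappa> / 2" "real (k * m) * \<epsilon> \<le> \<kappa> / 2"
  proof -
    show "\<epsilon> > 0" unfolding \<epsilon>_def using \<kappa> km by (metis divide_pos_pos half_gt_zero min_less_iff_conj mult_pos_pos zero_less_numeral)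
    show "\<epsilon> \<le> \<kappa> / 2" by (simp add: \<epsilon>_def)
    have "\<epsilon> \<le> \<kappa> / (2 * real (k * m))" by (simp add: \<epsilon>_def)
    then have "real (k * m) * \<epsilon> \<le> real (k * m) * (\<kappa> / (2 * real (k * m)))"
      using km by (intro mult_left_mono) auto
    also have "\<dots> = \<kappa> / 2"
    proof -
      have "q * (\<kappa> / (2 * q)) = \<kappa> / 2" if "q > 0" for q :: real using that by simp
      then show ?thesis using km .
    qed
    finally show "real (k * m) * \<epsilon> \<le> \<kappa> / 2" .
  qed
  from global[rule_format, OF \<epsilon>(1)] obtain N2 where N2: "\<forall>G. opt G \<and> card (verts G) \<ge> N2 \<longrightarrow>
    (\<exists>c. c ` verts G \<subseteq> {..<k} \<and> (\<forall>i<k. \<kappa> * card (verts G) \<le> real (card (colour_class (verts G) c i))) \<and>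
      (\<forall>v\<in>verts G. real (card (non_neighbours G (verts G) c v)) \<le> \<epsilon> * card (verts G)))" ..
  from g_linear_approx[of "W + b"] obtain K where K: "K \<ge> 0" and lin: "\<forall>n d D. 1 \<le> n \<longrightarrow> d \<le> n \<longrightarrow> D \<le> n \<longrightarrow>
     \<bar>real d - real D\<bar> \<le> real (W + b) \<longrightarrow>
     \<bar>g d - g D - (real d - real D) * (real (Suc s) * real D ^ s)\<bar> \<le> K * real n ^ s / real n"
    by (elim exE conjE)
  define N where "N = N1 + N2 + 2 * b * k + nat \<lceil>2 * (real (k * m) + real m) / \<kappa>\<rceil>
     + nat \<lceil>real (W + b) * K / \<kappa> ^ s\<rceil> + 1"
  show ?thesis
  proof (intro exI[of _ N] allI impI, elim conjE)
    fix G assume G: "opt G" and N: "N \<le> card (verts G)"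
    define n where "n = card (verts G)"
    define S where "S = verts G"
    have uG: "ugraph G" and finS: "finite S" using G opt_ugraph opt_finite by (auto simp: S_def)
    have n: "n \<ge> N1" "n \<ge> N2" "n \<ge> 2 * b * k" "n \<ge> 1" using N by (auto simp: N_def n_def)
    have nm: "2 * (real (k * m) + real m) \<le> \<kappa> * real n"
    proof -
      have "real n \<ge> 2 * (real (k * m) + real m) / \<kappa>" using N unfolding N_def n_def by linarith
      then show ?thesis using \<kappa> by (simp add: field_simps)
    qed
    have nW: "real (W + b) * K < \<kappa> ^ s * real n"
    proof -
      have "real n > real (W + b) * K / \<kappa> ^ s" using N unfolding N_def n_def by linarith
      then show ?thesis using \<kappa> by (simp add: field_simps)
    qed
    have "\<exists>c. c ` verts G \<subseteq> {..<k} \<and> (\<forall>i<k. \<kappa> * card (verts G) \<le> real (card (colour_class (verts G) c i))) \<and>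
      (\<forall>v\<in>verts G. real (card (non_neighbours G (verts G) c v)) \<le> \<epsilon> * card (verts G))"
      by (rule N2[rule_format]) (use G n in \<open>simp add: n_def\<close>)
    then obtain c where S_col: "c ` S \<subseteq> {..<k}" and cl_ge: "\<forall>i<k. \<kappa> * real n \<le> real (card (colour_class S c i))"
      and S_few: "\<forall>v\<in>S. real (card (non_neighbours G S c v)) \<le> \<epsilon> * real n"
      unfolding n_def S_def by (elim exE conjE)
    define z where "z = nat \<lfloor>\<epsilon> * real n\<rfloor>"
    have z: "real z \<le> \<epsilon> * real n" using \<epsilon> by (simp add: z_def)
    interpret near_multipartite Free k b h m0 G c m z
    proof
      show "ugraph G" "Free G" using G by (auto simp: opt_def)
      show "c ` verts G \<subseteq> {..<k}" using S_col by (simp add: S_def)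
      show "card (non_neighbours G (verts G) c v) \<le> z" if "v \<in> verts G" for v
      proof -
        have "real (card (non_neighbours G (verts G) c v)) \<le> \<epsilon> * real n" using S_few that by (simp add: S_def)
        then show ?thesis unfolding z_def by linarith
      qed
      show "k * m * (z + 1) + m \<le> card (colour_class (verts G) c i)" if "i < k" for i
      proof -
        have "real (k * m * (z + 1) + m) = real (k * m) * real z + (real (k * m) + real m)"
          by (simp add: algebra_simps)
        also have "\<dots> \<le> real (k * m) * (\<epsilon> * real n) + (real (k * m) + real m)"
          using z by (intro add_mono mult_left_mono order_refl) auto
        also have "\<dots> = (real (k * m) * \<epsilon>) * real n + (real (k * m) + real m)" by (simp only: mult.assoc)
        also have "\<dots> \<le> \<kappa> / 2 * real n + (real (k * m) + real m)"
          using \<epsilon>(3) by (intro add_mono mult_right_mono order_refl) auto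
        also have "\<dots> \<le> \<kappa> * real n" using nm by (simp add: field_simps)
        also have "\<dots> \<le> real (card (colour_class (verts G) c i))" using cl_ge that by (simp add: S_def)
        finally show ?thesis by linarith
      qed
      show "m0 \<le> m" "2 * (b + 1) \<le> m" using m by auto
    qed
    have finIM: "finite I" "finite M" using fin by auto
    define D where "D v = n - card (colour_class S c (c v))" for v
    define ins where "ins v = card {e \<in> I. v \<in> e}" for v
    define mis where "mis v = card {e \<in> M. v \<in> e}" for v
    have deg: "degree G v + mis v = D v + ins v" if "v \<in> S" for v
      using degree_identity[of v] that by (simp add: mis_def D_def ins_def S_def n_def)
    have Dn: "D v \<le> n" and degn: "degree G v \<le> n" for v
      using degree_le[OF uG, of v] by (simp_all add: D_def n_def)
    have D_ge: "\<kappa> * real n \<le> real (D v)" if "v \<in> S" for v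
    proof -
      \<comment> \<open>Any second class will do, and one exists because \<open>k \<ge> 2\<close>;
        its \<open>\<kappa> * n\<close> vertices all count towards \<open>D v\<close>.\<close>
      define j where "j = (if c v = 0 then 1 else 0 :: nat)"
      have j: "j < k" "j \<noteq> c v" using k_ge_2 by (auto simp: j_def)
      have "colour_class S c j \<subseteq> S - colour_class S c (c v)" using j(2) by (auto simp: colour_class_def)
      then have "card (colour_class S c j) \<le> card (S - colour_class S c (c v))" using finS by (intro card_mono) auto
      also have "\<dots> = D v" unfolding D_def n_def S_def[symmetric]
        using finS by (intro card_Diff_subset) (auto simp: colour_class_def)
      finally have "real (card (colour_class S c j)) \<le> real (D v)" by simp
      moreover have "\<kappa> * real n \<le> real (card (colour_class S c j))" using cl_ge j(1) by blast
      ultimately show ?thesis by linarith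
    qed
    have mis_le: "real (mis v) \<le> \<alpha> * real n" if "v \<in> S" for v
    proof -
      have "real (mis v) \<le> real z" using card_M_at_le that by (simp add: mis_def S_def)
      also have "\<dots> \<le> \<epsilon> * real n" by (rule z)
      also have "\<dots> \<le> \<alpha> * real n" using \<epsilon>(2) unfolding \<alpha>_def by (intro mult_right_mono) auto
      finally show ?thesis .
    qed
    have fK: "(\<Sum>v\<in>S. g (D v)) \<le> (\<Sum>v\<in>S. g (degree G v))"
      using opt_ge_cross_edges[OF G, of c] n(3) S_col unfolding D_def n_def S_def degree_sum_def by simp
    have sum_ins: "(\<Sum>v\<in>S. real (ins v)) = 2 * real (card I)" and sum_mis: "(\<Sum>v\<in>S. real (mis v)) = 2 * real (card M)"
      using sum_incidences[OF finS finIM(1), of "\<lambda>_. 1"] sum_incidences[OF finS finIM(2), of "\<lambda>_. 1"]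
        I_sub M_sub I_card M_card by (simp_all add: ins_def mis_def S_def)
    \<comment> \<open>The change passes through \<open>D v - mis v\<close>, which is still at least
      \<open>\<alpha> * n\<close>; there the lower bound on increments applies to the deleted
      pairs.\<close>
    have pointwise: "g (degree G v) - g (D v) \<le> real (ins v) * (L * real n ^ s) - real (mis v) * (\<nu> * real n ^ s)" if v: "v \<in> S" for v
    proof -
      have "\<alpha> * real n \<le> real (D v) - real (mis v)"
      proof -
        have "\<kappa> * real n = \<alpha> * real n + \<alpha> * real n" by (simp add: \<alpha>_def)
        then show ?thesis using D_ge[OF v] mis_le[OF v] by linarith
      qed
      moreover have "0 \<le> \<alpha> * real n" using \<alpha> by simp
      ultimately have le: "mis v \<le> D v" "\<alpha> * real n \<le> real (D v - mis v)" by linarith+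
      have "(real (D v) - real (D v - mis v)) * (\<nu> * real n ^ s) \<le> g (D v) - g (D v - mis v)"
        using le Dn by (intro N1[rule_format, OF n(1)]) auto
      moreover have "g (degree G v) - g (D v - mis v) \<le> (real (degree G v) - real (D v - mis v)) * (L * real n ^ s)"
        using deg[OF v] degn by (intro g_diff_le n(4)) auto
      moreover have "real (D v) - real (D v - mis v) = real (mis v)" "real (degree G v) - real (D v - mis v) = real (ins v)"
        using le(1) deg[OF v] by linarith+
      ultimately show ?thesis by simp
    qed
    have "0 \<le> (\<Sum>v\<in>S. g (degree G v) - g (D v))" using fK by (simp add: sum_subtractf)
    also have "\<dots> \<le> (\<Sum>v\<in>S. real (ins v) * (L * real n ^ s) - real (mis v) * (\<nu> * real n ^ s))"
      by (rule sum_mono[OF pointwise])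
    also have "\<dots> = 2 * real (card I) * (L * real n ^ s) - 2 * real (card M) * (\<nu> * real n ^ s)"
      by (simp only: sum_subtractf sum_distrib_right[symmetric] sum_ins sum_mis)
    finally have "(real (card M) * \<nu>) * real n ^ s \<le> (real (card I) * L) * real n ^ s" by (simp add: algebra_simps)
    moreover have npow: "real n ^ s > 0" using n(4) by simp
    ultimately have "real (card M) * \<nu> \<le> real (card I) * L" by (simp only: mult_le_cancel_right_pos)
    also have "\<dots> \<le> real (k * b) * L" using card_I_le L_pos by (intro mult_right_mono) (auto simp flip: of_nat_mult)
    finally have "real (card M) \<le> real (k * b) * L / \<nu>" using \<nu> by (simp add: field_simps)
    then have "card M \<le> Q" unfolding Q_def by linarith
    then have IMW: "card I + card M \<le> W" using card_I_le by (simp add: W_def)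
    then have small: "2 * (card I + card M) \<le> m" by (rule order_trans[OF mult_le_mono2 m(4)])
    \<comment> \<open>The first-order value of one end of an edge in class \<open>i\<close>: the
      derivative of the power function at the degree in the complete multipartite graph.\<close>
    define \<Gamma> where "\<Gamma> i = real (Suc s) * real (n - card (colour_class S c i)) ^ s" for i
    \<comment> \<open>With the minimum, an inside edge is worth exactly
      \<open>2 * \<gamma> e\<close>, its ends having one colour, and a missing pair costs at least
      \<open>2 * \<gamma> e\<close>. The condition \<theta> \<le> \<gamma> e means that all colours
      of \<open>e\<close> lie in a fixed set, as \<open>threshold_excess\<close> requires.\<close>
    define \<gamma> where "\<gamma> e = Min ((\<lambda>v. \<Gamma> (c v)) ` e)" for e
    have \<Gamma>D: "\<Gamma> (c v) = real (Suc s) * real (D v) ^ s" for v by (simp add: \<Gamma>_def D_def)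
    have "{..<k} \<noteq> {}" using k_ge_2 by (simp add: lessThan_empty_iff)
    then obtain i1 where i1: "i1 < k" "\<And>i. i < k \<Longrightarrow> \<Gamma> i \<le> \<Gamma> i1"
      using obtain_maximizer[of "{..<k}" \<Gamma>] by auto
    have fin_e: "finite e" "e \<noteq> {}" "e \<subseteq> S" if "e \<in> I \<union> M" for e
      using that I_card[of e] M_card[of e] I_sub[of e] M_sub[of e] card_gt_0_iff[of e] by (auto simp: S_def)
    have \<gamma>_ge: "\<theta> \<le> \<gamma> e \<longleftrightarrow> (\<forall>v\<in>e. \<theta> \<le> \<Gamma> (c v))" if "e \<in> I \<union> M" for e \<theta>
      unfolding \<gamma>_def using fin_e[OF that] by (subst Min_ge_iff) auto
    define x where "x = real (Suc s) * (\<kappa> * real n) ^ s"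
    have x_le: "x \<le> \<Gamma> (c v)" if "v \<in> S" for v
      unfolding x_def \<Gamma>D using D_ge[OF that] \<kappa> by (intro mult_left_mono power_mono) auto
    have x0: "0 \<le> x" using \<kappa> by (simp add: x_def)
    have \<gamma>_bounds: "x \<le> \<gamma> e \<and> \<gamma> e \<le> \<Gamma> i1" if "e \<in> I \<union> M" for e
    proof
      show "x \<le> \<gamma> e" using \<gamma>_ge[OF that] fin_e(3)[OF that] x_le by blast
      have "e \<noteq> {}" by (rule fin_e(2)[OF that])
      then obtain v where v: "v \<in> e" by blast
      then have "\<gamma> e \<le> \<Gamma> (c v)" using \<gamma>_ge[OF that, of "\<gamma> e"] by simp
      moreover have "c v < k" using v fin_e(3)[OF that] S_col by auto
      ultimately show "\<gamma> e \<le> \<Gamma> i1" using i1(2) by (meson order_trans)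
    qed
    have IM: "I \<inter> M = {}" by (auto simp: I_def M_def)
    define a :: "nat set \<Rightarrow> real" where "a e = (if e \<in> I then 1 else - 1)" for e
    have sum_a: "(\<Sum>e\<in>I \<union> M. a e * w e) = (\<Sum>e\<in>I. w e) - (\<Sum>e\<in>M. w e)" for w :: "nat set \<Rightarrow> real"
    proof -
      have "(\<Sum>e\<in>M. a e * w e) = (\<Sum>e\<in>M. - w e)"
        using IM by (intro sum.cong) (auto simp: a_def)
      moreover have "(\<Sum>e\<in>I. a e * w e) = (\<Sum>e\<in>I. w e)" by (simp add: a_def)
      ultimately show ?thesis using finIM IM by (simp add: sum.union_disjoint sum_negf)
    qed
    have threshold: "(\<Sum>e | e \<in> I \<union> M \<and> \<theta> \<le> \<gamma> e. a e) \<le> real b" for \<theta>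
    proof -
      define T where "T = {i. \<theta> \<le> \<Gamma> i}"
      have T: "\<theta> \<le> \<gamma> e \<longleftrightarrow> c ` e \<subseteq> T" if "e \<in> I \<union> M" for e using \<gamma>_ge[OF that] by (auto simp: T_def)
      have "{e. e \<in> I \<union> M \<and> \<theta> \<le> \<gamma> e} = {e \<in> I. c ` e \<subseteq> T} \<union> {e \<in> M. c ` e \<subseteq> T}" using T by auto
      moreover have "{e \<in> I. c ` e \<subseteq> T} \<inter> {e \<in> M. c ` e \<subseteq> T} = {}" using IM by auto
      ultimately have "(\<Sum>e | e \<in> I \<union> M \<and> \<theta> \<le> \<gamma> e. a e) = (\<Sum>e | e \<in> I \<and> c ` e \<subseteq> T. a e) + (\<Sum>e | e \<in> M \<and> c ` e \<subseteq> T. a e)"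
        using finIM by (simp add: sum.union_disjoint)
      also have "(\<Sum>e | e \<in> I \<and> c ` e \<subseteq> T. a e) = real (card {e \<in> I. c ` e \<subseteq> T})" by (simp add: a_def)
      also have "(\<Sum>e | e \<in> M \<and> c ` e \<subseteq> T. a e) = (\<Sum>e | e \<in> M \<and> c ` e \<subseteq> T. - 1)"
        using IM by (intro sum.cong) (auto simp: a_def)
      also have "\<dots> = - real (card {e \<in> M. c ` e \<subseteq> T})" by simp
      finally show ?thesis using threshold_excess[OF small, of T] by linarith
    qed
    have total: "(\<Sum>e\<in>I \<union> M. a e) = real (card I) - real (card M)" using sum_a[of "\<lambda>_. 1"] by simp
    have le_b: "card I \<le> card M + b"
      using threshold_excess[OF small, of UNIV] by simp
    have eq: "card I = card M + b"
    \<comment> \<open>With an excess below \<open>b\<close>, the weighted sum falls short of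
      \<open>b * \<Gamma> i1\<close> by at least \<open>x\<close>. Counting both ends, the
      competitor with \<open>b\<close> edges added in the heaviest class beats \<open>G\<close> by
      \<open>2 * x\<close> up to errors, where \<open>x\<close> has order n^s and the errors have
      order n^(s-1).\<close>
    proof (rule ccontr)
      assume "card I \<noteq> card M + b"
      then have "(\<Sum>e\<in>I \<union> M. a e) \<le> real b - 1" using le_b total by linarith
      then have "(\<Sum>e\<in>I \<union> M. a e * \<gamma> e) \<le> real b * \<Gamma> i1 - x"
      proof (rule sum_threshold_less[rotated 6])
        obtain v where "v \<in> S" using n(4) unfolding n_def S_def by (metis card.empty ex_in_conv not_one_le_zero)
        then have "x \<le> \<Gamma> (c v)" "c v < k" using x_le S_col by auto
        then show "x \<le> \<Gamma> i1" using i1(2) by (meson order_trans)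
      qed (use finIM \<gamma>_bounds x0 threshold in auto)
      then have weights: "(\<Sum>e\<in>I. \<gamma> e) - (\<Sum>e\<in>M. \<gamma> e) \<le> real b * \<Gamma> i1 - x" unfolding sum_a .
      define err where "err = K * real n ^ s / real n"
      have err0: "0 \<le> err" using K by (simp add: err_def)
      \<comment> \<open>Outside \<open>Y\<close> the degrees equal \<open>D\<close> exactly, so the
        error \<open>err\<close> occurs only at boundedly many vertices instead of all
        \<open>n\<close>.\<close>
      define Y where "Y = \<Union>(I \<union> M)"
      have YV: "Y \<subseteq> S" unfolding Y_def S_def by (rule card_Union_IM(2)[OF small])
      have cY: "card Y \<le> 2 * W"
      proof -
        have "card Y \<le> 2 * card (I \<union> M)"
          unfolding Y_def using finIM I_card M_card by (intro card_Union_edges_le) auto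
        also have "\<dots> \<le> 2 * (card I + card M)" by (rule mult_le_mono2[OF card_Un_le])
        also have "\<dots> \<le> 2 * W" using IMW by (rule mult_le_mono2)
        finally show ?thesis .
      qed
      have approx: "g (degree G v) - g (D v) \<le> (real (ins v) - real (mis v)) * \<Gamma> (c v) + (if v \<in> Y then err else 0)" if v: "v \<in> S" for v
      proof (cases "v \<in> Y")
        case True
        have d: "real (degree G v) - real (D v) = real (ins v) - real (mis v)" using deg[OF v] by linarith
        have "ins v \<le> card I" "mis v \<le> card M"
          unfolding ins_def mis_def using finIM by (auto intro: card_mono)
        then have "\<bar>real (degree G v) - real (D v)\<bar> \<le> real (W + b)" unfolding d using IMW by linarith
        then have "\<bar>g (degree G v) - g (D v) - (real (degree G v) - real (D v)) * (real (Suc s) * real (D v) ^ s)\<bar> \<le> err"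
          unfolding err_def using lin n(4) degn Dn by blast
        then show ?thesis using True unfolding d \<Gamma>D by simp
      next
        case False
        then have "{e \<in> I. v \<in> e} = {}" "{e \<in> M. v \<in> e} = {}" by (auto simp: Y_def)
        then have "ins v = 0" "mis v = 0" by (simp_all only: ins_def mis_def card.empty)
        then show ?thesis using deg[OF v] False by simp
      qed
      have "(\<Sum>v\<in>S. g (degree G v) - g (D v)) \<le> (\<Sum>v\<in>S. (real (ins v) - real (mis v)) * \<Gamma> (c v) + (if v \<in> Y then err else 0))"
        by (rule sum_mono[OF approx])
      also have "\<dots> = (\<Sum>v\<in>S. real (ins v) * \<Gamma> (c v)) - (\<Sum>v\<in>S. real (mis v) * \<Gamma> (c v)) + real (card Y) * err"
      proof -
        have "S \<inter> {v. v \<in> Y} = Y" using YV by blast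
        then show ?thesis using finS by (simp add: sum.distrib sum_subtractf left_diff_distrib sum.If_cases)
      qed
      also have "(\<Sum>v\<in>S. real (ins v) * \<Gamma> (c v)) = (\<Sum>e\<in>I. \<Sum>v\<in>e. \<Gamma> (c v))"
        unfolding ins_def using finS finIM I_sub by (intro sum_incidences) (auto simp: S_def)
      also have "\<dots> = (\<Sum>e\<in>I. 2 * \<gamma> e)"
      proof (rule sum.cong)
        fix e assume "e \<in> I"
        then obtain u v where "e = {u, v}" "u \<noteq> v" "u \<in> S" "v \<in> S" "c u = c v"
          unfolding S_def by (rule I_cases)
        then show "(\<Sum>v\<in>e. \<Gamma> (c v)) = 2 * \<gamma> e" by (simp add: \<gamma>_def)
      qed simp
      also have "(\<Sum>v\<in>S. real (mis v) * \<Gamma> (c v)) = (\<Sum>e\<in>M. \<Sum>v\<in>e. \<Gamma> (c v))"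
        unfolding mis_def using finS finIM M_sub by (intro sum_incidences) (auto simp: S_def)
      finally have "(\<Sum>v\<in>S. g (degree G v) - g (D v)) \<le> (\<Sum>e\<in>I. 2 * \<gamma> e) - (\<Sum>e\<in>M. \<Sum>v\<in>e. \<Gamma> (c v)) + real (card Y) * err" .
      moreover have "(\<Sum>e\<in>M. 2 * \<gamma> e) \<le> (\<Sum>e\<in>M. \<Sum>v\<in>e. \<Gamma> (c v))"
      proof (rule sum_mono)
        fix e assume e: "e \<in> M"
        have "2 * \<gamma> e = (\<Sum>v\<in>e. \<gamma> e)" using M_card[OF e] by simp
        also have "\<dots> \<le> (\<Sum>v\<in>e. \<Gamma> (c v))"
          using \<gamma>_ge[of e "\<gamma> e"] e by (intro sum_mono) auto
        finally show "2 * \<gamma> e \<le> (\<Sum>v\<in>e. \<Gamma> (c v))" .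
      qed
      moreover have "real (card Y) * err \<le> real (2 * W) * err"
        by (rule mult_right_mono[OF of_nat_mono[OF cY] err0])
      ultimately have upper: "(\<Sum>v\<in>S. g (degree G v) - g (D v)) \<le> 2 * (real b * \<Gamma> i1 - x) + real (2 * W) * err"
        using weights by (simp add: sum_distrib_left[symmetric])
      have "real (2 * b) \<le> real (card (colour_class S c i1))"
      proof -
        have "real (2 * b) \<le> real m" using m(3) by simp
        also have "\<dots> \<le> real (card (colour_class S c i1))" using large[OF i1(1)] unfolding S_def by linarith
        finally show ?thesis .
      qed
      then have "2 * b \<le> card (colour_class S c i1)" by (simp only: of_nat_le_iff)
      \<comment> \<open>The competitor keeps the classes of \<open>G\<close>, misses no pair and has
        its \<open>b\<close> additional edges in the class of largest weight.\<close>
      then obtain I0 where I0: "card I0 = b" "\<forall>e\<in>I0. e \<subseteq> colour_class S c i1 \<and> card e = 2" "Free (S, cross_edges S c \<union> I0)"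
        using add_edges[OF finS S_col i1(1)] by blast
      have finI0: "finite I0"
      proof (rule finite_subset)
        show "I0 \<subseteq> Pow S" using I0(2) by (auto simp: colour_class_def)
      qed (use finS in simp)
      define G' where "G' = (S, cross_edges S c \<union> I0)"
      have uG': "ugraph G'"
        using ugraph_cross_edges[OF finS, of c] I0(2) unfolding G'_def ugraph_def by (auto simp: colour_class_def)
      have "degree_sum g G' \<le> degree_sum g G" using I0(3) by (intro opt_le[OF G uG']) (auto simp: G'_def S_def)
      define ins0 where "ins0 v = card {e \<in> I0. v \<in> e}" for v
      have disj: "cross_edges S c \<inter> I0 = {}"
      proof -
        have "e \<notin> cross_edges S c" if "e \<subseteq> colour_class S c i1" for e
          using that by (auto elim!: cross_edges_cases simp: colour_class_def)
        then show ?thesis using I0(2) by blast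
      qed
      have deg0: "degree G' v = D v + ins0 v" if "v \<in> S" for v
      proof -
        have "{e \<in> edges G'. v \<in> e} = {e \<in> cross_edges S c. v \<in> e} \<union> {e \<in> I0. v \<in> e}" by (auto simp: G'_def)
        moreover have "{e \<in> cross_edges S c. v \<in> e} \<inter> {e \<in> I0. v \<in> e} = {}" using disj by blast
        ultimately have "degree G' v = card {e \<in> cross_edges S c. v \<in> e} + ins0 v"
          unfolding degree_def ins0_def using finI0 finite_cross_edges[OF finS, of c] by (simp add: card_Un_disjoint)
        then show ?thesis using degree_cross_edges[OF finS that, of c] by (simp add: degree_def D_def n_def S_def)
      qed
      have deg0n: "degree G' v \<le> n" for v using degree_le[OF uG', of v] by (simp add: G'_def n_def S_def)
      define Y0 where "Y0 = \<Union>I0"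
      have cY0: "card Y0 \<le> 2 * b" unfolding Y0_def using card_Union_edges_le[OF finI0] I0(1,2) by simp
      have Y0V: "Y0 \<subseteq> S" unfolding Y0_def using I0(2) by (auto simp: colour_class_def)
      have approx0: "real (ins0 v) * \<Gamma> (c v) - (if v \<in> Y0 then err else 0) \<le> g (degree G' v) - g (D v)" if v: "v \<in> S" for v
      proof (cases "v \<in> Y0")
        case True
        have d: "real (degree G' v) - real (D v) = real (ins0 v)" using deg0[OF v] by simp
        have "ins0 v \<le> card I0" unfolding ins0_def using finI0 by (auto intro: card_mono)
        then have "\<bar>real (degree G' v) - real (D v)\<bar> \<le> real (W + b)" unfolding d using I0(1) by simp
        then have "\<bar>g (degree G' v) - g (D v) - (real (degree G' v) - real (D v)) * (real (Suc s) * real (D v) ^ s)\<bar> \<le> err"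
          unfolding err_def using lin n(4) deg0n Dn by blast
        then show ?thesis using True unfolding d \<Gamma>D by simp
      next
        case False
        then have "{e \<in> I0. v \<in> e} = {}" by (auto simp: Y0_def)
        then have "ins0 v = 0" by (simp only: ins0_def card.empty)
        then show ?thesis using deg0[OF v] False by simp
      qed
      have "(\<Sum>v\<in>S. real (ins0 v) * \<Gamma> (c v)) - real (card Y0) * err = (\<Sum>v\<in>S. real (ins0 v) * \<Gamma> (c v) - (if v \<in> Y0 then err else 0))"
      proof -
        have "S \<inter> {v. v \<in> Y0} = Y0" using Y0V by blast
        then show ?thesis using finS by (simp add: sum_subtractf sum.If_cases)
      qed
      also have "\<dots> \<le> (\<Sum>v\<in>S. g (degree G' v) - g (D v))" by (rule sum_mono[OF approx0])
      also have "\<dots> \<le> (\<Sum>v\<in>S. g (degree G v) - g (D v))"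
        using \<open>degree_sum g G' \<le> degree_sum g G\<close> by (simp add: degree_sum_def G'_def S_def sum_subtractf)
      also have "(\<Sum>v\<in>S. real (ins0 v) * \<Gamma> (c v)) = (\<Sum>e\<in>I0. \<Sum>v\<in>e. \<Gamma> (c v))"
        unfolding ins0_def using finS finI0 I0(2) by (intro sum_incidences) (auto simp: colour_class_def)
      also have "\<dots> = (\<Sum>e\<in>I0. 2 * \<Gamma> i1)"
      proof (rule sum.cong)
        fix e assume e: "e \<in> I0"
        then have "(\<Sum>v\<in>e. \<Gamma> (c v)) = (\<Sum>v\<in>e. \<Gamma> i1)" using I0(2) by (intro sum.cong) (auto simp: colour_class_def)
        then show "(\<Sum>v\<in>e. \<Gamma> (c v)) = 2 * \<Gamma> i1" using I0(2) e by simp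
      qed simp
      finally have "2 * real b * \<Gamma> i1 - real (card Y0) * err \<le> (\<Sum>v\<in>S. g (degree G v) - g (D v))"
        using I0(1) by simp
      moreover have "real (card Y0) * err \<le> real (2 * b) * err"
        by (rule mult_right_mono[OF of_nat_mono[OF cY0] err0])
      ultimately have "2 * real b * \<Gamma> i1 - real (2 * b) * err \<le> 2 * (real b * \<Gamma> i1 - x) + real (2 * W) * err"
        using upper by linarith
      then have "x \<le> real (W + b) * err" by (simp add: algebra_simps)
      moreover have "(\<kappa> * real n) ^ s \<le> x" unfolding x_def using \<kappa> by (simp add: algebra_simps)
      ultimately have "\<kappa> ^ s * real n ^ s \<le> real (W + b) * K * real n ^ s / real n"
        by (simp add: err_def power_mult_distrib)
      then have "(\<kappa> ^ s * real n) * real n ^ s \<le> (real (W + b) * K) * real n ^ s"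
        using n(4) by (simp add: field_simps)
      then have "\<kappa> ^ s * real n \<le> real (W + b) * K" using npow by (simp only: mult_le_cancel_right_pos)
      then show False using nW by linarith
    qed
    have "\<exists>B. \<Union>(I \<union> M) \<subseteq> B \<and> B \<subseteq> verts G \<and> (\<forall>i<k. card (colour_class B c i) = m) \<and>
      card {e \<in> edges G. e \<subseteq> B} + card M = card (cross_edges B c) + card I"
      by (rule balanced_superset[OF small]) blast
    then obtain B where B: "\<Union>(I \<union> M) \<subseteq> B" "B \<subseteq> verts G" "\<forall>i<k. card (colour_class B c i) = m"
      "card {e \<in> edges G. e \<subseteq> B} + card M = card (cross_edges B c) + card I"
      by (elim exE conjE)
    show "\<exists>c m B. c ` verts G \<subseteq> {..<k} \<and> m \<ge> m1 \<and> B \<subseteq> verts G \<and> (\<forall>i<k. card (colour_class B c i) = m) \<and>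
      card {e \<in> edges G. e \<subseteq> B} = card (cross_edges B c) + b \<and>
      \<Union>((edges G - cross_edges (verts G) c) \<union> (cross_edges (verts G) c - edges G)) \<subseteq> B \<and>
      card (edges G - cross_edges (verts G) c) + 2 < m"
    proof (intro exI[of _ c] exI[of _ m] exI[of _ B] conjI allI impI)
      show "card {e \<in> edges G. e \<subseteq> B} = card (cross_edges B c) + b" using B(4) eq by simp
      show "\<Union>((edges G - cross_edges (verts G) c) \<union> (cross_edges (verts G) c - edges G)) \<subseteq> B"
        using B(1) unfolding I_def M_def .
      show "card (edges G - cross_edges (verts G) c) + 2 < m" using card_I_le m(5) unfolding I_def by linarith
    qed (use S_col B m in \<open>auto simp: S_def\<close>)
  qed
qed

end

section \<open>Copies, colourings and stars\<close>

text \<open>Copies as injective maps preserving edges, which compose and can be modified at single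
  vertices; for a \<open>ugraph\<close> this agrees with the existence of a subgraph copy.\<close>

definition embeds :: "'a ugraph \<Rightarrow> 'b ugraph \<Rightarrow> bool" where
  "embeds H G \<longleftrightarrow> (\<exists>f. inj_on f (verts H) \<and> f ` verts H \<subseteq> verts G \<and> (\<forall>e\<in>edges H. f ` e \<in> edges G))"

lemma copies_empty_iff:
  assumes "ugraph H"
  shows "copies H G = {} \<longleftrightarrow> \<not> embeds H G"
proof
  assume c: "copies H G = {}"
  show "\<not> embeds H G"
  proof
    assume "embeds H G"
    then obtain f where f: "inj_on f (verts H)" "f ` verts H \<subseteq> verts G" "\<forall>e\<in>edges H. f ` e \<in> edges G"
      by (auto simp: embeds_def)
    define X where "X = (f ` verts H, (\<lambda>e. f ` e) ` edges H)"
    have "ugraph X"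
      unfolding ugraph_def
    proof (intro conjI ballI)
      show "finite (verts X)" using assms by (simp add: X_def ugraph_finite)
      fix e assume "e \<in> edges X"
      then obtain e0 where e0: "e0 \<in> edges H" "e = f ` e0" by (auto simp: X_def)
      then have "e0 \<subseteq> verts H" "card e0 = 2" using assms by (auto simp: ugraph_def)
      then show "e \<subseteq> verts X" "card e = 2"
        using e0 f(1) by (auto simp: X_def card_image inj_on_subset)
    qed
    then have "X \<in> copies H G"
      using f unfolding copies_def subgraph_def graph_iso_def X_def
      by (auto simp: bij_betw_def intro!: exI[of _ f])
    then show False using c by simp
  qed
next
  assume n: "\<not> embeds H G"
  show "copies H G = {}"
  proof (rule ccontr)
    assume "copies H G \<noteq> {}"
    then obtain X f where X: "subgraph X G" "bij_betw f (verts H) (verts X)" "(\<lambda>e. f ` e) ` edges H = edges X"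
      by (auto simp: copies_def graph_iso_def)
    have "embeds H G"
      unfolding embeds_def
    proof (intro exI[of _ f] conjI ballI)
      show "inj_on f (verts H)" using X(2) by (rule bij_betw_imp_inj_on)
      show "f ` verts H \<subseteq> verts G" using X(1,2) by (simp add: bij_betw_def subgraph_def)
      fix e assume "e \<in> edges H"
      then have "f ` e \<in> edges X" using X(3) by blast
      then show "f ` e \<in> edges G" using X(1) by (auto simp: subgraph_def)
    qed
    with n show False by simp
  qed
qed

lemma free_of_iff: "\<forall>H\<in>\<F>. ugraph H \<Longrightarrow> free_of \<F> G \<longleftrightarrow> (\<forall>H\<in>\<F>. \<not> embeds H G)"
  unfolding free_of_def using copies_empty_iff by blast

lemma embeds_mono:
  assumes "embeds H G" "verts G \<subseteq> verts G'" "edges G \<subseteq> edges G'"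
  shows "embeds H G'"
proof -
  obtain f where f: "inj_on f (verts H)" "f ` verts H \<subseteq> verts G" "\<forall>e\<in>edges H. f ` e \<in> edges G"
    using assms(1) by (auto simp: embeds_def)
  have "f ` verts H \<subseteq> verts G'" using f(2) assms(2) by (rule order_trans)
  moreover have "\<forall>e\<in>edges H. f ` e \<in> edges G'" using f(3) assms(3) by blast
  ultimately show ?thesis unfolding embeds_def using f(1) by blast
qed

text \<open>Isolated vertices of \<open>D\<close> can be placed anywhere, so only the number of vertices matters.\<close>

lemma embeds_same_edges:
  assumes D: "ugraph D" and H: "ugraph H" and eq: "edges H' = edges H"
    and large: "card (verts D) \<le> card (verts H)" and emb: "embeds D H'"
  shows "embeds D H"
proof -
  obtain f where f: "inj_on f (verts D)" "\<forall>e\<in>edges D. f ` e \<in> edges H"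
    using emb eq by (auto simp: embeds_def)
  define S where "S = \<Union>(edges D)"
  have S: "S \<subseteq> verts D" using D by (auto simp: S_def ugraph_def)
  have fin: "finite (verts D)" "finite (verts H)" using D H ugraph_finite by blast+
  have fS: "f ` S \<subseteq> verts H"
  proof
    fix y assume "y \<in> f ` S"
    then obtain e where "e \<in> edges D" "y \<in> f ` e" by (auto simp: S_def)
    then show "y \<in> verts H" using f(2) H unfolding ugraph_def by blast
  qed
  have finS: "finite S" using S fin(1) finite_subset by blast
  have "card (verts D - S) \<le> card (verts H - f ` S)"
  proof -
    have "card (f ` S) = card S" using f(1) S by (intro card_image) (rule inj_on_subset)
    then show ?thesis using large finS S fS by (simp add: card_Diff_subset)
  qed
  then obtain g where g: "inj_on g (verts D - S)" "g ` (verts D - S) \<subseteq> verts H - f ` S"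
    using card_le_inj[of "verts D - S" "verts H - f ` S"] fin by blast
  define q where "q v = (if v \<in> S then f v else g v)" for v
  show ?thesis
    unfolding embeds_def
  proof (intro exI[of _ q] conjI ballI)
    show "inj_on q (verts D)"
    proof (rule inj_onI)
      fix x y assume xy: "x \<in> verts D" "y \<in> verts D" "q x = q y"
      have ne: "f x \<noteq> g y" if "x \<in> S" "y \<in> verts D - S" for x y using g(2) that by blast
      consider "x \<in> S" "y \<in> S" | "x \<in> S" "y \<notin> S" | "x \<notin> S" "y \<in> S" | "x \<notin> S" "y \<notin> S" by blast
      then show "x = y"
      proof cases
        case 1 then show ?thesis using xy inj_onD[OF f(1), of x y] by (simp add: q_def)
      next
        case 2 then show ?thesis using xy ne[of x y] by (simp add: q_def)
      next
        case 3 then show ?thesis using xy ne[of y x] by (simp add: q_def)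
      next
        case 4 then show ?thesis using xy inj_onD[OF g(1), of x y] by (simp add: q_def)
      qed
    qed
    show "q ` verts D \<subseteq> verts H" using fS g(2) by (auto simp: q_def)
    fix e assume e: "e \<in> edges D"
    then have "q ` e = f ` e" by (intro image_cong) (auto simp: q_def S_def)
    then show "q ` e \<in> edges H" using f(2) e by simp
  qed
qed

text \<open>Used to pass from a class of a balanced subgraph to a whole part of the graph: the added
  edges stay the same while the vertex set changes.\<close>

lemma free_of_same_edges:
  assumes "\<forall>D\<in>\<F>. ugraph D \<and> card (verts D) \<le> card (verts H)" "ugraph H" "edges H' = edges H"
    "free_of \<F> H"
  shows "free_of \<F> H'"
proof -
  have D: "\<forall>D\<in>\<F>. ugraph D" using assms(1) by blast
  show ?thesis
    unfolding free_of_iff[OF D] using assms embeds_same_edges free_of_iff[OF D] by blast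
qed

section \<open>Extremal numbers of families and their eventual values\<close>

lemma finite_card_edges_image: "finite ((\<lambda>G. card (edges G)) ` free_graphs n \<F>)"
proof (rule finite_subset)
  show "(\<lambda>G. card (edges G)) ` free_graphs n \<F> \<subseteq> {..2 ^ n}"
  proof
    fix x assume "x \<in> (\<lambda>G. card (edges G)) ` free_graphs n \<F>"
    then obtain G where "G \<in> free_graphs n \<F>" and x: "x = card (edges G)" by blast
    then have G: "ugraph G" "card (verts G) = n" by (simp_all add: free_graphs_def)
    have "edges G \<subseteq> Pow (verts G)" using G(1) by (auto simp: ugraph_def)
    then have "card (edges G) \<le> card (Pow (verts G))" using G(1) by (intro card_mono) (auto simp: ugraph_finite)
    then show "x \<in> {..2 ^ n}" using G x ugraph_finite[OF G(1)] by (simp add: card_Pow)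
  qed
qed simp

lemma card_edges_le_ex_family:
  "G \<in> free_graphs n \<F> \<Longrightarrow> card (edges G) \<le> ex_family n \<F>"
  unfolding ex_family_def by (intro Max_ge finite_card_edges_image imageI)

lemma empty_graph_free:
  assumes "\<forall>D\<in>\<F>. ugraph D \<and> edges D \<noteq> {}"
  shows "({..<n}, {}) \<in> free_graphs n \<F>"
proof -
  have "\<forall>D\<in>\<F>. ugraph D" using assms by blast
  then have "free_of \<F> ({..<n}, {})"
    using assms by (subst free_of_iff) (auto simp: embeds_def)
  then show ?thesis by (auto simp: free_graphs_def ugraph_def)
qed

lemma ex_family_attained:
  assumes "\<forall>D\<in>\<F>. ugraph D \<and> edges D \<noteq> {}"
  obtains G where "G \<in> free_graphs n \<F>" "card (edges G) = ex_family n \<F>"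
proof -
  have "ex_family n \<F> \<in> (\<lambda>G. card (edges G)) ` free_graphs n \<F>"
    unfolding ex_family_def
    using empty_graph_free[OF assms] by (intro Max_in finite_card_edges_image) blast
  then show ?thesis using that by auto
qed

text \<open>Add an isolated vertex to an extremal graph. A copy could use it only for an isolated
  vertex of \<open>D\<close>, and the \<open>n\<close> old vertices already have room for
  that.\<close>

lemma ex_family_mono_Suc:
  assumes "\<forall>D\<in>\<F>. ugraph D \<and> edges D \<noteq> {} \<and> card (verts D) \<le> n"
  shows "ex_family n \<F> \<le> ex_family (Suc n) \<F>"
proof -
  have "\<forall>D\<in>\<F>. ugraph D \<and> edges D \<noteq> {}" using assms by blast
  then obtain G where G: "G \<in> free_graphs n \<F>" "card (edges G) = ex_family n \<F>"
    by (rule ex_family_attained)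
  then have uG: "ugraph G" "card (verts G) = n" "free_of \<F> G" by (auto simp: free_graphs_def)
  obtain x where x: "x \<notin> verts G" using ugraph_finite[OF uG(1)] ex_new_if_finite infinite_UNIV_nat by blast
  define G' where "G' = (insert x (verts G), edges G)"
  have "free_of \<F> G'"
    by (rule free_of_same_edges[OF _ uG(1) _ uG(3)]) (use assms uG in \<open>auto simp: G'_def\<close>)
  moreover have "ugraph G'" using uG(1) by (auto simp: G'_def ugraph_def)
  moreover have "card (verts G') = Suc n" using x uG ugraph_finite[OF uG(1)] by (simp add: G'_def)
  ultimately have "G' \<in> free_graphs (Suc n) \<F>" by (simp add: free_graphs_def)
  then have "card (edges G') \<le> ex_family (Suc n) \<F>" by (rule card_edges_le_ex_family)
  then show ?thesis using G(2) by (simp add: G'_def)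
qed

lemma eventually_constant_if_mono_bounded:
  fixes f :: "nat \<Rightarrow> nat"
  assumes mono: "\<And>n. n \<ge> N0 \<Longrightarrow> f n \<le> f (Suc n)" and bound: "\<And>n. n \<ge> N0 \<Longrightarrow> f n \<le> C"
  shows "\<exists>b N. \<forall>n\<ge>N. f n = b"
proof -
  have fin: "finite (f ` {N0..})" by (rule finite_subset[of _ "{..C}"]) (use bound in auto)
  then have "Max (f ` {N0..}) \<in> f ` {N0..}" by (intro Max_in) auto
  then obtain N where N: "N \<ge> N0" "f N = Max (f ` {N0..})" by auto
  have "f n = f N" if "n \<ge> N" for n
  proof (rule antisym)
    show "f n \<le> f N" unfolding N(2) using fin N(1) that by (intro Max_ge) auto
    show "f N \<le> f n" using that
    proof (induction n rule: dec_induct)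
      case (step n)
      then show ?case using mono[of n] N(1) by simp
    qed simp
  qed
  then show ?thesis by blast
qed

section \<open>Chromatic number and decomposition family\<close>

lemma proper_colouring_exists:
  assumes "ugraph F"
  shows "\<exists>c. proper_colouring F (chromatic_number F) c"
proof -
  obtain f where f: "bij_betw f (verts F) {0..<card (verts F)}"
    using ex_bij_betw_finite_nat[OF ugraph_finite[OF assms]] by blast
  have "proper_colouring F (card (verts F)) f"
    unfolding proper_colouring_def
  proof (intro conjI allI impI)
    show "f ` verts F \<subseteq> {..<card (verts F)}" using f by (auto simp: bij_betw_def)
    fix u v assume "{u, v} \<in> edges F"
    then have "u \<in> verts F" "v \<in> verts F" "u \<noteq> v" using ugraph_edgeD[OF assms] by auto
    then show "f u \<noteq> f v" using f by (auto simp: bij_betw_def inj_on_def)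
  qed
  then have "\<exists>k c. proper_colouring F k c" by blast
  then show ?thesis unfolding chromatic_number_def by (rule LeastI_ex)
qed

lemma chromatic_number_le: "proper_colouring F k c \<Longrightarrow> chromatic_number F \<le> k"
  unfolding chromatic_number_def by (rule Least_le) blast

text \<open>Otherwise the two classes could be merged, giving a proper colouring with one colour
  fewer.\<close>

lemma edges_between_colour_classes:
  assumes c: "proper_colouring F (chromatic_number F) c"
    and ij: "i < chromatic_number F" "j < chromatic_number F" "i \<noteq> j"
  shows "\<exists>u v. {u, v} \<in> edges F \<and> c u = i \<and> c v = j"
proof (rule ccontr)
  assume none: "\<not> ?thesis"
  define k where "k = chromatic_number F - 1"
  have k: "chromatic_number F = Suc k" using ij by (simp add: k_def)
  \<comment> \<open>\<open>p\<close> merges colour \<open>j\<close> into \<open>i\<close>, and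
    \<open>q\<close> moves the top colour \<open>k\<close> to the freed \<open>j\<close>, so that
    the remaining colours are again an initial segment.\<close>
  define p where "p v = (if c v = j then i else c v)" for v
  define q where "q v = (if p v = k then j else p v)" for v
  have p_ne: "p v \<noteq> j" for v using ij(3) by (simp add: p_def)
  have "proper_colouring F k q"
    unfolding proper_colouring_def
  proof (intro conjI allI impI)
    show "q ` verts F \<subseteq> {..<k}"
    proof
      fix x assume "x \<in> q ` verts F"
      then obtain v where v: "v \<in> verts F" "x = q v" by auto
      then have "c v < Suc k" using c k by (auto simp: proper_colouring_def)
      then have "p v < Suc k" using ij(1) k by (simp add: p_def)
      then show "x \<in> {..<k}" using v p_ne[of v] ij(2) k by (auto simp: q_def)
    qed
    fix u v assume e: "{u, v} \<in> edges F"
    then have "c u \<noteq> c v" using c by (simp add: proper_colouring_def)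
    moreover have "\<not> (c u = i \<and> c v = j)" "\<not> (c v = i \<and> c u = j)"
      using none e by (auto simp: insert_commute)
    ultimately have "p u \<noteq> p v" by (auto simp: p_def)
    then show "q u \<noteq> q v" using p_ne by (auto simp: q_def)
  qed
  then show False using chromatic_number_le[of F k q] k by simp
qed

text \<open>Members have an edge, so edgeless graphs are free of them and the maximum defining
  \<open>biex\<close> is attained; the bound on their order is what makes isolated vertices
  harmless.\<close>

lemma decomposition_family_props:
  assumes F: "ugraph F" and D: "D \<in> decomposition_family F"
  shows "ugraph D" "edges D \<noteq> {}" "card (verts D) \<le> card (verts F)"
proof -
  obtain c i j where D: "D = induced F {v \<in> verts F. c v = i \<or> c v = j}"
    and c: "proper_colouring F (chromatic_number F) c"
    and ij: "i < chromatic_number F" "j < chromatic_number F" "i \<noteq> j"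
    using D by (auto simp: decomposition_family_def)
  show "ugraph D" using F by (auto simp: D induced_def ugraph_def)
  obtain u v where "{u, v} \<in> edges F" "c u = i" "c v = j" using edges_between_colour_classes[OF c ij] by blast
  moreover from this have "u \<in> verts F" "v \<in> verts F" using ugraph_edgeD[OF F] by auto
  ultimately have "{u, v} \<in> edges D" by (auto simp: D induced_def)
  then show "edges D \<noteq> {}" by blast
  show "card (verts D) \<le> card (verts F)"
    using ugraph_finite[OF F] by (auto simp: D induced_def intro: card_mono)
qed

lemma edges_nonempty_if_chromatic_number:
  assumes "ugraph F" "chromatic_number F \<ge> 2"
  shows "edges F \<noteq> {}"
proof -
  obtain c where c: "proper_colouring F (chromatic_number F) c" using proper_colouring_exists[OF assms(1)] by blast
  show ?thesis using edges_between_colour_classes[OF c, of 0 1] assms(2) by auto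
qed

lemma biex_eventually_constant:
  assumes F: "ugraph F" and O: "(\<lambda>n. real (biex n F)) \<in> O(\<lambda>_. 1)"
  shows "\<exists>b N. \<forall>n\<ge>N. biex n F = b"
proof -
  obtain C where "eventually (\<lambda>n. norm (real (biex n F)) \<le> C * norm (1::real)) sequentially"
    using O by (elim landau_o.bigE)
  then obtain N1 where N1: "\<And>n. n \<ge> N1 \<Longrightarrow> real (biex n F) \<le> C"
    by (auto simp: eventually_sequentially)
  show ?thesis
  proof (rule eventually_constant_if_mono_bounded[of "N1 + card (verts F)"])
    fix n assume n: "N1 + card (verts F) \<le> n"
    show "biex n F \<le> biex (Suc n) F"
      unfolding biex_def
      using decomposition_family_props[OF F] n by (intro ex_family_mono_Suc) fastforce
    show "biex n F \<le> nat \<lceil>C\<rceil>" using N1[of n] n by linarith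
  qed
qed

section \<open>Translation between partitions and colourings\<close>

lemma complete_partite_colouring:
  assumes "complete_partite k P K"
  shows "\<exists>c. c ` verts K \<subseteq> {..<k} \<and> edges K = cross_edges (verts K) c \<and> (\<forall>i<k. colour_class (verts K) c i \<in> P) \<and>
    (\<forall>A\<in>P. \<exists>i<k. A = colour_class (verts K) c i)"
proof -
  have K: "ugraph K" "partition_on (verts K) P" "card P = k" "edges K = multipartite_edges P"
    using assms by (auto simp: complete_partite_def)
  have finP: "finite P"
    using finite_elements[OF ugraph_finite[OF K(1)] K(2)] .
  obtain idx where idx: "bij_betw idx P {0..<k}" using ex_bij_betw_finite_nat[OF finP] K(3) by blast
  have U: "\<Union>P = verts K" using K(2) by (simp add: partition_on_def)
  have disj: "A = B" if "A \<in> P" "B \<in> P" "v \<in> A" "v \<in> B" for A B v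
    using K(2) that by (auto simp: partition_on_def disjoint_def)
  define part where "part v = (THE A. A \<in> P \<and> v \<in> A)" for v
  have part: "part v = A" if "A \<in> P" "v \<in> A" for A v
    unfolding part_def using that disj by (intro the_equality) auto
  define c where "c v = idx (part v)" for v
  have c: "c v = idx A" if "A \<in> P" "v \<in> A" for A v using part[OF that] by (simp add: c_def)
  have c_eq: "c u = c v \<longleftrightarrow> A = B" if "A \<in> P" "u \<in> A" "B \<in> P" "v \<in> B" for A B u v
    using c[OF that(1,2)] c[OF that(3,4)] idx that by (auto simp: bij_betw_def inj_on_def)
  have colour_class: "colour_class (verts K) c (idx A) = A" if A: "A \<in> P" for A
  proof (intro equalityI subsetI)
    fix v assume "v \<in> colour_class (verts K) c (idx A)"
    then have v: "v \<in> verts K" "c v = idx A" by (auto simp: colour_class_def)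
    then obtain B where B: "B \<in> P" "v \<in> B" using U by blast
    then have "idx B = idx A" using c v by simp
    then have "A = B" using idx A B by (auto simp: bij_betw_def inj_on_def)
    then show "v \<in> A" using B by simp
  next
    fix v assume "v \<in> A"
    then show "v \<in> colour_class (verts K) c (idx A)" using c[OF A] U A by (auto simp: colour_class_def)
  qed
  show ?thesis
  proof (intro exI[of _ c] conjI)
    show "c ` verts K \<subseteq> {..<k}"
    proof
      fix x assume "x \<in> c ` verts K"
      then obtain v A where "x = c v" "A \<in> P" "v \<in> A" using U by blast
      then show "x \<in> {..<k}" using c idx by (auto simp: bij_betw_def)
    qed
    show "edges K = cross_edges (verts K) c"
    proof (intro equalityI subsetI)
      fix e assume "e \<in> edges K"
      then obtain u v A B where "e = {u, v}" "A \<in> P" "B \<in> P" "A \<noteq> B" "u \<in> A" "v \<in> B"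
        unfolding K(4) multipartite_edges_def by blast
      then show "e \<in> cross_edges (verts K) c" using c_eq U by (auto simp: cross_edges_iff)
    next
      fix e assume "e \<in> cross_edges (verts K) c"
      then obtain u v where uv: "e = {u, v}" "u \<in> verts K" "v \<in> verts K" "c u \<noteq> c v" by (rule cross_edges_cases)
      then obtain A B where "A \<in> P" "u \<in> A" "B \<in> P" "v \<in> B" using U by blast
      moreover from this have "A \<noteq> B" using c_eq uv(4) by blast
      ultimately show "e \<in> edges K" unfolding K(4) multipartite_edges_def using uv(1) by blast
    qed
    show "\<forall>i<k. colour_class (verts K) c i \<in> P"
    proof (intro allI impI)
      fix i assume "i < k"
      then have "i \<in> idx ` P" using idx by (simp add: bij_betw_def)
      then obtain A where "A \<in> P" "idx A = i" by blast
      then show "colour_class (verts K) c i \<in> P" using colour_class by auto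
    qed
    show "\<forall>A\<in>P. \<exists>i<k. A = colour_class (verts K) c i"
    proof
      fix A assume A: "A \<in> P"
      then have "idx A < k" using idx by (auto simp: bij_betw_def)
      then show "\<exists>i<k. A = colour_class (verts K) c i" using colour_class[OF A] by blast
    qed
  qed
qed

lemma complete_partite_of_colouring:
  assumes "finite V" "c ` V \<subseteq> {..<k}" "\<And>i. i < k \<Longrightarrow> colour_class V c i \<noteq> {}"
  shows "complete_partite k (colour_class V c ` {..<k}) (V, cross_edges V c)"
  unfolding complete_partite_def
proof (intro conjI)
  show "ugraph (V, cross_edges V c)" by (rule ugraph_cross_edges[OF assms(1)])
  show "partition_on (verts (V, cross_edges V c)) (colour_class V c ` {..<k})"
  proof (rule partition_onI)
    show "\<Union>(colour_class V c ` {..<k}) = verts (V, cross_edges V c)" using assms(2) by (auto simp: colour_class_def)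
    show "{} \<notin> colour_class V c ` {..<k}" using assms(3) by fastforce
    show "disjnt p q" if "p \<in> colour_class V c ` {..<k}" "q \<in> colour_class V c ` {..<k}" "p \<noteq> q" for p q
      using that by (auto simp: colour_class_def disjnt_def)
  qed
  have "inj_on (colour_class V c) {..<k}"
  proof (rule inj_onI)
    fix i j assume "i \<in> {..<k}" "j \<in> {..<k}" "colour_class V c i = colour_class V c j"
    moreover from this obtain v where "v \<in> colour_class V c i" using assms(3) by blast
    ultimately show "i = j" by (auto simp: colour_class_def)
  qed
  then show "card (colour_class V c ` {..<k}) = k" by (simp add: card_image)
  show "edges (V, cross_edges V c) = multipartite_edges (colour_class V c ` {..<k})"
  proof (intro equalityI subsetI)
    fix e assume "e \<in> edges (V, cross_edges V c)"
    then obtain u v where "e = {u, v}" "u \<in> V" "v \<in> V" "c u \<noteq> c v" by (auto elim: cross_edges_cases)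
    moreover from this have "colour_class V c (c u) \<in> colour_class V c ` {..<k}" "colour_class V c (c v) \<in> colour_class V c ` {..<k}"
      "u \<in> colour_class V c (c u)" "v \<in> colour_class V c (c v)" "colour_class V c (c u) \<noteq> colour_class V c (c v)"
      using assms(2) by (auto simp: colour_class_def)
    ultimately show "e \<in> multipartite_edges (colour_class V c ` {..<k})" unfolding multipartite_edges_def by blast
  next
    fix e assume "e \<in> multipartite_edges (colour_class V c ` {..<k})"
    then obtain u v i j where "e = {u, v}" "colour_class V c i \<noteq> colour_class V c j" "u \<in> colour_class V c i" "v \<in> colour_class V c j"
      unfolding multipartite_edges_def by blast
    then show "e \<in> edges (V, cross_edges V c)" by (auto simp: cross_edges_iff colour_class_def)
  qed
qed

text \<open>With at least two leaves the centre is determined by the copy, so copies correspond to a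
  centre with a set of \<open>r\<close> neighbours. A single edge could be centred at either end,
  hence the separate treatment of \<open>r = 1\<close>.\<close>

lemma num_copies_star_ge_2:
  fixes G :: "'a ugraph"
  assumes G: "ugraph G" and r: "r \<ge> 2"
  shows "num_copies (star r) G = (\<Sum>v\<in>verts G. degree G v choose r)"
proof -
  define S where "S = (SIGMA v:verts G. {L. L \<subseteq> neighbours G v \<and> card L = r})"
  define \<phi> where "\<phi> = (\<lambda>(v :: 'a, L). (insert v L, (\<lambda>u. {v, u}) ` L))"
  have star_edges: "edges (star r) = (\<lambda>i. {0, i}) ` {1..r}" by (auto simp: star_def)
  have "bij_betw \<phi> S (copies (star r) G)"
    unfolding bij_betw_def
  proof
    show "inj_on \<phi> S"
    proof (rule inj_onI, clarify)
      fix v L v' L' assume S: "(v, L) \<in> S" "(v', L') \<in> S" and eq: "\<phi> (v, L) = \<phi> (v', L')"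
      have L: "v \<notin> L" "card L = r" and L': "v' \<notin> L'" using S not_self_neighbours[OF G] by (auto simp: S_def)
      have vs: "insert v L = insert v' L'" and es: "(\<lambda>u. {v, u}) ` L = (\<lambda>u. {v', u}) ` L'"
        using eq by (auto simp: \<phi>_def)
      have "v = v'"
      proof (rule ccontr)
        assume ne: "v \<noteq> v'"
        have "l = v'" if "l \<in> L" for l
        proof -
          have "{v, l} \<in> (\<lambda>u. {v', u}) ` L'" using es that by blast
          then show ?thesis using ne by (auto simp: doubleton_eq_iff)
        qed
        then have "L \<subseteq> {v'}" by blast
        then have "card L \<le> 1" using card_mono[of "{v'}" L] by simp
        then show False using L(2) r by simp
      qed
      moreover have "L = L'" using vs L(1) L' \<open>v = v'\<close> by auto
      ultimately show "v = v' \<and> L = L'" by simp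
    qed
    show "\<phi> ` S = copies (star r) G"
    proof (intro equalityI subsetI)
      fix X assume "X \<in> \<phi> ` S"
      then obtain v L where S: "(v, L) \<in> S" and X: "X = (insert v L, (\<lambda>u. {v, u}) ` L)" by (auto simp: \<phi>_def)
      have L: "v \<in> verts G" "L \<subseteq> neighbours G v" "card L = r" "v \<notin> L" using S not_self_neighbours[OF G] by (auto simp: S_def)
      have finL: "finite L" using L(2) finite_neighbours[OF G] finite_subset by blast
      obtain q where q: "bij_betw q {1..r} L" using finite_same_card_bij[OF _ finL, of "{1..r}"] L(3) by auto
      define f where "f = q(0 := v)"
      have fq: "f ` {1..r} = L" using q by (auto simp: f_def bij_betw_def)
      have set_eq: "{0..r} = insert 0 {1..r}" and diff: "{1..r} - {0} = {1..r}" by auto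
      have f0: "f 0 = v" by (simp add: f_def)
      have "inj_on f {1..r} = inj_on q {1..r}" by (rule inj_on_cong) (simp add: f_def)
      then have "inj_on f {1..r}" using q by (simp add: bij_betw_def)
      then have "bij_betw f {0..r} (insert v L)"
        unfolding bij_betw_def set_eq inj_on_insert image_insert diff fq f0 using L(4) by simp
      moreover have "(\<lambda>e. f ` e) ` edges (star r) = (\<lambda>u. {v, u}) ` L"
        unfolding star_edges fq[symmetric] by (auto simp: f_def image_image)
      ultimately have "graph_iso (star r) X" unfolding graph_iso_def X by (intro exI[of _ f]) (simp add: star_def)
      moreover have "ugraph X" using finL L(4) by (auto simp: ugraph_def X card_insert_if)
      moreover have "verts X \<subseteq> verts G" "edges X \<subseteq> edges G"
        using L neighbours_subset[OF G, of v] by (auto simp: X mem_neighbours)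
      ultimately show "X \<in> copies (star r) G" by (simp add: copies_def subgraph_def)
    next
      fix X assume "X \<in> copies (star r) G"
      then obtain f where X: "subgraph X G" and f: "bij_betw f (verts (star r)) (verts X)"
        "(\<lambda>e. f ` e) ` edges (star r) = edges X" by (auto simp: copies_def graph_iso_def)
      have f0: "bij_betw f {0..r} (verts X)" using f(1) by (simp add: star_def)
      have inj: "inj_on f {0..r}" using f0 by (simp add: bij_betw_def)
      define L where "L = f ` {1..r}"
      have "inj_on f {1..r}" using inj by (rule inj_on_subset) auto
      then have "card L = r" unfolding L_def by (simp add: card_image)
      have eX: "edges X = (\<lambda>u. {f 0, u}) ` L"
        using f(2) unfolding star_edges L_def by (auto simp: image_image)
      have "{0..r} = insert 0 {1..r}" by auto
      then have "f ` {0..r} = insert (f 0) L" by (simp add: L_def)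
      then have vX: "verts X = insert (f 0) L" using f0 by (simp add: bij_betw_def)
      have "(\<lambda>u. {f 0, u}) ` L \<subseteq> edges G" using X eX by (simp add: subgraph_def)
      then have "L \<subseteq> neighbours G (f 0)" unfolding neighbours_def by blast
      moreover have "f 0 \<in> verts G" using X vX by (auto simp: subgraph_def)
      ultimately have "(f 0, L) \<in> S" using \<open>card L = r\<close> by (simp add: S_def)
      moreover have "X = \<phi> (f 0, L)" using vX eX by (simp add: \<phi>_def prod_eq_iff)
      ultimately show "X \<in> \<phi> ` S" by blast
    qed
  qed
  then have "num_copies (star r) G = card S" unfolding num_copies_def by (metis bij_betw_same_card)
  also have "\<dots> = (\<Sum>v\<in>verts G. card {L. L \<subseteq> neighbours G v \<and> card L = r})"
  proof -
    have "finite {L. L \<subseteq> neighbours G v \<and> card L = r}" for v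
      by (rule finite_subset[of _ "Pow (neighbours G v)"]) (auto simp: finite_neighbours[OF G])
    then show ?thesis unfolding S_def using ugraph_finite[OF G] by simp
  qed
  also have "\<dots> = (\<Sum>v\<in>verts G. degree G v choose r)"
    using n_subsets[OF finite_neighbours[OF G]] degree_eq_card_neighbours[OF G] by simp
  finally show ?thesis .
qed

lemma num_copies_star_1:
  assumes G: "ugraph G"
  shows "num_copies (star 1) G = card (edges G)"
proof -
  have star: "star 1 = ({0..1}, {{0, 1}})" by (auto simp: star_def)
  have "bij_betw (\<lambda>e. (e, {e})) (edges G) (copies (star 1) G)"
    unfolding bij_betw_def
  proof
    show "inj_on (\<lambda>e. (e, {e})) (edges G)" by (auto simp: inj_on_def)
    show "(\<lambda>e. (e, {e})) ` edges G = copies (star 1) G"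
    proof (intro equalityI subsetI)
      fix X assume "X \<in> (\<lambda>e. (e, {e})) ` edges G"
      then obtain e where e: "e \<in> edges G" "X = (e, {e})" by auto
      then obtain u v where uv: "e = {u, v}" "u \<noteq> v" "u \<in> verts G" "v \<in> verts G"
        using ugraph_edge_cases[OF G] by metis
      define f where "f = (\<lambda>i::nat. if i = 0 then u else v)"
      have "{0..1} = {0, 1::nat}" by auto
      then have "graph_iso (star 1) X"
        unfolding graph_iso_def star e uv using uv(2)
        by (intro exI[of _ f]) (auto simp: f_def bij_betw_def)
      moreover have "ugraph X" using e uv by (auto simp: ugraph_def)
      ultimately show "X \<in> copies (star 1) G" using e uv by (simp add: copies_def subgraph_def)
    next
      fix X assume "X \<in> copies (star 1) G"
      then obtain f where X: "subgraph X G" and f: "bij_betw f {0..1::nat} (verts X)"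
        "(\<lambda>e. f ` e) ` {{0, 1}} = edges X" unfolding star copies_def graph_iso_def by auto
      have "{0..1} = {0, 1::nat}" by auto
      then have "verts X = {f 0, f 1}" using f(1) by (auto simp: bij_betw_def)
      moreover have "edges X = {{f 0, f 1}}" using f(2) by auto
      ultimately show "X \<in> (\<lambda>e. (e, {e})) ` edges G" using X by (auto simp: subgraph_def prod_eq_iff intro!: image_eqI[of _ _ "{f 0, f 1}"])
    qed
  qed
  then show ?thesis unfolding num_copies_def by (metis bij_betw_same_card)
qed

section \<open>The extremal graphs\<close>

text \<open>One threshold \<open>m0\<close> for both eventual hypotheses. It is at least the order
  of \<open>F\<close>, so that on vertex sets of that size freeness from the decomposition family
  depends on the edges only.\<close>

locale turan_extremal =
  fixes F :: "'a ugraph" and k b m0 :: nat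
  assumes F_ugraph: "ugraph F" and chi: "chromatic_number F = Suc k" and two_le_k: "k \<ge> 2"
    and biex_eq: "\<And>n. n \<ge> m0 \<Longrightarrow> biex n F = b" and m0_ge: "m0 \<ge> card (verts F)" "m0 \<ge> 1"
    and extremal: "\<And>n G. n \<ge> m0 \<Longrightarrow> G \<in> free_graphs n {F} \<Longrightarrow> card (edges G) = ex_edges n F \<Longrightarrow>
      \<exists>K P. turan n k P K \<and> add_in_part F (biex n F) K P G"
begin

lemma Free_iff: "free_of {F} G \<longleftrightarrow> \<not> embeds F G"
  using F_ugraph by (subst free_of_iff) auto

lemma m0_le: "m \<ge> m0 \<Longrightarrow> m0 \<le> k * m"
  using two_le_k by (metis One_nat_def Suc_1 Suc_leD le_trans mult_le_mono1 nat_mult_1)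

text \<open>At order \<open>k * m\<close> the Turan graph has all parts of size exactly
  \<open>m\<close>, since \<open>n / k\<close> is an integer.\<close>

lemma extremal_form:
  assumes m: "m \<ge> m0" and G: "G \<in> free_graphs (k * m) {F}" "card (edges G) = ex_edges (k * m) F"
  shows "\<exists>c i J. c ` verts G \<subseteq> {..<k} \<and> (\<forall>j<k. card (colour_class (verts G) c j) = m) \<and> i < k \<and>
    edges G = cross_edges (verts G) c \<union> J \<and> (\<forall>e\<in>J. e \<subseteq> colour_class (verts G) c i \<and> card e = 2) \<and> card J = b \<and>
    free_of (decomposition_family F) (colour_class (verts G) c i, J)"
proof -
  obtain K P where K: "turan (k * m) k P K" and add: "add_in_part F (biex (k * m) F) K P G"
    using extremal[OF m0_le[OF m] G] by blast
  have cp: "complete_partite k P K" using K by (simp add: turan_def)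
  obtain c where c: "c ` verts K \<subseteq> {..<k}" "edges K = cross_edges (verts K) c" "\<forall>i<k. colour_class (verts K) c i \<in> P"
    "\<forall>A\<in>P. \<exists>i<k. A = colour_class (verts K) c i"
    using complete_partite_colouring[OF cp] by blast
  obtain H where H: "ugraph H" "verts H \<in> P" "free_of (decomposition_family F) H"
    "card (edges H) = biex (k * m) F" "verts G = verts K" "edges G = edges K \<union> edges H"
    using add by (auto simp: add_in_part_def)
  obtain i where i: "i < k" "verts H = colour_class (verts K) c i" using c(4) H(2) by blast
  have "real (k * m) / real k = real m" using two_le_k by simp
  then have "\<forall>A\<in>P. card A = m" using K by (simp add: turan_def)
  then have "\<forall>j<k. card (colour_class (verts K) c j) = m" using c(3) by blast
  moreover have "\<forall>e\<in>edges H. e \<subseteq> colour_class (verts K) c i \<and> card e = 2" using H(1) i(2) by (auto simp: ugraph_def)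
  moreover have "card (edges H) = b" using H(4) biex_eq[OF m0_le[OF m]] by simp
  moreover have "free_of (decomposition_family F) (colour_class (verts K) c i, edges H)" using H(3) i(2) by (metis prod.collapse)
  ultimately show ?thesis using c(1,2) H(5,6) i(1)
    by (intro exI[of _ c] exI[of _ i] exI[of _ "edges H"]) simp
qed

lemma extremal_exists:
  obtains G where "G \<in> free_graphs n {F}" "card (edges G) = ex_edges n F"
proof -
  have "edges F \<noteq> {}" using edges_nonempty_if_chromatic_number[OF F_ugraph] chi two_le_k by simp
  then show ?thesis
    using ex_family_attained[of "{F}" n] F_ugraph that by (auto simp: ex_edges_def)
qed

text \<open>Read off from one extremal graph. The number of cross pairs of a balanced colouring
  depends on \<open>k\<close> and \<open>m\<close> only, so the value can be expressed by any
  balanced \<open>W\<close>.\<close>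

lemma ex_edges_eq:
  assumes m: "m \<ge> m0" and W: "finite W" "c ` W \<subseteq> {..<k}" "\<And>i. i < k \<Longrightarrow> card (colour_class W c i) = m"
  shows "ex_edges (k * m) F = card (cross_edges W c) + b"
proof -
  obtain G where G: "G \<in> free_graphs (k * m) {F}" "card (edges G) = ex_edges (k * m) F"
    by (rule extremal_exists)
  have fin: "finite (verts G)" "finite (edges G)" using G(1) ugraph_finite[of G] ugraph_finite_edges[of G] by (simp_all add: free_graphs_def)
  obtain c' i J where c': "c' ` verts G \<subseteq> {..<k}" "\<forall>j<k. card (colour_class (verts G) c' j) = m"
    "edges G = cross_edges (verts G) c' \<union> J" "\<forall>e\<in>J. e \<subseteq> colour_class (verts G) c' i \<and> card e = 2" "card J = b"
    using extremal_form[OF m G] by blast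
  have "e \<notin> cross_edges (verts G) c'" if "e \<subseteq> colour_class (verts G) c' i" for e
    using that by (auto elim!: cross_edges_cases simp: colour_class_def)
  then have "cross_edges (verts G) c' \<inter> J = {}" using c'(4) by blast
  then have "card (edges G) = card (cross_edges (verts G) c') + b"
    using c'(3,5) fin by (simp add: card_Un_disjoint)
  moreover have "2 * card (cross_edges (verts G) c') = k * m * (k * m - m)"
    using c'(2) by (intro card_cross_edges_balanced[OF fin(1) c'(1)]) auto
  moreover have "2 * card (cross_edges W c) = k * m * (k * m - m)"
    by (rule card_cross_edges_balanced[OF W])
  ultimately show ?thesis using G(2) by linarith
qed

lemma induced_balanced:
  assumes G: "ugraph G" "free_of {F} G" and B: "B \<subseteq> verts G" "c ` B \<subseteq> {..<k}"
    "\<And>i. i < k \<Longrightarrow> card (colour_class B c i) = m"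
  shows "(B, {e \<in> edges G. e \<subseteq> B}) \<in> free_graphs (k * m) {F}"
proof -
  have finB: "finite B" using finite_subset[OF B(1) ugraph_finite[OF G(1)]] .
  have "card B = k * m" using card_eq_sum_colour_class[OF finB B(2)] B(3) by simp
  moreover have "ugraph (B, {e \<in> edges G. e \<subseteq> B})" using G(1) finB by (auto simp: ugraph_def)
  moreover have "free_of {F} (B, {e \<in> edges G. e \<subseteq> B})"
    using G(2) embeds_mono[of F "(B, {e \<in> edges G. e \<subseteq> B})" G] B(1) by (auto simp: Free_iff)
  ultimately show ?thesis by (simp add: free_graphs_def)
qed

text \<open>The given multipartite graph is mapped class by class into a much larger balanced
  extremal graph. As the \<open>b\<close> extra edges there span at most \<open>2 * b\<close>
  vertices, the image of class \<open>i\<close> can be made to cover them, and they are pulled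
  back.\<close>

lemma add_edges_Free:
  assumes V: "finite (V :: nat set)" "c ` V \<subseteq> {..<k}" and i: "i < k" and large: "2 * b \<le> card (colour_class V c i)"
  shows "\<exists>I. card I = b \<and> (\<forall>e\<in>I. e \<subseteq> colour_class V c i \<and> card e = 2) \<and> free_of {F} (V, cross_edges V c \<union> I)"
proof -
  \<comment> \<open>Every class of the extremal graph then has room for any class of
    \<open>V\<close>.\<close>
  define m where "m = m0 + card V"
  obtain G where G: "G \<in> free_graphs (k * m) {F}" "card (edges G) = ex_edges (k * m) F"
    by (rule extremal_exists)
  have uG: "ugraph G" and FG: "free_of {F} G" using G(1) by (auto simp: free_graphs_def)
  have finG: "finite (verts G)" by (rule ugraph_finite[OF uG])
  obtain c' i' J where c': "c' ` verts G \<subseteq> {..<k}" "\<forall>j<k. card (colour_class (verts G) c' j) = m" "i' < k"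
    "edges G = cross_edges (verts G) c' \<union> J" "\<forall>e\<in>J. e \<subseteq> colour_class (verts G) c' i' \<and> card e = 2" "card J = b"
    using extremal_form[OF _ G] by (auto simp: m_def)
  \<comment> \<open>The transposition of \<open>i\<close> and \<open>i'\<close> matches the class
    containing the extra edges with class \<open>i\<close>.\<close>
  define t where "t j = (if j = i then i' else if j = i' then i else j)" for j
  have t: "t j < k" if "j < k" for j using that i c'(3) by (simp add: t_def)
  have t_inj: "t j = t j' \<longleftrightarrow> j = j'" for j j' by (auto simp: t_def)
  define colour_class' where "colour_class' j = colour_class (verts G) c' (t j)" for j
  have colour_class'_card: "card (colour_class' j) = m" if "j < k" for j using c'(2) t[OF that] by (simp add: colour_class'_def)
  have J: "\<Union>J \<subseteq> colour_class' i" using c'(5) by (auto simp: colour_class'_def t_def)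
  have finJ: "finite J"
    using c'(4) ugraph_finite_edges[OF uG] finite_subset[of J "edges G"] by blast
  have cJ: "card (\<Union>J) \<le> 2 * b" using card_Union_edges_le[OF finJ] c'(5,6) by simp
  have maps: "\<exists>f. inj_on f (colour_class V c j) \<and> f ` colour_class V c j \<subseteq> colour_class' j \<and> (j = i \<longrightarrow> \<Union>J \<subseteq> f ` colour_class V c j)" if j: "j < k" for j
  proof -
    have fin: "finite (colour_class V c j)" "finite (colour_class' j)" using V(1) finG by (auto simp: colour_class_def colour_class'_def)
    have "card (colour_class V c j) \<le> card V" using V(1) by (intro card_mono) (auto simp: colour_class_def)
    then have le: "card (colour_class V c j) \<le> card (colour_class' j)" using colour_class'_card[OF j] by (simp add: m_def)
    define S where "S = (if j = i then \<Union>J else {})"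
    have S: "S \<subseteq> colour_class' j" "card S \<le> card (colour_class V c j)" using J cJ large by (auto simp: S_def)
    obtain A where A: "S \<subseteq> A" "A \<subseteq> colour_class' j" "card A = card (colour_class V c j)"
      using exists_subset_between[OF S(2) le S(1) fin(2)] by blast
    have "finite A" using A(2) fin(2) finite_subset by blast
    then obtain f where "bij_betw f (colour_class V c j) A" using finite_same_card_bij[OF fin(1) _ A(3)[symmetric]] by blast
    then have f: "inj_on f (colour_class V c j)" "f ` colour_class V c j = A" by (auto simp: bij_betw_def)
    have "\<Union>J \<subseteq> A" if "j = i" using A(1) unfolding S_def if_P[OF that] .
    then have "j = i \<longrightarrow> \<Union>J \<subseteq> f ` colour_class V c j" unfolding f(2) by (rule impI)
    moreover have "f ` colour_class V c j \<subseteq> colour_class' j" unfolding f(2) by (rule A(2))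
    ultimately show ?thesis using f(1) by blast
  qed
  then have "\<forall>j\<in>{..<k}. \<exists>f. inj_on f (colour_class V c j) \<and> f ` colour_class V c j \<subseteq> colour_class' j \<and> (j = i \<longrightarrow> \<Union>J \<subseteq> f ` colour_class V c j)"
    by (intro ballI maps) (simp only: lessThan_iff)
  from bchoice[OF this] obtain f where f: "\<forall>j\<in>{..<k}. inj_on (f j) (colour_class V c j) \<and> f j ` colour_class V c j \<subseteq> colour_class' j \<and>
      (j = i \<longrightarrow> \<Union>J \<subseteq> f j ` colour_class V c j)" ..
  define \<psi> where "\<psi> v = f (c v) v" for v
  have cV: "c v < k" if "v \<in> V" for v using V(2) that by auto
  have f_inj: "inj_on (f j) (colour_class V c j)" and f_sub: "f j ` colour_class V c j \<subseteq> colour_class' j" if "j < k" for j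
    using bspec[OF f, of j] that by simp_all
  have f_J: "\<Union>J \<subseteq> f i ` colour_class V c i" using bspec[OF f, of i] i by simp
  have v_cl: "v \<in> colour_class V c (c v)" if "v \<in> V" for v using that by (simp add: colour_class_def)
  have \<psi>_cl: "\<psi> v \<in> colour_class' (c v)" if "v \<in> V" for v
    unfolding \<psi>_def by (rule subsetD[OF f_sub[OF cV[OF that]] imageI[OF v_cl[OF that]]])
  then have \<psi>V: "\<psi> v \<in> verts G" and \<psi>c: "c' (\<psi> v) = t (c v)" if "v \<in> V" for v
    using that by (simp_all add: colour_class'_def colour_class_def)
  have \<psi>_inj: "inj_on \<psi> V"
  proof (rule inj_onI)
    fix u v assume uv: "u \<in> V" "v \<in> V" "\<psi> u = \<psi> v"
    then have cuv: "c u = c v" using \<psi>c[OF uv(1)] \<psi>c[OF uv(2)] t_inj by simp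
    then have "f (c v) u = f (c v) v" using uv(3) by (simp add: \<psi>_def)
    moreover have "u \<in> colour_class V c (c v)" using v_cl[OF uv(1)] cuv by simp
    ultimately show "u = v" using inj_onD[OF f_inj[OF cV[OF uv(2)]]] v_cl[OF uv(2)] by blast
  qed
  define I where "I = {e \<in> Pow (colour_class V c i). \<psi> ` e \<in> J}"
  have clV: "colour_class V c i \<subseteq> V" by (auto simp: colour_class_def)
  have "\<psi> ` colour_class V c i = f i ` colour_class V c i" by (intro image_cong) (auto simp: \<psi>_def colour_class_def)
  then have J_sub: "\<Union>J \<subseteq> \<psi> ` colour_class V c i" using f_J by simp
  have bij: "bij_betw (\<lambda>e. \<psi> ` e) I J"
    unfolding bij_betw_def
  proof
    show "inj_on (\<lambda>e. \<psi> ` e) I"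
      using inj_on_image_Pow[OF \<psi>_inj] by (rule inj_on_subset) (use clV in \<open>auto simp: I_def\<close>)
    show "(\<lambda>e. \<psi> ` e) ` I = J"
    proof (intro equalityI subsetI)
      fix e assume e: "e \<in> J"
      then have "e \<subseteq> \<psi> ` colour_class V c i" using J_sub by blast
      then obtain e' where "e' \<subseteq> colour_class V c i" "e = \<psi> ` e'" by (auto simp: subset_image_iff)
      then show "e \<in> (\<lambda>e. \<psi> ` e) ` I" using e by (auto simp: I_def)
    qed (auto simp: I_def)
  qed
  have "card I = b" using bij_betw_same_card[OF bij] c'(6) by simp
  moreover have "e \<subseteq> colour_class V c i \<and> card e = 2" if e: "e \<in> I" for e
  proof -
    have "e \<subseteq> colour_class V c i" "\<psi> ` e \<in> J" using e by (auto simp: I_def)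
    moreover from this have "card (\<psi> ` e) = card e"
      using inj_on_subset[OF \<psi>_inj, of e] clV by (intro card_image) blast
    ultimately show ?thesis using c'(5) by simp
  qed
  moreover have "free_of {F} (V, cross_edges V c \<union> I)"
    unfolding Free_iff
  proof
    assume "embeds F (V, cross_edges V c \<union> I)"
    then obtain h where h: "inj_on h (verts F)" "h ` verts F \<subseteq> V" "\<forall>e\<in>edges F. h ` e \<in> cross_edges V c \<union> I"
      by (auto simp: embeds_def)
    have "embeds F G"
      unfolding embeds_def
    proof (intro exI[of _ "\<psi> \<circ> h"] conjI ballI)
      show "inj_on (\<psi> \<circ> h) (verts F)" using h(1,2) \<psi>_inj by (meson comp_inj_on inj_on_subset)
      show "(\<psi> \<circ> h) ` verts F \<subseteq> verts G" using h(2) \<psi>V by auto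
      fix e assume "e \<in> edges F"
      then have "h ` e \<in> cross_edges V c \<or> h ` e \<in> I" using h(3) by blast
      then have "\<psi> ` h ` e \<in> edges G"
      proof
        assume "h ` e \<in> cross_edges V c"
        then obtain u v where "h ` e = {u, v}" "u \<in> V" "v \<in> V" "c u \<noteq> c v" by (rule cross_edges_cases)
        then show ?thesis using \<psi>V \<psi>c t_inj unfolding c'(4) by (simp add: cross_edges_iff)
      next
        assume "h ` e \<in> I"
        then show ?thesis unfolding c'(4) I_def by blast
      qed
      then show "(\<psi> \<circ> h) ` e \<in> edges G" by (simp add: image_comp)
    qed
    then show False using FG by (simp add: Free_iff)
  qed
  ultimately show ?thesis by blast
qed

lemma replace_vertex_Free:
  assumes G: "ugraph G" "free_of {F} G" and v: "v \<in> verts G" and N: "N \<subseteq> verts G - {v}"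
    and common: "\<And>Q. Q \<subseteq> N \<Longrightarrow> card Q \<le> card (verts F) \<Longrightarrow>
      card (verts F) \<le> card {u \<in> verts G - {v}. Q \<subseteq> neighbours G u}"
  shows "free_of {F} (verts G, {e \<in> edges G. v \<notin> e} \<union> {{v, u} |u. u \<in> N})"
  unfolding Free_iff
proof
  define E' where "E' = {e \<in> edges G. v \<notin> e} \<union> {{v, u} |u. u \<in> N}"
  assume "embeds F (verts G, {e \<in> edges G. v \<notin> e} \<union> {{v, u} |u. u \<in> N})"
  then obtain f where f: "inj_on f (verts F)" "f ` verts F \<subseteq> verts G" "\<forall>e\<in>edges F. f ` e \<in> E'"
    by (auto simp: embeds_def E'_def)
  have finF: "finite (verts F)" by (rule ugraph_finite[OF F_ugraph])
  have old: "e \<in> edges G" if "e \<in> E'" "v \<notin> e" for e using that by (auto simp: E'_def)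
  have "embeds F G"
  proof (cases "v \<in> f ` verts F")
    case False
    have "f ` e \<in> edges G" if e: "e \<in> edges F" for e
    proof -
      have "e \<subseteq> verts F" using F_ugraph e by (simp add: ugraph_def)
      then have "v \<notin> f ` e" using False by blast
      then show ?thesis using f(3) e old by blast
    qed
    then show ?thesis using f unfolding embeds_def by blast
  next
    case True
    then obtain x where x: "x \<in> verts F" "f x = v" by blast
    define Q where "Q = f ` neighbours F x"
    have nb: "neighbours F x \<subseteq> verts F - {x}" using neighbours_subset[OF F_ugraph] not_self_neighbours[OF F_ugraph] by blast
    have "Q \<subseteq> N"
    proof
      fix q assume "q \<in> Q"
      then obtain y where y: "{x, y} \<in> edges F" "q = f y" by (auto simp: Q_def mem_neighbours)
      then have "{v, q} \<in> E'" using f(3) x(2) by force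
      then show "q \<in> N" using N by (auto simp: E'_def doubleton_eq_iff)
    qed
    moreover have "card Q \<le> card (verts F)"
      unfolding Q_def using card_image_le[of "neighbours F x" f] card_mono[OF finF, of "neighbours F x"] nb
        finite_neighbours[OF F_ugraph, of x] by fastforce
    ultimately have big: "card (verts F) \<le> card {u \<in> verts G - {v}. Q \<subseteq> neighbours G u}" by (rule common)
    have "card (f ` (verts F - {x})) < card (verts F)"
      using card_image_le[of "verts F - {x}" f] finF x(1) card_Diff1_less[OF finF x(1)] by simp
    then have "\<not> {u \<in> verts G - {v}. Q \<subseteq> neighbours G u} \<subseteq> f ` (verts F - {x})"
      using big card_mono[of "f ` (verts F - {x})" "{u \<in> verts G - {v}. Q \<subseteq> neighbours G u}"] finF by force
    then obtain u where u: "u \<in> verts G" "u \<noteq> v" "Q \<subseteq> neighbours G u" "u \<notin> f ` (verts F - {x})" by blast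
    define f' where "f' = f(x := u)"
    show ?thesis
      unfolding embeds_def
    proof (intro exI[of _ f'] conjI ballI)
      show "inj_on f' (verts F)"
        using f(1) u(4) unfolding inj_on_def f'_def by (auto simp: image_iff)
      show "f' ` verts F \<subseteq> verts G" using f(2) u(1) by (auto simp: f'_def)
      fix e assume e: "e \<in> edges F"
      have eF: "e \<subseteq> verts F" using F_ugraph e by (simp add: ugraph_def)
      show "f' ` e \<in> edges G"
      proof (cases "x \<in> e")
        case True
        obtain a b' where ab: "e = {a, b'}" "a \<noteq> b'" using ugraph_edge_cases[OF F_ugraph e] by metis
        define y where "y = (if x = a then b' else a)"
        have y: "e = {x, y}" "y \<noteq> x" using ab True by (auto simp: y_def)
        then have "y \<in> neighbours F x" using e by (simp add: mem_neighbours)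
        then have "f y \<in> neighbours G u" using u(3) by (auto simp: Q_def)
        moreover have "f' ` e = {u, f y}" using y by (auto simp: f'_def)
        ultimately show ?thesis by (simp add: mem_neighbours)
      next
        case False
        have "f' ` e = f ` e" using False by (intro image_cong) (auto simp: f'_def)
        moreover have "v \<notin> f ` e"
        proof
          assume "v \<in> f ` e"
          then obtain y where "y \<in> e" "f y = f x" using x(2) by auto
          then have "y = x" using inj_onD[OF f(1), of y x] eF x(1) by blast
          then show False using False \<open>y \<in> e\<close> by simp
        qed
        ultimately show ?thesis using f(3) e old by auto
      qed
    qed
  qed
  then show False using G(2) by (simp add: Free_iff)
qed

lemma excess_bounded_Free: "excess_bounded (free_of {F}) k b (card (verts F)) m0"
proof
  show "2 \<le> k" by (rule two_le_k)
  show "card {e \<in> edges G. e \<subseteq> B} \<le> card (cross_edges B c) + b"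
    if "ugraph G" "free_of {F} G" "B \<subseteq> verts G" "c ` B \<subseteq> {..<k}" "m0 \<le> m" "\<And>i. i < k \<Longrightarrow> card (colour_class B c i) = m"
    for G :: "nat ugraph" and B c m
  proof -
    have "card (edges (B, {e \<in> edges G. e \<subseteq> B})) \<le> ex_edges (k * m) F"
      unfolding ex_edges_def by (rule card_edges_le_ex_family[OF induced_balanced[OF that(1-4,6)]])
    moreover have "finite B" using finite_subset[OF that(3) ugraph_finite[OF that(1)]] .
    ultimately show ?thesis using ex_edges_eq[OF that(5) _ that(4,6)] by simp
  qed
  show "\<exists>I. card I = b \<and> (\<forall>e\<in>I. e \<subseteq> colour_class V c i \<and> card e = 2) \<and> free_of {F} (V, cross_edges V c \<union> I)"
    if "finite V" "c ` V \<subseteq> {..<k}" "i < k" "2 * b \<le> card (colour_class V c i)" for V :: "nat set" and c i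
    by (rule add_edges_Free[OF that])
  show "free_of {F} G'" if "ugraph G" "free_of {F} G" "ugraph G'" "verts G' \<subseteq> verts G" "edges G' \<subseteq> edges G"
    for G G' :: "nat ugraph"
    using that embeds_mono unfolding Free_iff by blast
  show "free_of {F} (verts G, {e \<in> edges G. v \<notin> e} \<union> {{v, u} |u. u \<in> N})"
    if "ugraph G" "free_of {F} G" "v \<in> verts G" "N \<subseteq> verts G - {v}"
      "\<And>Q. Q \<subseteq> N \<Longrightarrow> card Q \<le> card (verts F) \<Longrightarrow> card (verts F) \<le> card {u \<in> verts G - {v}. Q \<subseteq> neighbours G u}"
    for G :: "nat ugraph" and v N
    by (rule replace_vertex_Free[OF that])
qed

text \<open>When the balanced subgraph attains the extremal number, its Turan partition must be the given
  colouring: vertices of one colour in different parts would create too many edges inside that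
  colour.\<close>

lemma structure_from_balanced:
  assumes G: "G \<in> free_graphs n {F}" and n: "n \<ge> m0" and col: "c ` verts G \<subseteq> {..<k}" and m: "m \<ge> m0"
    and B: "B \<subseteq> verts G" "\<forall>i<k. card (colour_class B c i) = m"
    and eq: "card {e \<in> edges G. e \<subseteq> B} = card (cross_edges B c) + b"
    and diff: "\<Union>((edges G - cross_edges (verts G) c) \<union> (cross_edges (verts G) c - edges G)) \<subseteq> B"
    and few: "card (edges G - cross_edges (verts G) c) + 2 < m"
  shows "\<exists>K P. complete_partite k P K \<and> add_in_part F (biex n F) K P G"
proof -
  have uG: "ugraph G" and FG: "free_of {F} G" using G by (auto simp: free_graphs_def)
  define I where "I = edges G - cross_edges (verts G) c"
  have fin: "finite (verts G)" "finite B" "finite (edges G)" "finite I"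
    using ugraph_finite[OF uG] finite_subset[OF B(1)] ugraph_finite_edges[OF uG] by (simp_all add: I_def)
  have colB: "c ` B \<subseteq> {..<k}" using col B(1) by blast
  define GB where "GB = (B, {e \<in> edges G. e \<subseteq> B})"
  have GB: "GB \<in> free_graphs (k * m) {F}"
    unfolding GB_def using B(2) by (intro induced_balanced[OF uG FG B(1) colB]) auto
  have "card (edges GB) = ex_edges (k * m) F"
    using eq ex_edges_eq[OF m fin(2) colB] B(2) by (simp add: GB_def)
  from extremal_form[OF m GB this] have "\<exists>c' i' J. c' ` B \<subseteq> {..<k} \<and> (\<forall>j<k. card (colour_class B c' j) = m) \<and> i' < k \<and>
    {e \<in> edges G. e \<subseteq> B} = cross_edges B c' \<union> J \<and> (\<forall>e\<in>J. e \<subseteq> colour_class B c' i' \<and> card e = 2) \<and> card J = b \<and>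
    free_of (decomposition_family F) (colour_class B c' i', J)"
    unfolding GB_def fst_conv snd_conv .
  then obtain c' i' J where
    c': "c' ` B \<subseteq> {..<k}" "\<forall>j<k. card (colour_class B c' j) = m" "i' < k"
      "{e \<in> edges G. e \<subseteq> B} = cross_edges B c' \<union> J" "\<forall>e\<in>J. e \<subseteq> colour_class B c' i' \<and> card e = 2" "card J = b"
      "free_of (decomposition_family F) (colour_class B c' i', J)"
    by (elim exE conjE)
  have same: "c' u = c' w" if uw: "u \<in> B" "w \<in> B" "c u = c w" for u w
  proof (rule ccontr)
    assume ne: "c' u \<noteq> c' w"
    define S where "S = colour_class B c (c u) - {u, w}"
    \<comment> \<open>Every other vertex \<open>x\<close> of this colour is in a different part from
      \<open>u\<close> or from \<open>w\<close>, hence adjacent to that one. These edges are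
      distinct and lie inside the colour class, giving at least \<open>m - 2\<close> edges of
      \<open>I\<close>.\<close>
    define p where "p x = (if c' x \<noteq> c' u then u else w)" for x
    have pI: "{x, p x} \<in> I" if x: "x \<in> S" for x
    proof -
      have "c' x \<noteq> c' (p x)" using ne by (auto simp: p_def)
      moreover have "x \<in> B" "p x \<in> B" "c x = c (p x)" using x uw by (auto simp: S_def colour_class_def p_def)
      ultimately have "{x, p x} \<in> {e \<in> edges G. e \<subseteq> B}" unfolding c'(4) by (simp add: cross_edges_iff)
      then show ?thesis using \<open>c x = c (p x)\<close> by (simp add: I_def cross_edges_iff)
    qed
    have "inj_on (\<lambda>x. {x, p x}) S"
      by (rule inj_onI) (auto simp: doubleton_eq_iff S_def p_def split: if_splits)
    then have "card S \<le> card I" using pI fin(4) by (intro card_inj_on_le) auto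
    moreover have "m \<le> card S + 2"
    proof -
      have "c u < k" using colB uw by auto
      then have "card (colour_class B c (c u)) = m" using B(2) by blast
      moreover have "card (colour_class B c (c u)) \<le> card S + card {u, w}"
        unfolding S_def using diff_card_le_card_Diff[of "{u, w}" "colour_class B c (c u)"] by simp
      moreover have "card {u, w} \<le> 2" by (simp add: card_insert_if)
      ultimately show ?thesis by linarith
    qed
    ultimately show False using few by (simp add: I_def)
  qed
  have cl_eq: "colour_class B c (c u) = colour_class B c' (c' u)" if u: "u \<in> B" for u
  proof (rule card_subset_eq)
    show "finite (colour_class B c' (c' u))" using fin(2) by (simp add: finite_colour_class)
    show "colour_class B c (c u) \<subseteq> colour_class B c' (c' u)"
    proof
      fix w assume "w \<in> colour_class B c (c u)"
      then have w: "w \<in> B" "c w = c u" by (simp_all add: colour_class_def)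
      then show "w \<in> colour_class B c' (c' u)" using same[OF w(1) u w(2)] by (simp add: colour_class_def)
    qed
    have "c u < k" "c' u < k" using colB c'(1) u by auto
    then show "card (colour_class B c (c u)) = card (colour_class B c' (c' u))" using B(2) c'(2) by simp
  qed
  have iff: "c u = c w \<longleftrightarrow> c' u = c' w" if "u \<in> B" "w \<in> B" for u w
  proof
    assume "c' u = c' w"
    then have "u \<in> colour_class B c' (c' w)" using that(1) by (simp add: colour_class_def)
    then show "c u = c w" using cl_eq[OF that(2)] by (auto simp: colour_class_def)
  qed (use same that in blast)
  have cpe_sub: "cross_edges (verts G) c \<subseteq> edges G"
  proof
    fix e assume e: "e \<in> cross_edges (verts G) c"
    show "e \<in> edges G"
    proof (rule ccontr)
      assume "e \<notin> edges G"
      then have "e \<subseteq> B" using e diff by blast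
      moreover obtain u v where "e = {u, v}" "c u \<noteq> c v" using e by (rule cross_edges_cases)
      ultimately have "e \<in> cross_edges B c'" using iff by (simp add: cross_edges_iff)
      then have "e \<in> {e \<in> edges G. e \<subseteq> B}" unfolding c'(4) by simp
      then show False using \<open>e \<notin> edges G\<close> by simp
    qed
  qed
  have IJ: "I = J"
  proof (intro equalityI subsetI)
    fix e assume e: "e \<in> I"
    then have eB: "e \<subseteq> B" and eG: "e \<in> edges G" using diff by (auto simp: I_def)
    then have "e \<in> cross_edges B c' \<or> e \<in> J" using c'(4) by blast
    moreover have "e \<notin> cross_edges B c'"
    proof
      assume "e \<in> cross_edges B c'"
      then obtain u v where "e = {u, v}" "u \<in> B" "v \<in> B" "c' u \<noteq> c' v" by (rule cross_edges_cases)
      then have "e \<in> cross_edges (verts G) c" using iff B(1) by (auto simp: cross_edges_iff)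
      then show False using e by (simp add: I_def)
    qed
    ultimately show "e \<in> J" by simp
  next
    fix e assume e: "e \<in> J"
    then have eG: "e \<in> edges G" and eB: "e \<subseteq> colour_class B c' i'" using c'(4,5) by auto
    have "e \<notin> cross_edges (verts G) c"
    proof
      assume "e \<in> cross_edges (verts G) c"
      then obtain u v where uv: "e = {u, v}" "c u \<noteq> c v" by (rule cross_edges_cases)
      then have "u \<in> B" "v \<in> B" "c' u = c' v" using eB by (auto simp: colour_class_def)
      then show False using iff uv(2) by simp
    qed
    then show "e \<in> I" using eG by (simp add: I_def)
  qed
  have "m \<ge> 1" using m m0_ge(2) by simp
  then have "colour_class B c' i' \<noteq> {}" using c'(2,3) by (metis card.empty not_one_le_zero)
  then obtain u where u: "u \<in> B" "c' u = i'" by (auto simp: colour_class_def)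
  define A where "A = colour_class (verts G) c (c u)"
  have J_A: "e \<subseteq> A" if "e \<in> J" for e
  proof -
    have "e \<subseteq> colour_class B c (c u)" using c'(5) that cl_eq[OF u(1)] u(2) by simp
    then show ?thesis using B(1) by (auto simp: A_def colour_class_def)
  qed
  \<comment> \<open>Freeness is known for the class of \<open>B\<close>, which has \<open>m\<close>
    vertices. As no member of the family is larger, it carries over to the whole class
    \<open>A\<close> with the same edges.\<close>
  have D: "\<forall>D\<in>decomposition_family F. ugraph D \<and> card (verts D) \<le> card (verts (colour_class B c' i', J))"
  proof
    fix D assume "D \<in> decomposition_family F"
    then show "ugraph D \<and> card (verts D) \<le> card (verts (colour_class B c' i', J))"
      using decomposition_family_props[OF F_ugraph, of D] c'(2,3) m m0_ge(1) by simp
  qed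
  have "ugraph (colour_class B c' i', J)" using c'(5) fin(2) by (auto simp: ugraph_def finite_colour_class)
  from free_of_same_edges[OF D this _ c'(7)] have free_A: "free_of (decomposition_family F) (A, J)" by simp
  define P where "P = colour_class (verts G) c ` {..<k}"
  have ne: "colour_class (verts G) c i \<noteq> {}" if "i < k" for i
  proof -
    have "colour_class B c i \<noteq> {}" using B(2) that \<open>m \<ge> 1\<close> by (metis card.empty not_one_le_zero)
    then show ?thesis using B(1) by (auto simp: colour_class_def)
  qed
  have "complete_partite k P (verts G, cross_edges (verts G) c)"
    unfolding P_def using ne by (intro complete_partite_of_colouring fin(1) col)
  moreover have "add_in_part F (biex n F) (verts G, cross_edges (verts G) c) P G"
    unfolding add_in_part_def
  proof (intro exI[of _ "(A, J)"] conjI)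
    show "ugraph (A, J)" using J_A c'(5) fin(1) by (auto simp: ugraph_def A_def finite_colour_class)
    show "verts (A, J) \<in> P" using col u(1) B(1) by (auto simp: A_def P_def)
    show "free_of (decomposition_family F) (A, J)" by (rule free_A)
    show "card (edges (A, J)) = biex n F" using c'(6) biex_eq[OF n] by simp
    show "edges G = edges (verts G, cross_edges (verts G) c) \<union> edges (A, J)"
      using cpe_sub IJ by (auto simp: I_def)
  qed simp
  ultimately show ?thesis by blast
qed

lemma degree_sum_maximal_structure:
  assumes g: "degree_function g s C"
  shows "\<exists>N. \<forall>n\<ge>N. \<forall>G\<in>free_graphs n {F}. (\<forall>G'\<in>free_graphs n {F}. degree_sum g G' \<le> degree_sum g G) \<longrightarrow>
    (\<exists>K P. complete_partite k P K \<and> add_in_part F (biex n F) K P G)"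
proof -
  interpret eb: excess_bounded "free_of {F}" k b "card (verts F)" m0 by (rule excess_bounded_Free)
  interpret dg: degree_function g s C by (rule g)
  interpret es: extremal_setting "free_of {F}" k b "card (verts F)" m0 g s C by unfold_locales
  from es.extremal_structure[of m0] obtain N where N: "\<forall>G. es.opt G \<and> card (verts G) \<ge> N \<longrightarrow>
    (\<exists>c m B. c ` verts G \<subseteq> {..<k} \<and> m \<ge> m0 \<and> B \<subseteq> verts G \<and> (\<forall>i<k. card (colour_class B c i) = m) \<and>
      card {e \<in> edges G. e \<subseteq> B} = card (cross_edges B c) + b \<and>
      \<Union>((edges G - cross_edges (verts G) c) \<union> (cross_edges (verts G) c - edges G)) \<subseteq> B \<and>
      card (edges G - cross_edges (verts G) c) + 2 < m)" ..
  show ?thesis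
  proof (intro exI[of _ "N + m0"] allI ballI impI)
    fix n G assume n: "N + m0 \<le> n" and G: "G \<in> free_graphs n {F}"
      and max: "\<forall>G'\<in>free_graphs n {F}. degree_sum g G' \<le> degree_sum g G"
    have "es.opt G"
      unfolding es.opt_def using G max by (auto simp: free_graphs_def)
    moreover have "N \<le> card (verts G)" using G n by (simp add: free_graphs_def)
    ultimately have "\<exists>c m B. c ` verts G \<subseteq> {..<k} \<and> m \<ge> m0 \<and> B \<subseteq> verts G \<and> (\<forall>i<k. card (colour_class B c i) = m) \<and>
      card {e \<in> edges G. e \<subseteq> B} = card (cross_edges B c) + b \<and>
      \<Union>((edges G - cross_edges (verts G) c) \<union> (cross_edges (verts G) c - edges G)) \<subseteq> B \<and>
      card (edges G - cross_edges (verts G) c) + 2 < m"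
      by (intro N[rule_format]) simp
    then obtain c m B where "c ` verts G \<subseteq> {..<k}" "m \<ge> m0" "B \<subseteq> verts G" "\<forall>i<k. card (colour_class B c i) = m"
      "card {e \<in> edges G. e \<subseteq> B} = card (cross_edges B c) + b"
      "\<Union>((edges G - cross_edges (verts G) c) \<union> (cross_edges (verts G) c - edges G)) \<subseteq> B"
      "card (edges G - cross_edges (verts G) c) + 2 < m"
      by (elim exE conjE)
    then show "\<exists>K P. complete_partite k P K \<and> add_in_part F (biex n F) K P G"
      using n by (intro structure_from_balanced[OF G]) auto
  qed
qed

end

section \<open>The two functionals and the conclusion\<close>

lemma degree_power_sum_eq_degree_sum: "real (degree_power_sum r G) = degree_sum (\<lambda>d. real d ^ r) G"
  by (simp add: degree_power_sum_def degree_sum_def)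

text \<open>The factor is (s+1)! for at least two leaves. For s = 0 it is 2, because every edge is
  one copy of the star but contributes to two degrees.\<close>

lemma num_copies_star_eq_degree_sum:
  "\<exists>\<rho>>0. \<forall>G :: 'a ugraph. ugraph G \<longrightarrow>
     \<rho> * real (num_copies (star (Suc s)) G) = degree_sum (\<lambda>d. fact (Suc s) * real (d choose Suc s)) G"
proof (cases "s = 0")
  case True
  have "2 * real (num_copies (star (Suc 0)) G) = degree_sum (\<lambda>d. real d) G" if G: "ugraph G" for G :: "'a ugraph"
  proof -
    have "real (\<Sum>v\<in>verts G. degree G v) = real (2 * card (edges G))" using handshake[OF G] by simp
    then show ?thesis using num_copies_star_1[OF G] by (simp add: degree_sum_def)
  qed
  then show ?thesis using True by (intro exI[of _ 2]) simp
next
  case False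
  have "fact (Suc s) * real (num_copies (star (Suc s)) G) = degree_sum (\<lambda>d. fact (Suc s) * real (d choose Suc s)) G"
    if G: "ugraph G" for G :: "'a ugraph"
  proof -
    have "num_copies (star (Suc s)) G = (\<Sum>v\<in>verts G. degree G v choose Suc s)"
      using False by (intro num_copies_star_ge_2[OF G]) simp
    then have "real (num_copies (star (Suc s)) G) = (\<Sum>v\<in>verts G. real (degree G v choose Suc s))"
      by (simp only: of_nat_sum)
    then show ?thesis unfolding degree_sum_def by (simp only: sum_distrib_left)
  qed
  then show ?thesis by (intro exI[of _ "fact (Suc s)"]) (simp del: fact_Suc)
qed

text \<open>A crude bound by the number of pairs of a vertex set and an edge set. It serves to bound
  the range of the parameter, so that its maximum over infinitely many host graphs exists.\<close>

lemma num_copies_le: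
  assumes "ugraph G"
  shows "num_copies H G \<le> 2 ^ card (verts G) * 2 ^ 2 ^ card (verts G)"
proof -
  have fin: "finite (verts G)" by (rule ugraph_finite[OF assms])
  have "copies H G \<subseteq> Pow (verts G) \<times> Pow (Pow (verts G))"
  proof
    fix X assume "X \<in> copies H G"
    then have X: "ugraph X" "verts X \<subseteq> verts G" by (auto simp: copies_def subgraph_def)
    then have "edges X \<subseteq> Pow (verts G)" unfolding ugraph_def by blast
    with X(2) show "X \<in> Pow (verts G) \<times> Pow (Pow (verts G))" by (simp add: mem_Times_iff)
  qed
  then have "card (copies H G) \<le> card (Pow (verts G) \<times> Pow (Pow (verts G)))"
    using fin by (intro card_mono) auto
  then show ?thesis using fin by (simp add: num_copies_def card_cartesian_product card_Pow)
qed

lemma le_ex_copies: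
  assumes "G \<in> free_graphs n {F}"
  shows "num_copies H G \<le> ex_copies n H F"
  unfolding ex_copies_def
proof (rule Max_ge)
  show "finite (num_copies H ` free_graphs n {F})"
    by (rule finite_subset[of _ "{..2 ^ n * 2 ^ 2 ^ n}"])
      (auto simp: free_graphs_def dest: num_copies_le[of _ H])
qed (use assms in simp)

lemma le_ex_degree_power:
  assumes "G \<in> free_graphs n {F}"
  shows "degree_power_sum r G \<le> ex_degree_power r n F"
  unfolding ex_degree_power_def
proof (rule Max_ge)
  have bound: "degree_power_sum r G \<le> n * n ^ r" if G: "G \<in> free_graphs n {F}" for G
  proof -
    have uG: "ugraph G" "card (verts G) = n" using G by (auto simp: free_graphs_def)
    have "degree G v \<le> n" for v
      using card_mono[OF ugraph_finite[OF uG(1)] neighbours_subset[OF uG(1)]] uG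
      by (simp add: degree_eq_card_neighbours)
    then have "degree_power_sum r G \<le> (\<Sum>v\<in>verts G. n ^ r)"
      unfolding degree_power_sum_def by (intro sum_mono power_mono) auto
    then show ?thesis using uG(2) by simp
  qed
  have "degree_power_sum r ` free_graphs n {F} \<subseteq> {..n * n ^ r}"
    unfolding image_subset_iff atMost_iff using bound by blast
  then show "finite (degree_power_sum r ` free_graphs n {F})" by (rule finite_subset) simp
qed (use assms in simp)

theorem theorem1p9:
  fixes F :: "'a ugraph" and r :: nat
  assumes "ugraph F" and "chromatic_number F \<ge> 3" and "r \<ge> 1"
    and "(\<lambda>n. real (biex n F)) \<in> O(\<lambda>_. 1)"
    and "\<forall>\<^sub>F n in sequentially. \<forall>G \<in> free_graphs n {F}. card (edges G) = ex_edges n F \<longrightarrow>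
           (\<exists>K P. turan n (chromatic_number F - 1) P K \<and> add_in_part F (biex n F) K P G)"
  shows "\<forall>\<^sub>F n in sequentially. \<forall>G \<in> free_graphs n {F}.
           (num_copies (star r) G = ex_copies n (star r) F \<or>
            degree_power_sum r G = ex_degree_power r n F) \<longrightarrow>
           (\<exists>K P. complete_partite (chromatic_number F - 1) P K \<and> add_in_part F (biex n F) K P G)"
proof -
  define k where "k = chromatic_number F - 1"
  obtain b N1 where N1: "\<forall>n\<ge>N1. biex n F = b" using biex_eventually_constant[OF assms(1,4)] by blast
  obtain N2 where N2: "\<forall>n\<ge>N2. \<forall>G \<in> free_graphs n {F}. card (edges G) = ex_edges n F \<longrightarrow>
      (\<exists>K P. turan n k P K \<and> add_in_part F (biex n F) K P G)"
    using assms(5) unfolding eventually_sequentially k_def ..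
  interpret turan_extremal F k b "N1 + N2 + card (verts F) + 1"
  proof
    show "\<exists>K P. turan n k P K \<and> add_in_part F (biex n F) K P G"
      if "N1 + N2 + card (verts F) + 1 \<le> n" "G \<in> free_graphs n {F}" "card (edges G) = ex_edges n F" for n G
      using N2 that by simp
  qed (use assms(1,2) N1 in \<open>auto simp: k_def\<close>)
  obtain s where s: "r = Suc s" using assms(3) by (cases r) auto
  obtain C1 where "degree_function (\<lambda>d. real d ^ Suc s) s C1" using degree_function_power by blast
  from degree_sum_maximal_structure[OF this] obtain M1 where M1: "\<forall>n\<ge>M1. \<forall>G\<in>free_graphs n {F}.
    (\<forall>G'\<in>free_graphs n {F}. degree_sum (\<lambda>d. real d ^ Suc s) G' \<le> degree_sum (\<lambda>d. real d ^ Suc s) G) \<longrightarrow>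
    (\<exists>K P. complete_partite k P K \<and> add_in_part F (biex n F) K P G)" ..
  obtain C2 where "degree_function (\<lambda>d. fact (Suc s) * real (d choose Suc s)) s C2"
    using degree_function_choose by blast
  from degree_sum_maximal_structure[OF this] obtain M2 where M2: "\<forall>n\<ge>M2. \<forall>G\<in>free_graphs n {F}.
    (\<forall>G'\<in>free_graphs n {F}. degree_sum (\<lambda>d. fact (Suc s) * real (d choose Suc s)) G' \<le>
       degree_sum (\<lambda>d. fact (Suc s) * real (d choose Suc s)) G) \<longrightarrow>
    (\<exists>K P. complete_partite k P K \<and> add_in_part F (biex n F) K P G)" ..
  obtain \<rho> where \<rho>: "\<rho> > 0" "\<forall>G :: nat ugraph. ugraph G \<longrightarrow>
     \<rho> * real (num_copies (star (Suc s)) G) = degree_sum (\<lambda>d. fact (Suc s) * real (d choose Suc s)) G"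
    using num_copies_star_eq_degree_sum[of s] by blast
  show ?thesis
    unfolding eventually_sequentially k_def[symmetric]
  proof (intro exI[of _ "M1 + M2"] allI impI ballI)
    fix n G assume n: "M1 + M2 \<le> n" and G: "G \<in> free_graphs n {F}"
      and opt: "num_copies (star r) G = ex_copies n (star r) F \<or> degree_power_sum r G = ex_degree_power r n F"
    from opt show "\<exists>K P. complete_partite k P K \<and> add_in_part F (biex n F) K P G"
    proof
      assume max: "num_copies (star r) G = ex_copies n (star r) F"
      have "degree_sum (\<lambda>d. fact (Suc s) * real (d choose Suc s)) G' \<le> degree_sum (\<lambda>d. fact (Suc s) * real (d choose Suc s)) G"
        if G': "G' \<in> free_graphs n {F}" for G'
      proof -
        have "real (num_copies (star (Suc s)) G') \<le> real (num_copies (star (Suc s)) G)"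
          using le_ex_copies[OF G', of "star r"] max s by simp
        then have "\<rho> * real (num_copies (star (Suc s)) G') \<le> \<rho> * real (num_copies (star (Suc s)) G)"
          using \<rho>(1) by simp
        moreover have "ugraph G" "ugraph G'" using G G' by (simp_all add: free_graphs_def)
        ultimately show ?thesis using \<rho>(2)[rule_format, of G] \<rho>(2)[rule_format, of G'] by linarith
      qed
      then show ?thesis using M2 n G by (meson add_leD2)
    next
      assume max: "degree_power_sum r G = ex_degree_power r n F"
      have "degree_sum (\<lambda>d. real d ^ Suc s) G' \<le> degree_sum (\<lambda>d. real d ^ Suc s) G" if G': "G' \<in> free_graphs n {F}" for G'
      proof -
        have "real (degree_power_sum (Suc s) G') \<le> real (degree_power_sum (Suc s) G)"
          using le_ex_degree_power[OF G', of r] max s by simp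
        then show ?thesis by (simp only: degree_power_sum_eq_degree_sum)
      qed
      then show ?thesis using M1 n G by (meson add_leD1)
    qed
  qed
qed

end
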